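(* For each $n$, let $G=G(n)$ be an instance of the degree-corrected stochastic block model on $n$ vertices (see context) and let $\rho$ be a uniformly picked vertex in $V(G)$. Let $T$, $\tau$ and $\psi$ be, respectively, a random instance of the branching process $T^{\mathrm{Poi}}$ (see context), its spins and its weights. There exists an unbounded non-decreasing function $R:\mathbb N\to\mathbb N$ such that $$\left\|\left(G_{R(n)}(\rho),\sigma_{G_{R(n)}},\phi_{G_{R(n)}}\right)-\left(T_{R(n)},\tau_{T_{R(n)}},\psi_{T_{R(n)}}\right)\right\|_{\mathrm{TV}}=o_n(1),$$ and $$\mathbb P\left(|G_{R(n)}|\le n^{1/9}\right)=1-o_n(1).$$
   Context: Degree-corrected stochastic block model (DC-SBM). Fix an integer $q\ge 2$, constants $a,b>0$, a constant $\phi_{\min}\in(0,\infty)$ and a probability law $\nu$ with support in a set $W\subset[\phi_{\min},\infty)$, all independent of $n$. It is assumed that there is an exponent $\beta>8$ such that $\nu([k,\infty))\le k^{-\beta}$ for all large enough $k$. Write $\Phi^{(k)}=\int_W x^k\,\mathrm d\nu(x)$. The graph $G=G(n)$ has vertex set $V=\{1,\dots,n\}$. Each vertex $w$ has a spin $\sigma_w$ drawn independently and uniformly from $\{1,\dots,q\}$ and a weight $\phi_w$; the weights are i.i.d. with law $\nu$ and independent of the spins. Conditionally on spins and weights, each pair of distinct vertices $w,w'$ is joined by an edge, independently of other pairs, with probability $\frac{\phi_w\phi_{w'}}{n}a$ if $\sigma_w=\sigma_{w'}$ and $\frac{\phi_w\phi_{w'}}{n}b$ otherwise (read as $1$ if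 exceeding $1$). Branching process $T^{\mathrm{Poi}}$. Let $\nu^*$ be the size-biased version of $\nu$: $\nu^*([0,x])=\frac1{\Phi^{(1)}}\int_{\phi_{\min}}^x y\,\mathrm d\nu(y)$ for $x\ge\phi_{\min}$. Start with a root $o$ with spin $\sigma_o$ uniform in $\{1,\dots,q\}$ and weight $\phi_o$ with law $\nu$ (independent). A particle (root or not) with spin $\sigma$ and weight $\phi$ has, independently of everything else, $\mathrm{Poi}\!\left(\frac aq\Phi^{(1)}\phi\right)$ children of spin $\sigma$ and, for each $s\in\{1,\dots,q\}\setminus\{\sigma\}$, independently $\mathrm{Poi}\!\left(\frac bq\Phi^{(1)}\phi\right)$ children of spin $s$. The weights of all non-root particles are i.i.d. with law $\nu^*$. Notation. $G_r=G_r(\rho)$ is the subgraph of $G$ induced by the vertices at graph distance at most $r$ from $\rho$, rooted at $\rho$; $|G_r|$ is its number of vertices; $\sigma_{G_r},\phi_{G_r}$ are the spins and weights of its vertices. $T_r$ is the tree of the first $r$ generations of $T$ (generations $0,\dots,r$), and $\tau_{T_r},\psi_{T_r}$ are the spins and weights of its particles. The total variation distance $\|X-Y\|_{\mathrm{TV}}$ is the distance between the laws of $X$ and $Y$, where the triples are regarded as rooted graphs whose vertices carry spins and weights, up to root-preserving isomorphism. *)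

theory Defs
  imports "HOL-Probability.Probability"
begin

section \<open>Rooted graphs with spins and weights\<close>

text \<open>Edges are ordered pairs; an undirected graph has a symmetric edge relation. The values of
  \<open>gspin\<close> and \<open>gweight\<close> outside \<open>gverts\<close> are irrelevant.\<close>

record 'v mgraph =
  gverts :: "'v set"
  gedges :: "'v rel"
  groot :: 'v
  gspin :: "'v \<Rightarrow> nat"
  gweight :: "'v \<Rightarrow> real"

definition finite_rooted_graph :: "'v mgraph \<Rightarrow> bool" where
  "finite_rooted_graph g \<longleftrightarrow>
     finite (gverts g) \<and> groot g \<in> gverts g \<and>
     gedges g \<subseteq> gverts g \<times> gverts g \<and> sym (gedges g) \<and> irrefl (gedges g)"

definition induced :: "'v mgraph \<Rightarrow> 'v set \<Rightarrow> 'v mgraph" where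
  "induced g B = g\<lparr>gverts := gverts g \<inter> B, gedges := gedges g \<inter> (B \<times> B)\<rparr>"

definition gdist :: "'v mgraph \<Rightarrow> 'v \<Rightarrow> 'v \<Rightarrow> enat" where
  "gdist g u v = (INF k \<in> {k. (u, v) \<in> gedges g ^^ k}. enat k)"

definition root_ball :: "nat \<Rightarrow> 'v mgraph \<Rightarrow> 'v mgraph" where
  "root_ball r g = induced g {v. gdist g (groot g) v \<le> enat r}"

definition mgraph_iso :: "'v mgraph \<Rightarrow> 'w mgraph \<Rightarrow> bool" where
  "mgraph_iso g h \<longleftrightarrow> (\<exists>f. bij_betw f (gverts g) (gverts h) \<and> f (groot g) = groot h \<and>
     (\<forall>u\<in>gverts g. \<forall>v\<in>gverts g. (u, v) \<in> gedges g \<longleftrightarrow> (f u, f v) \<in> gedges h) \<and>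
     (\<forall>v\<in>gverts g. gspin h (f v) = gspin g v \<and> gweight h (f v) = gweight g v))"

text \<open>Isomorphism classes of finite graphs with arbitrary vertex type are represented
  by their members with vertices in \<open>nat\<close>.\<close>

definition iso_class :: "'v mgraph \<Rightarrow> nat mgraph set" where
  "iso_class g = {h. mgraph_iso g h}"

definition iso_classes :: "nat mgraph set set" where
  "iso_classes = iso_class ` {g :: nat mgraph. finite_rooted_graph g}"

text \<open>The isomorphism classes carry the quotient Borel structure: a set of classes is
  measurable iff, for every finite rooted graph on \<open>{..<k}\<close> and every spin assignment, the
  weight vectors in \<open>\<real>\<^sup>k\<close> that put the graph into the set form a Borel set.\<close>

definition iso_sets :: "nat mgraph set set set" where
  "iso_sets = {S. S \<subseteq> iso_classes \<and>
     (\<forall>(k::nat) E \<rho> s. finite_rooted_graph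
          \<lparr>gverts = {..<k}, gedges = E, groot = \<rho>, gspin = s, gweight = (\<lambda>_. 0)\<rparr> \<longrightarrow>
        {x \<in> space (PiM {..<k} (\<lambda>_. borel)).
           iso_class \<lparr>gverts = {..<k}, gedges = E, groot = \<rho>, gspin = s, gweight = x\<rparr> \<in> S}
          \<in> sets (PiM {..<k} (\<lambda>_. borel)))}"

definition iso_space :: "nat mgraph set measure" where
  "iso_space = sigma iso_classes iso_sets"

definition tv_dist :: "'a measure \<Rightarrow> 'a measure \<Rightarrow> real" where
  "tv_dist M N = (SUP A\<in>sets M. \<bar>measure M A - measure N A\<bar>)"

section \<open>The degree-corrected stochastic block model\<close>

definition affinity :: "real \<Rightarrow> real \<Rightarrow> nat \<Rightarrow> nat \<Rightarrow> real" where
  "affinity a b s t = (if s = t then a else b)"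

definition spin_law :: "nat \<Rightarrow> nat measure" where
  "spin_law q = measure_pmf (pmf_of_set {1..q})"

definition vertex_pairs :: "nat \<Rightarrow> (nat \<times> nat) set" where
  "vertex_pairs n = {(v, w). 1 \<le> v \<and> v < w \<and> w \<le> n}"

definition edge_prob :: "real \<Rightarrow> real \<Rightarrow> nat \<Rightarrow> (nat \<Rightarrow> nat) \<Rightarrow> (nat \<Rightarrow> real) \<Rightarrow> nat \<times> nat \<Rightarrow> real"
  where
  "edge_prob a b n \<sigma> \<phi> = (\<lambda>(v, w). min 1 (\<phi> v * \<phi> w / real n * affinity a b (\<sigma> v) (\<sigma> w)))"

text \<open>An outcome consists of the spins, the weights, the edge indicators and the uniformly
  picked vertex \<open>\<rho>\<close>, which is independent of the rest.\<close>

type_synonym dcsbm_outcome = "(nat \<Rightarrow> nat) \<times> (nat \<Rightarrow> real) \<times> (nat \<times> nat \<Rightarrow> bool) \<times> nat"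

definition dcsbm_space :: "nat \<Rightarrow> dcsbm_outcome measure" where
  "dcsbm_space n =
     PiM {1..n} (\<lambda>_. count_space UNIV) \<Otimes>\<^sub>M PiM {1..n} (\<lambda>_. borel) \<Otimes>\<^sub>M
     PiM (vertex_pairs n) (\<lambda>_. count_space UNIV) \<Otimes>\<^sub>M count_space {1..n}"

definition dcsbm :: "nat \<Rightarrow> real \<Rightarrow> real \<Rightarrow> real measure \<Rightarrow> nat \<Rightarrow> dcsbm_outcome measure" where
  "dcsbm q a b \<nu> n = do {
     \<sigma> \<leftarrow> PiM {1..n} (\<lambda>_. spin_law q);
     \<phi> \<leftarrow> PiM {1..n} (\<lambda>_. \<nu>);
     \<eta> \<leftarrow> PiM (vertex_pairs n) (\<lambda>e. measure_pmf (bernoulli_pmf (edge_prob a b n \<sigma> \<phi> e)));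
     \<rho> \<leftarrow> uniform_count_measure {1..n};
     return (dcsbm_space n) (\<sigma>, \<phi>, \<eta>, \<rho>)
   }"

fun dcsbm_graph :: "nat \<Rightarrow> dcsbm_outcome \<Rightarrow> nat mgraph" where
  "dcsbm_graph n (\<sigma>, \<phi>, \<eta>, \<rho>) =
     \<lparr>gverts = {1..n},
      gedges = {(v, w). (v, w) \<in> vertex_pairs n \<and> \<eta> (v, w) \<or> (w, v) \<in> vertex_pairs n \<and> \<eta> (w, v)},
      groot = \<rho>, gspin = \<sigma>, gweight = \<phi>\<rparr>"

section \<open>The branching process\<close>

definition moment :: "real set \<Rightarrow> real measure \<Rightarrow> nat \<Rightarrow> real" where
  "moment W \<nu> k = (LINT x:W|\<nu>. x ^ k)"

definition size_biased :: "real set \<Rightarrow> real measure \<Rightarrow> real measure" where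
  "size_biased W \<nu> = density \<nu> (\<lambda>x. ennreal (x / moment W \<nu> 1))"

lemma size_biased_cdf:
  assumes "prob_space \<nu>" "sets \<nu> = sets borel" "W \<in> sets borel" "W \<subseteq> {m..}" "m > 0"
    "AE x in \<nu>. x \<in> W" "moment W \<nu> 1 > 0" "x \<ge> m"
  shows "measure (size_biased W \<nu>) {0..x} = (LINT y:{m..x}|\<nu>. y) / moment W \<nu> 1"
proof -
  note [measurable_cong] = assms(2)
  have i: "integrable \<nu> (\<lambda>y. indicator {m..x} y *\<^sub>R y)"
    using assms by (intro finite_measure.integrable_const_bound[where B="x"]) (auto simp: prob_space.finite_measure indicator_def)
  have "emeasure (size_biased W \<nu>) {0..x} = (\<integral>\<^sup>+y. ennreal (y / moment W \<nu> 1) * indicator {0..x} y \<partial>\<nu>)"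
    unfolding size_biased_def by (rule emeasure_density) measurable
  also have "\<dots> = (\<integral>\<^sup>+y. ennreal (indicator {m..x} y *\<^sub>R y / moment W \<nu> 1) \<partial>\<nu>)"
    using assms(6) by (intro nn_integral_cong_AE, eventually_elim) (use assms in \<open>auto simp: indicator_def\<close>)
  also have "\<dots> = ennreal (\<integral>y. indicator {m..x} y *\<^sub>R y / moment W \<nu> 1 \<partial>\<nu>)"
    using i assms by (intro nn_integral_eq_integral) (auto simp: indicator_def)
  also have "(\<integral>y. indicator {m..x} y *\<^sub>R y / moment W \<nu> 1 \<partial>\<nu>) = (LINT y:{m..x}|\<nu>. y) / moment W \<nu> 1"
    by (simp add: set_lebesgue_integral_def)
  finally show ?thesis using assms
    by (simp add: measure_def set_lebesgue_integral_def) (subst enn2real_ennreal; auto intro!: divide_nonneg_pos integral_nonneg_AE simp: indicator_def)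
qed

text \<open>\<open>poisson_pmf\<close> is unspecified at nonpositive rates; those have probability zero below.\<close>

definition poisson_law :: "real \<Rightarrow> nat measure" where
  "poisson_law r = measure_pmf (if 0 < r then poisson_pmf r else return_pmf 0)"

text \<open>A particle is named by its line of descent: \<open>u @ [(s, i)]\<close> is the \<open>i\<close>-th child of
  spin \<open>s\<close> of the particle \<open>u\<close>, counting from \<open>0\<close>. So the name of a non-root particle
  determines its spin. To every name \<open>u\<close> (whether or not it occurs in the tree) belongs a pair
  \<open>(\<psi>, N)\<close> of a weight and the numbers \<open>N s\<close> of children of spin \<open>s\<close>; given the spin of the
  root, these pairs are independent.\<close>

type_synonym particle = "(nat \<times> nat) list"

definition particle_spin :: "nat \<Rightarrow> particle \<Rightarrow> nat" where
  "particle_spin s\<^sub>0 u = (if u = [] then s\<^sub>0 else fst (last u))"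

definition particle_space :: "nat \<Rightarrow> (real \<times> (nat \<Rightarrow> nat)) measure" where
  "particle_space q = borel \<Otimes>\<^sub>M PiM {1..q} (\<lambda>_. count_space UNIV)"

definition particle_law ::
    "nat \<Rightarrow> real \<Rightarrow> real \<Rightarrow> real \<Rightarrow> real measure \<Rightarrow> nat \<Rightarrow> (real \<times> (nat \<Rightarrow> nat)) measure" where
  "particle_law q a b m \<mu> s = do {
     \<psi> \<leftarrow> \<mu>;
     N \<leftarrow> PiM {1..q} (\<lambda>t. poisson_law (affinity a b s t / real q * m * \<psi>));
     return (particle_space q) (\<psi>, N)
   }"

type_synonym bp_outcome = "nat \<times> (particle \<Rightarrow> real \<times> (nat \<Rightarrow> nat))"

definition branching_process ::
    "nat \<Rightarrow> real \<Rightarrow> real \<Rightarrow> real set \<Rightarrow> real measure \<Rightarrow> bp_outcome measure" where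
  "branching_process q a b W \<nu> = do {
     s\<^sub>0 \<leftarrow> spin_law q;
     X \<leftarrow> PiM UNIV (\<lambda>u. particle_law q a b (moment W \<nu> 1)
            (if u = [] then \<nu> else size_biased W \<nu>) (particle_spin s\<^sub>0 u));
     return (count_space UNIV \<Otimes>\<^sub>M PiM UNIV (\<lambda>_. particle_space q)) (s\<^sub>0, X)
   }"

primrec generation :: "nat \<Rightarrow> (particle \<Rightarrow> nat \<Rightarrow> nat) \<Rightarrow> nat \<Rightarrow> particle set" where
  "generation q N 0 = {[]}"
| "generation q N (Suc k) = {u @ [(s, i)] | u s i. u \<in> generation q N k \<and> s \<in> {1..q} \<and> i < N u s}"

fun bp_tree :: "nat \<Rightarrow> nat \<Rightarrow> bp_outcome \<Rightarrow> particle mgraph" where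
  "bp_tree q r (s\<^sub>0, X) =
     (let P = (\<Union>k\<le>r. generation q (\<lambda>u. snd (X u)) k) in
      \<lparr>gverts = P,
       gedges = {(u, v). u \<in> P \<and> v \<in> P \<and> ((\<exists>x. v = u @ [x]) \<or> (\<exists>x. u = v @ [x]))},
       groot = [], gspin = particle_spin s\<^sub>0, gweight = (\<lambda>u. fst (X u))\<rparr>)"

end

theory Submission
  imports Defs
begin

text \<open>
  The radius may grow as slowly as desired. So it suffices to show, for every fixed radius \<open>r\<close>, that
  the total variation distance tends to \<open>0\<close> and that the ball is small with probability tending to
  \<open>1\<close>; a diagonal argument (\<open>diagonal_radius\<close>) then produces \<open>R\<close>.

  For fixed \<open>r\<close> the two laws are compared through densities. For a root spin \<open>s\<close> and a finite set
  \<open>P\<close> of particle names let \<open>k\<close> be the size of \<open>P\<close>. On the event that the root has spin \<open>s\<close> and the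
  first \<open>r\<close> generations of the branching process are \<open>P\<close>, the weights have an explicit density with
  respect to the \<open>k\<close>-th power of \<open>\<nu>\<close>: a product of Poisson probabilities and size-biasing factors
  (\<open>emeasure_bp_tree_shape\<close>). In the random graph one considers the injections \<open>f\<close> of \<open>P\<close> into the
  vertices that identify \<open>P\<close> with the ball. Given spins and weights, the probability of this is at least a
  product over pairs of vertices, and integrating out the vertices outside the ball
  gives a lower bound for the density of the weights (\<open>emeasure_embedding_ge\<close>). The same ball may be
  identified with several sets of names, in several ways, since siblings of equal spin can be numbered in any
  order; the number of these identifications is at most the product of the factorials of the
  numbers of siblings (\<open>sum_ball_embeddings_le_1\<close>). These factorials are also the ones in the Poisson
  probabilities. There are asymptotically \<open>n ^ k\<close> injections, the \<open>k - 1\<close> edges and the choice of the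
  root contribute the order \<open>1 / n ^ k\<close>, and the condition that no further vertex is attached
  contributes a factor \<open>(1 - c / n) ^ (n - k)\<close>, which tends to the exponential factor \<open>exp (- c)\<close> of the
  Poisson probabilities. So the lower bound converges pointwise to the density of the tree
  (\<open>graph_density_tendsto\<close>).

  Now the argument of Scheffe's lemma applies: the densities of the tree have total mass \<open>1\<close>, so by
  dominated convergence the lower bounds already account for almost all of the mass in the
  graph. No upper bound is needed, and balls containing cycles need not be discussed. As
  there are only countably many shapes \<open>P\<close>, finitely many of them carry most of the mass
  (\<open>bp_tree_tight\<close>), which also bounds the size of the ball (\<open>fixed_radius\<close>).
\<close>

section \<open>Isomorphism classes\<close>

lemma mgraph_iso_sym:
  assumes "mgraph_iso g h" "groot g \<in> gverts g"
  shows "mgraph_iso h g"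
proof -
  obtain f where f: "bij_betw f (gverts g) (gverts h)" "f (groot g) = groot h"
    "\<forall>u\<in>gverts g. \<forall>v\<in>gverts g. (u, v) \<in> gedges g \<longleftrightarrow> (f u, f v) \<in> gedges h"
    "\<forall>v\<in>gverts g. gspin h (f v) = gspin g v \<and> gweight h (f v) = gweight g v"
    using assms unfolding mgraph_iso_def by blast
  let ?f = "inv_into (gverts g) f"
  have b: "bij_betw ?f (gverts h) (gverts g)" by (rule bij_betw_inv_into[OF f(1)])
  have m: "?f u \<in> gverts g" "f (?f u) = u" if "u \<in> gverts h" for u
    using that b bij_betw_inv_into_right[OF f(1)] by (auto simp: bij_betw_def)
  have "?f (groot h) = groot g"
    using bij_betw_inv_into_left[OF f(1) assms(2)] f(2) by simp
  then show ?thesis unfolding mgraph_iso_def using b f m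
    by (intro exI[of _ ?f]) (metis)
qed

lemma mgraph_iso_trans:
  assumes "mgraph_iso g h" "mgraph_iso h k"
  shows "mgraph_iso g k"
proof -
  obtain f where f: "bij_betw f (gverts g) (gverts h)" "f (groot g) = groot h"
    "\<forall>u\<in>gverts g. \<forall>v\<in>gverts g. (u, v) \<in> gedges g \<longleftrightarrow> (f u, f v) \<in> gedges h"
    "\<forall>v\<in>gverts g. gspin h (f v) = gspin g v \<and> gweight h (f v) = gweight g v"
    using assms unfolding mgraph_iso_def by blast
  obtain f' where f': "bij_betw f' (gverts h) (gverts k)" "f' (groot h) = groot k"
    "\<forall>u\<in>gverts h. \<forall>v\<in>gverts h. (u, v) \<in> gedges h \<longleftrightarrow> (f' u, f' v) \<in> gedges k"
    "\<forall>v\<in>gverts h. gspin k (f' v) = gspin h v \<and> gweight k (f' v) = gweight h v"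
    using assms unfolding mgraph_iso_def by blast
  have m: "f u \<in> gverts h" if "u \<in> gverts g" for u using f(1) that by (auto simp: bij_betw_def)
  show ?thesis unfolding mgraph_iso_def
  proof (intro exI[of _ "f' \<circ> f"] conjI ballI)
    show "bij_betw (f' \<circ> f) (gverts g) (gverts k)" using f(1) f'(1) by (rule bij_betw_trans)
    fix u v assume "u \<in> gverts g" "v \<in> gverts g"
    then show "(u, v) \<in> gedges g \<longleftrightarrow> ((f' \<circ> f) u, (f' \<circ> f) v) \<in> gedges k"
      using f(3) f'(3) m by simp
  qed (use f f' m in simp_all)
qed

lemma iso_class_eqI:
  assumes "mgraph_iso g h" "groot g \<in> gverts g"
  shows "iso_class g = iso_class h"
  unfolding iso_class_def
proof (rule Collect_cong, rule iffI)
  fix k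
  show "mgraph_iso h k" if "mgraph_iso g k"
    using mgraph_iso_trans[OF mgraph_iso_sym[OF assms] that] .
  show "mgraph_iso g k" if "mgraph_iso h k"
    using mgraph_iso_trans[OF assms(1) that] .
qed

lemma iso_class_weight_cong:
  assumes "\<And>v. v \<in> V \<Longrightarrow> x v = y v" "\<rho> \<in> V"
  shows "iso_class \<lparr>gverts = V, gedges = E, groot = \<rho>, gspin = s, gweight = x\<rparr> =
    iso_class \<lparr>gverts = V, gedges = E, groot = \<rho>, gspin = s, gweight = y\<rparr>"
proof (rule iso_class_eqI)
  show "mgraph_iso \<lparr>gverts = V, gedges = E, groot = \<rho>, gspin = s, gweight = x\<rparr>
    \<lparr>gverts = V, gedges = E, groot = \<rho>, gspin = s, gweight = y\<rparr>"
    unfolding mgraph_iso_def using assms by (intro exI[of _ id]) auto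
qed (use assms in simp)

text \<open>The classes of graphs on \<open>{..<k}\<close> generate the structure, so every graph with a fixed finite
  shape depends measurably on its weights, whatever its vertex type.\<close>

lemma measurable_iso_class:
  fixes V :: "'v set"
  assumes g: "\<And>x. finite_rooted_graph \<lparr>gverts = V, gedges = E, groot = \<rho>, gspin = s, gweight = x\<rparr>"
  shows "(\<lambda>x. iso_class \<lparr>gverts = V, gedges = E, groot = \<rho>, gspin = s, gweight = x\<rparr>)
    \<in> PiM V (\<lambda>_. borel) \<rightarrow>\<^sub>M iso_space"
proof -
  have fin: "finite V" and rV: "\<rho> \<in> V" and EV: "E \<subseteq> V \<times> V" "sym E" "irrefl E"
    using g unfolding finite_rooted_graph_def by auto
  define k where "k = card V"
  obtain h where h: "bij_betw h {..<k} V"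
    using ex_bij_betw_nat_finite[OF fin] by (auto simp: k_def atLeast0LessThan)
  define E' where "E' = {(i, j). i < k \<and> j < k \<and> (h i, h j) \<in> E}"
  define \<rho>' where "\<rho>' = inv_into {..<k} h \<rho>"
  have \<rho>': "\<rho>' < k" "h \<rho>' = \<rho>"
    using h rV bij_betw_inv_into_right[OF h rV] bij_betw_inv_into[OF h]
    by (auto simp: \<rho>'_def bij_betw_def)
  let ?G = "\<lambda>x. \<lparr>gverts = {..<k}, gedges = E', groot = \<rho>', gspin = s \<circ> h, gweight = x\<rparr>"
  let ?H = "\<lambda>x. \<lparr>gverts = V, gedges = E, groot = \<rho>, gspin = s, gweight = x\<rparr>"
  let ?r = "\<lambda>x. \<lambda>i\<in>{..<k}. x (h i)"
  have fG: "finite_rooted_graph (?G x)" for x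
    using EV \<rho>' unfolding finite_rooted_graph_def E'_def sym_def irrefl_def by auto
  have hV: "h i \<in> V" if "i < k" for i using h that by (auto simp: bij_betw_def)
  have iso: "iso_class (?H x) = iso_class (?G (?r x))" for x
  proof (rule iso_class_eqI[symmetric])
    show "mgraph_iso (?G (?r x)) (?H x)"
      unfolding mgraph_iso_def using h \<rho>' by (intro exI[of _ h]) (auto simp: E'_def)
  qed (use \<rho>' in auto)
  have G: "(\<lambda>x. iso_class (?G x)) \<in> PiM {..<k} (\<lambda>_. borel) \<rightarrow>\<^sub>M iso_space"
    unfolding iso_space_def
  proof (rule measurable_measure_of)
    show "(\<lambda>x. iso_class (?G x)) \<in> space (PiM {..<k} (\<lambda>_. borel)) \<rightarrow> iso_classes"
      using fG by (auto simp: iso_classes_def)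
    fix S assume "S \<in> iso_sets"
    moreover have "finite_rooted_graph \<lparr>gverts = {..<k}, gedges = E', groot = \<rho>', gspin = s \<circ> h, gweight = (\<lambda>_. 0)\<rparr>"
      by (rule fG)
    ultimately have "{x \<in> space (PiM {..<k} (\<lambda>_. borel)). iso_class (?G x) \<in> S} \<in> sets (PiM {..<k} (\<lambda>_. borel))"
      unfolding iso_sets_def by blast
    then show "(\<lambda>x. iso_class (?G x)) -` S \<inter> space (PiM {..<k} (\<lambda>_. borel)) \<in> sets (PiM {..<k} (\<lambda>_. borel))"
      by (simp add: vimage_def Int_def conj_commute)
  qed (auto simp: iso_sets_def)
  have r: "?r \<in> PiM V (\<lambda>_. borel) \<rightarrow>\<^sub>M PiM {..<k} (\<lambda>_. borel :: real measure)"
    by (intro measurable_restrict measurable_component_singleton) (auto intro: hV)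
  show ?thesis unfolding iso by (rule measurable_compose[OF r G])
qed

section \<open>Family trees and their embeddings as balls\<close>

text \<open>Parent and child, in either order.\<close>

definition tree_adjacent :: "particle \<Rightarrow> particle \<Rightarrow> bool" where
  "tree_adjacent u v \<longleftrightarrow> (\<exists>x. v = u @ [x]) \<or> (\<exists>x. u = v @ [x])"

text \<open>The tree on the particles \<open>P\<close>, with root spin \<open>s0\<close> and weights \<open>x\<close>.\<close>

definition tree_graph :: "nat \<Rightarrow> particle set \<Rightarrow> (particle \<Rightarrow> real) \<Rightarrow> particle mgraph" where
  "tree_graph s0 P x = \<lparr>gverts = P, gedges = {(u, v). u \<in> P \<and> v \<in> P \<and> tree_adjacent u v},
     groot = [], gspin = particle_spin s0, gweight = x\<rparr>"

text \<open>The particles of generations \<open>0, \<dots>, r\<close> when \<open>u\<close> has \<open>N u s\<close> children of spin \<open>s\<close>.\<close>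

definition family_tree :: "nat \<Rightarrow> nat \<Rightarrow> (particle \<Rightarrow> nat \<Rightarrow> nat) \<Rightarrow> particle set" where
  "family_tree q r N = (\<Union>k\<le>r. generation q N k)"

text \<open>The sets of names that can occur as the first \<open>r\<close> generations.\<close>

definition tree_shape :: "nat \<Rightarrow> nat \<Rightarrow> particle set \<Rightarrow> bool" where
  "tree_shape q r P \<longleftrightarrow> (\<exists>N. P = family_tree q r N)"

text \<open>The number of children of spin \<open>s\<close> that \<open>u\<close> has in \<open>P\<close>.\<close>

definition offspring :: "particle set \<Rightarrow> particle \<Rightarrow> nat \<Rightarrow> nat" where
  "offspring P u s = card {i. u @ [(s, i)] \<in> P}"

text \<open>The particles before generation \<open>r\<close>; the others have no children in a tree of height \<open>r\<close>.\<close>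

definition inner_particles :: "nat \<Rightarrow> particle set \<Rightarrow> particle set" where
  "inner_particles r P = {u \<in> P. length u < r}"

lemma bp_tree_eq:
  "bp_tree q r (s0, X) = tree_graph s0 (family_tree q r (\<lambda>u. snd (X u))) (\<lambda>u. fst (X u))"
  by (simp add: tree_graph_def family_tree_def Let_def tree_adjacent_def)

lemma length_generation: "u \<in> generation q N k \<Longrightarrow> length u = k"
  by (induction k arbitrary: u) auto

lemma finite_generation: "finite (generation q N k)"
proof (induction k)
  case (Suc k)
  have "generation q N (Suc k) = (\<Union>u\<in>generation q N k. \<Union>s\<in>{1..q}. (\<lambda>i. u @ [(s, i)]) ` {..<N u s})"
    by fastforce
  then show ?case using Suc by simp
qed simp

lemma finite_family_tree: "finite (family_tree q r N)"
  by (simp add: family_tree_def finite_generation)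

lemma family_tree_Nil: "[] \<in> family_tree q r N"
  by (auto simp: family_tree_def intro!: bexI[of _ 0])

lemma family_tree_length: "u \<in> family_tree q r N \<Longrightarrow> length u \<le> r"
  by (auto simp: family_tree_def dest: length_generation)

lemma family_tree_snoc:
  "u @ [(s, i)] \<in> family_tree q r N \<longleftrightarrow>
     u \<in> family_tree q r N \<and> length u < r \<and> s \<in> {1..q} \<and> i < N u s"
proof
  assume "u @ [(s, i)] \<in> family_tree q r N"
  then obtain k where k: "k \<le> r" "u @ [(s, i)] \<in> generation q N k" by (auto simp: family_tree_def)
  then obtain j where j: "k = Suc j" by (cases k) auto
  with k have "u \<in> generation q N j" "s \<in> {1..q}" "i < N u s" by auto
  then show "u \<in> family_tree q r N \<and> length u < r \<and> s \<in> {1..q} \<and> i < N u s"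
    using k j length_generation by (fastforce simp: family_tree_def)
next
  assume *: "u \<in> family_tree q r N \<and> length u < r \<and> s \<in> {1..q} \<and> i < N u s"
  then obtain k where k: "k \<le> r" "u \<in> generation q N k" by (auto simp: family_tree_def)
  then have "k = length u" using length_generation by blast
  with k * show "u @ [(s, i)] \<in> family_tree q r N"
    by (auto simp: family_tree_def intro!: bexI[of _ "Suc k"])
qed

lemma offspring_family_tree:
  assumes "u \<in> family_tree q r N" "length u < r" "s \<in> {1..q}"
  shows "offspring (family_tree q r N) u s = N u s"
  using assms unfolding offspring_def family_tree_snoc by simp

lemma family_tree_cong:
  assumes "\<And>u s. u \<in> family_tree q r N \<Longrightarrow> length u < r \<Longrightarrow> s \<in> {1..q} \<Longrightarrow> N' u s = N u s"
  shows "family_tree q r N' = family_tree q r N"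
proof -
  have "u \<in> family_tree q r N' \<longleftrightarrow> u \<in> family_tree q r N" for u
  proof (induction u rule: rev_induct)
    case (snoc x u)
    then show ?case using assms by (cases x) (auto simp: family_tree_snoc)
  qed (simp add: family_tree_Nil)
  then show ?thesis by blast
qed

lemma family_tree_eq_iff:
  assumes "tree_shape q r P"
  shows "family_tree q r N = P \<longleftrightarrow>
    (\<forall>u\<in>inner_particles r P. \<forall>s\<in>{1..q}. N u s = offspring P u s)"
proof -
  obtain N0 where P: "P = family_tree q r N0" using assms by (auto simp: tree_shape_def)
  show ?thesis
  proof
    assume "family_tree q r N = P"
    then show "\<forall>u\<in>inner_particles r P. \<forall>s\<in>{1..q}. N u s = offspring P u s"
      using offspring_family_tree[of _ q r N] by (auto simp: inner_particles_def)
  next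
    assume "\<forall>u\<in>inner_particles r P. \<forall>s\<in>{1..q}. N u s = offspring P u s"
    then show "family_tree q r N = P" unfolding P
      by (intro family_tree_cong) (auto simp: offspring_family_tree inner_particles_def)
  qed
qed

lemma tree_shapeD:
  assumes "tree_shape q r P"
  shows "finite P" "[] \<in> P" "\<And>u. u \<in> P \<Longrightarrow> length u \<le> r"
    "\<And>u s i. u @ [(s, i)] \<in> P \<longleftrightarrow> u \<in> inner_particles r P \<and> s \<in> {1..q} \<and> i < offspring P u s"
proof -
  obtain N where P: "P = family_tree q r N" using assms by (auto simp: tree_shape_def)
  show "finite P" "[] \<in> P" "\<And>u. u \<in> P \<Longrightarrow> length u \<le> r"
    using finite_family_tree family_tree_Nil family_tree_length by (auto simp: P)
  show "\<And>u s i. u @ [(s, i)] \<in> P \<longleftrightarrow> u \<in> inner_particles r P \<and> s \<in> {1..q} \<and> i < offspring P u s"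
    unfolding inner_particles_def using offspring_family_tree[of _ q r N] by (auto simp: family_tree_snoc P)
qed

lemma tree_shape_spin:
  assumes "tree_shape q r P" "s0 \<in> {1..q}" "u \<in> P"
  shows "particle_spin s0 u \<in> {1..q}"
  using assms tree_shapeD(4)[OF assms(1)] by (cases u rule: rev_cases) (auto simp: particle_spin_def)

lemma tree_shape_butlast:
  assumes "tree_shape q r P" "v \<in> P" "v \<noteq> []"
  shows "butlast v \<in> inner_particles r P" "butlast v @ [last v] = v"
  using assms tree_shapeD(4)[OF assms(1), of "butlast v" "fst (last v)" "snd (last v)"] by auto

lemma countable_tree_shapes: "countable {P. tree_shape q r P}"
proof (rule countable_subset)
  show "{P. tree_shape q r P} \<subseteq> {P. finite P}" using tree_shapeD(1) by auto
  show "countable {P :: particle set. finite P}" by (rule countable_Collect_finite)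
qed

lemma iso_class_tree_graph_cong:
  assumes "\<And>u. u \<in> P \<Longrightarrow> x u = y u" "[] \<in> P"
  shows "iso_class (tree_graph s P x) = iso_class (tree_graph s P y)"
  unfolding tree_graph_def using assms by (rule iso_class_weight_cong)

lemma finite_rooted_tree_graph:
  assumes "tree_shape q r P"
  shows "finite_rooted_graph (tree_graph s0 P x)"
  using tree_shapeD[OF assms]
  by (auto simp: finite_rooted_graph_def tree_graph_def sym_def irrefl_def tree_adjacent_def)

lemma measurable_iso_class_tree_graph:
  assumes "tree_shape q r P"
  shows "(\<lambda>x. iso_class (tree_graph s0 P x)) \<in> PiM P (\<lambda>_. borel) \<rightarrow>\<^sub>M iso_space"
  unfolding tree_graph_def
  by (rule measurable_iso_class, rule finite_rooted_tree_graph[OF assms, unfolded tree_graph_def])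

text \<open>The function \<open>f\<close> identifies the tree \<open>P\<close> with the ball of radius \<open>r\<close>; the last
  condition says that only particles of generation \<open>r\<close> may have neighbours outside the image.\<close>

definition ball_embedding ::
    "nat \<Rightarrow> nat \<Rightarrow> particle set \<Rightarrow> (particle \<Rightarrow> 'v) \<Rightarrow> 'v mgraph \<Rightarrow> bool" where
  "ball_embedding r s0 P f g \<longleftrightarrow> inj_on f P \<and> f ` P \<subseteq> gverts g \<and> f [] = groot g \<and>
     (\<forall>u\<in>P. gspin g (f u) = particle_spin s0 u) \<and>
     (\<forall>u\<in>P. \<forall>v\<in>P. (f u, f v) \<in> gedges g \<longleftrightarrow> tree_adjacent u v) \<and>
     (\<forall>u\<in>inner_particles r P. \<forall>w\<in>gverts g - f ` P. (f u, w) \<notin> gedges g)"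

lemma gdist_le_iff: "gdist g u v \<le> enat r \<longleftrightarrow> (\<exists>k\<le>r. (u, v) \<in> gedges g ^^ k)"
proof
  assume "gdist g u v \<le> enat r"
  then have "gdist g u v < enat (Suc r)" by (metis enat_ord_simps(2) lessI order_le_less_trans)
  then show "\<exists>k\<le>r. (u, v) \<in> gedges g ^^ k"
    unfolding gdist_def by (auto simp: INF_less_iff less_Suc_eq_le)
next
  assume "\<exists>k\<le>r. (u, v) \<in> gedges g ^^ k"
  then obtain k where k: "k \<le> r" "(u, v) \<in> gedges g ^^ k" by auto
  then have "gdist g u v \<le> enat k" unfolding gdist_def by (intro INF_lower) auto
  then show "gdist g u v \<le> enat r" using k(1) by (meson enat_ord_simps(1) order_trans)
qed

text \<open>A path of length at most \<open>r\<close> from the root cannot leave the image of \<open>P\<close>, because it could do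
  so only at a particle of generation \<open>r\<close>.\<close>

lemma ball_embedding_vertices:
  assumes P: "tree_shape q r P" and f: "ball_embedding r s0 P f g" and g: "finite_rooted_graph g"
  shows "gverts (root_ball r g) = f ` P"
proof -
  have path: "(groot g, f u) \<in> gedges g ^^ length u" if "u \<in> P" for u
    using that
  proof (induction u rule: rev_induct)
    case Nil
    then show ?case using f by (simp add: ball_embedding_def)
  next
    case (snoc x u)
    then have "u \<in> P" using tree_shapeD(4)[OF P, of u "fst x" "snd x"] by (simp add: inner_particles_def)
    moreover have "(f u, f (u @ [x])) \<in> gedges g"
      using f snoc.prems \<open>u \<in> P\<close> by (auto simp: ball_embedding_def tree_adjacent_def)
    ultimately show ?case using snoc.IH by auto
  qed
  have conv: "\<exists>u\<in>P. length u \<le> k \<and> v = f u" if "(groot g, v) \<in> gedges g ^^ k" "k \<le> r" for k v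
    using that
  proof (induction k arbitrary: v)
    case 0
    then show ?case using f tree_shapeD(2)[OF P] by (auto simp: ball_embedding_def)
  next
    case (Suc k)
    then obtain w where w: "(groot g, w) \<in> gedges g ^^ k" "(w, v) \<in> gedges g" by auto
    then obtain u where u: "u \<in> P" "length u \<le> k" "w = f u" using Suc by auto
    have "u \<in> inner_particles r P" using u Suc.prems by (simp add: inner_particles_def)
    moreover have "v \<in> gverts g" using w g by (auto simp: finite_rooted_graph_def)
    ultimately have "v \<in> f ` P" using f w u by (auto simp: ball_embedding_def)
    then obtain u' where u': "u' \<in> P" "v = f u'" by auto
    then have "tree_adjacent u u'" using f w u by (auto simp: ball_embedding_def)
    then have "length u' \<le> Suc k" using u by (auto simp: tree_adjacent_def)
    then show ?case using u' by auto
  qed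
  have "f ` P \<subseteq> gverts g" using f by (simp add: ball_embedding_def)
  then show ?thesis
    unfolding root_ball_def induced_def gdist_le_iff
    using path conv tree_shapeD(3)[OF P] by auto blast+
qed

lemma ball_embedding_iso_class:
  assumes P: "tree_shape q r P" and f: "ball_embedding r s0 P f g" and g: "finite_rooted_graph g"
  shows "iso_class (root_ball r g) = iso_class (tree_graph s0 P (\<lambda>u. gweight g (f u)))"
proof (rule iso_class_eqI[symmetric])
  note v = ball_embedding_vertices[OF assms]
  have e: "(f u, f v) \<in> gedges (root_ball r g) \<longleftrightarrow> (f u, f v) \<in> gedges g" if "u \<in> P" "v \<in> P" for u v
    using that v unfolding root_ball_def induced_def by auto
  have s: "groot (root_ball r g) = groot g" "gspin (root_ball r g) = gspin g" "gweight (root_ball r g) = gweight g"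
    by (simp_all add: root_ball_def induced_def)
  show "mgraph_iso (tree_graph s0 P (\<lambda>u. gweight g (f u))) (root_ball r g)"
    unfolding mgraph_iso_def
    by (rule exI[of _ f]) (use f in \<open>auto simp: tree_graph_def v bij_betw_def s e ball_embedding_def\<close>)
qed (use tree_shapeD(2)[OF P] in \<open>simp add: tree_graph_def\<close>)

section \<open>Counting the embeddings onto one ball\<close>

text \<open>The number of ways to number, in every family, the siblings of equal spin.\<close>

definition orderings :: "nat \<Rightarrow> nat \<Rightarrow> particle set \<Rightarrow> nat" where
  "orderings q r P = (\<Prod>(u, s)\<in>inner_particles r P \<times> {1..q}. fact (offspring P u s))"

lemma orderings_pos: "orderings q r P > 0"
  unfolding orderings_def by (intro prod_pos) auto

lemma finite_inner_particles: "finite P \<Longrightarrow> finite (inner_particles r P)"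
  by (simp add: inner_particles_def)

text \<open>An isomorphism, preserving root and spins, between the trees on two sets of names.\<close>

definition relabelling :: "nat \<Rightarrow> particle set \<Rightarrow> particle set \<Rightarrow> (particle \<Rightarrow> particle) \<Rightarrow> bool" where
  "relabelling s0 P Q g \<longleftrightarrow> bij_betw g P Q \<and> g [] = [] \<and>
     (\<forall>u\<in>P. particle_spin s0 (g u) = particle_spin s0 u) \<and>
     (\<forall>u\<in>P. \<forall>v\<in>P. tree_adjacent (g u) (g v) \<longleftrightarrow> tree_adjacent u v)"

lemma relabelling_inv:
  assumes "relabelling s0 P Q g" "[] \<in> P"
  shows "relabelling s0 Q P (inv_into P g)"
proof -
  have b: "bij_betw g P Q" and g: "g [] = []" using assms by (auto simp: relabelling_def)
  have m: "inv_into P g v \<in> P" "g (inv_into P g v) = v" if "v \<in> Q" for v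
    using that bij_betw_inv_into_right[OF b that] bij_betw_inv_into[OF b] by (auto simp: bij_betw_def)
  have "inv_into P g [] = []" using bij_betw_inv_into_left[OF b assms(2)] g by simp
  moreover have "particle_spin s0 (inv_into P g v) = particle_spin s0 v" if "v \<in> Q" for v
    using m[OF that] assms(1) by (metis relabelling_def)
  moreover have "tree_adjacent (inv_into P g u) (inv_into P g v) \<longleftrightarrow> tree_adjacent u v"
    if "u \<in> Q" "v \<in> Q" for u v
    using m[OF that(1)] m[OF that(2)] assms(1) by (metis relabelling_def)
  ultimately show ?thesis using bij_betw_inv_into[OF b] unfolding relabelling_def by blast
qed

text \<open>A relabelling maps children to children: the only neighbour of a particle that is not its
  child is its parent, whose image is already the parent of the image.\<close>

lemma relabelling_child:
  assumes P: "tree_shape q r P" and g: "relabelling s0 P Q g"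
  shows "u @ [(s, i)] \<in> P \<Longrightarrow> \<exists>j. g (u @ [(s, i)]) = g u @ [(s, j)]"
proof (induction u arbitrary: s i rule: length_induct)
  case (1 u)
  let ?v = "u @ [(s, i)]"
  have uP: "u \<in> P" using 1(2) tree_shapeD(4)[OF P] by (auto simp: inner_particles_def)
  have inj: "inj_on g P" and g0: "g [] = []" using g by (auto simp: relabelling_def bij_betw_def)
  have "tree_adjacent u ?v" by (auto simp: tree_adjacent_def)
  then have adj: "tree_adjacent (g u) (g ?v)" using g uP 1(2) by (simp add: relabelling_def)
  have "\<exists>x. g ?v = g u @ [x]"
  proof (rule ccontr)
    assume "\<nexists>x. g ?v = g u @ [x]"
    with adj obtain x where x: "g u = g ?v @ [x]" by (auto simp: tree_adjacent_def)
    then have "u \<noteq> []" using g0 by auto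
    then obtain w y where w: "u = w @ [y]" by (metis append_butlast_last_id)
    then obtain s' i' where y: "u = w @ [(s', i')]" by (cases y) auto
    then obtain j where "g u = g w @ [(s', j)]" using 1(1) uP by fastforce
    with x have "g ?v = g w" by simp
    moreover have "w \<in> P" using uP y tree_shapeD(4)[OF P] by (auto simp: inner_particles_def)
    ultimately have "?v = w" using inj 1(2) by (auto dest: inj_onD)
    with y show False by (metis append_assoc append_self_conv list.distinct(1) append_is_Nil_conv)
  qed
  then obtain x where x: "g ?v = g u @ [x]" by auto
  have "particle_spin s0 (g ?v) = particle_spin s0 ?v" using g 1(2) by (simp add: relabelling_def)
  then have "fst x = s" using x by (simp add: particle_spin_def)
  with x show ?case by (cases x) auto
qed

lemma relabelling_length:
  assumes P: "tree_shape q r P" and g: "relabelling s0 P Q g" and u: "u \<in> P"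
  shows "length (g u) = length u"
  using u
proof (induction u rule: rev_induct)
  case Nil
  then show ?case using g by (simp add: relabelling_def)
next
  case (snoc x u)
  obtain s i where x: "x = (s, i)" by (cases x)
  have "u \<in> P" using snoc(2) tree_shapeD(4)[OF P] by (auto simp: inner_particles_def x)
  then show ?case using snoc relabelling_child[OF P g, of u s i] by (auto simp: x)
qed

lemma relabelling_offspring_le:
  assumes P: "tree_shape q r P" and Q: "tree_shape q r Q" and g: "relabelling s0 P Q g"
    and u: "u \<in> P"
  shows "offspring P u s \<le> offspring Q (g u) s"
proof -
  define \<theta> where "\<theta> i = (SOME j. g (u @ [(s, i)]) = g u @ [(s, j)])" for i
  have \<theta>: "g (u @ [(s, i)]) = g u @ [(s, \<theta> i)]" if "u @ [(s, i)] \<in> P" for i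
    unfolding \<theta>_def using relabelling_child[OF P g that] by (rule someI_ex)
  have inj: "inj_on g P" and im: "g ` P = Q" using g by (auto simp: relabelling_def bij_betw_def)
  have fin: "finite {j. g u @ [(s, j)] \<in> Q}"
    by (rule finite_subset[of _ "{..<offspring Q (g u) s}"]) (auto simp: tree_shapeD(4)[OF Q])
  show ?thesis unfolding offspring_def
  proof (rule card_inj_on_le[OF _ _ fin])
    show "inj_on \<theta> {i. u @ [(s, i)] \<in> P}"
    proof (rule inj_onI)
      fix i j assume *: "i \<in> {i. u @ [(s, i)] \<in> P}" "j \<in> {i. u @ [(s, i)] \<in> P}" "\<theta> i = \<theta> j"
      then have "g (u @ [(s, i)]) = g (u @ [(s, j)])" using \<theta> by simp
      moreover have "u @ [(s, i)] \<in> P" "u @ [(s, j)] \<in> P" using * by auto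
      ultimately have "u @ [(s, i)] = u @ [(s, j)]" by (rule inj_onD[OF inj])
      then show "i = j" by simp
    qed
    show "\<theta> ` {i. u @ [(s, i)] \<in> P} \<subseteq> {j. g u @ [(s, j)] \<in> Q}"
    proof safe
      fix i assume i: "u @ [(s, i)] \<in> P"
      then have "g (u @ [(s, i)]) \<in> Q" using im by blast
      then show "g u @ [(s, \<theta> i)] \<in> Q" using \<theta>[OF i] by simp
    qed
  qed
qed

lemma relabelling_offspring:
  assumes P: "tree_shape q r P" and Q: "tree_shape q r Q" and g: "relabelling s0 P Q g"
    and u: "u \<in> P"
  shows "offspring Q (g u) s = offspring P u s"
proof (rule antisym)
  have b: "bij_betw g P Q" using g by (simp add: relabelling_def)
  have "g u \<in> Q" using b u by (auto simp: bij_betw_def)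
  from relabelling_offspring_le[OF Q P relabelling_inv[OF g tree_shapeD(2)[OF P]] this]
  show "offspring Q (g u) s \<le> offspring P u s" using bij_betw_inv_into_left[OF b u] by simp
  show "offspring P u s \<le> offspring Q (g u) s"
    by (rule relabelling_offspring_le[OF P Q g u])
qed

lemma orderings_relabelling:
  assumes P: "tree_shape q r P" and Q: "tree_shape q r Q" and g: "relabelling s0 P Q g"
  shows "orderings q r Q = orderings q r P"
proof -
  have b: "inj_on g P" "g ` P = Q" using g by (auto simp: relabelling_def bij_betw_def)
  have "bij_betw g (inner_particles r P) (inner_particles r Q)"
    unfolding bij_betw_def
    using b relabelling_length[OF P g] by (auto simp: inner_particles_def intro: inj_on_subset)
  then have "bij_betw (map_prod g (\<lambda>s. s)) (inner_particles r P \<times> {1..q}) (inner_particles r Q \<times> {1..q})"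
    by (intro bij_betw_map_prod) (auto simp: bij_betw_def)
  from prod.reindex_bij_betw[OF this, of "\<lambda>(u, s). fact (offspring Q u s)"]
  have "orderings q r Q = (\<Prod>x\<in>inner_particles r P \<times> {1..q}. (\<lambda>(u, s). fact (offspring Q u s)) (map_prod g (\<lambda>s. s) x))"
    unfolding orderings_def by (rule sym)
  also have "\<dots> = orderings q r P" unfolding orderings_def
    by (intro prod.cong) (auto simp: relabelling_offspring[OF P Q g] inner_particles_def)
  finally show ?thesis .
qed

text \<open>A relabelling is determined by how it permutes each group of siblings of equal spin.\<close>

lemma card_relabellings:
  assumes P: "tree_shape q r P"
    and R: "\<And>g. g \<in> R \<Longrightarrow> g \<in> extensional P \<and> (\<exists>Q. tree_shape q r Q \<and> relabelling s0 P Q g)"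
  shows "finite R \<and> card R \<le> orderings q r P"
proof -
  let ?I = "inner_particles r P \<times> {1..q}"
  define \<Theta> where "\<Theta> g = (\<lambda>(u, s)\<in>?I. \<lambda>i\<in>{..<offspring P u s}. snd (last (g (u @ [(s, i)]))))"
    for g :: "particle \<Rightarrow> particle"
  let ?B = "\<lambda>us. {\<theta> \<in> {..<offspring P (fst us) (snd us)} \<rightarrow>\<^sub>E {..<offspring P (fst us) (snd us)}.
    inj_on \<theta> {..<offspring P (fst us) (snd us)}}"
  have fI: "finite ?I" using tree_shapeD(1)[OF P] by (simp add: finite_inner_particles)
  have fB: "finite (?B us)" for us
    by (rule finite_subset[of _ "{..<offspring P (fst us) (snd us)} \<rightarrow>\<^sub>E {..<offspring P (fst us) (snd us)}"])
       (auto intro: finite_PiE)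
  have key: "g (u @ [(s, i)]) = g u @ [(s, \<Theta> g (u, s) i)]"
    if "g \<in> R" "u \<in> inner_particles r P" "s \<in> {1..q}" "i < offspring P u s" for g u s i
  proof -
    from R[OF that(1)] obtain Q where Q: "relabelling s0 P Q g" by blast
    have "u @ [(s, i)] \<in> P" using tree_shapeD(4)[OF P] that by blast
    then obtain j where j: "g (u @ [(s, i)]) = g u @ [(s, j)]" using relabelling_child[OF P Q] by blast
    then show ?thesis using that by (simp add: \<Theta>_def)
  qed
  have 1: "inj_on \<Theta> R"
  proof (rule inj_onI)
    fix g g' assume g: "g \<in> R" "g' \<in> R" "\<Theta> g = \<Theta> g'"
    have "g u = g' u" if "u \<in> P" for u
      using that
    proof (induction u rule: rev_induct)
      case Nil
      then show ?case using R[OF g(1)] R[OF g(2)] by (auto simp: relabelling_def)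
    next
      case (snoc x u)
      obtain s i where x: "x = (s, i)" by (cases x)
      have *: "u \<in> inner_particles r P" "s \<in> {1..q}" "i < offspring P u s"
        using snoc(2) tree_shapeD(4)[OF P] by (auto simp: x)
      then have "u \<in> P" by (simp add: inner_particles_def)
      then show ?case using snoc(1) key[OF g(1) *] key[OF g(2) *] g(3) by (simp add: x)
    qed
    then show "g = g'" using R[OF g(1)] R[OF g(2)] by (auto intro: extensionalityI)
  qed
  have 2: "\<Theta> ` R \<subseteq> PiE ?I ?B"
  proof (intro image_subsetI PiE_I)
    fix g us assume g: "g \<in> R" and us: "us \<in> ?I"
    obtain u s where [simp]: "us = (u, s)" by (cases us)
    have u: "u \<in> inner_particles r P" "s \<in> {1..q}" "u \<in> P" using us by (auto simp: inner_particles_def)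
    obtain Q where Q: "tree_shape q r Q" "relabelling s0 P Q g" using R[OF g] by blast
    have inj: "inj_on g P" and im: "g ` P = Q" using Q by (auto simp: relabelling_def bij_betw_def)
    have c: "u @ [(s, i)] \<in> P" if "i < offspring P u s" for i
      using tree_shapeD(4)[OF P] that u by blast
    have "\<Theta> g (u, s) i < offspring P u s" if "i < offspring P u s" for i
    proof -
      have "g u @ [(s, \<Theta> g (u, s) i)] \<in> Q" using key[OF g u(1,2) that] c[OF that] im by (metis imageI)
      then show ?thesis
        using tree_shapeD(4)[OF Q(1)] relabelling_offspring[OF P Q u(3)] by simp
    qed
    moreover have "inj_on (\<Theta> g (u, s)) {..<offspring P u s}"
    proof (rule inj_onI)
      fix i j assume *: "i \<in> {..<offspring P u s}" "j \<in> {..<offspring P u s}" "\<Theta> g (u, s) i = \<Theta> g (u, s) j"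
      then have "g (u @ [(s, i)]) = g (u @ [(s, j)])" using key[OF g u(1,2)] by simp
      moreover have "u @ [(s, i)] \<in> P" "u @ [(s, j)] \<in> P" using * c by auto
      ultimately have "u @ [(s, i)] = u @ [(s, j)]" by (rule inj_onD[OF inj])
      then show "i = j" by simp
    qed
    moreover have "\<Theta> g (u, s) \<in> extensional {..<offspring P u s}"
      using us by (simp add: \<Theta>_def)
    ultimately show "\<Theta> g us \<in> ?B us" by (auto simp: PiE_iff)
  next
    fix g us assume "us \<notin> ?I" then show "\<Theta> g us = undefined" by (auto simp: \<Theta>_def)
  qed
  have 3: "finite (PiE ?I ?B)" using fI fB by (intro finite_PiE) auto
  have "card (PiE ?I ?B) = (\<Prod>us\<in>?I. card (?B us))" by (rule card_PiE[OF fI])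
  also have "\<dots> = (\<Prod>us\<in>?I. fact (offspring P (fst us) (snd us)))"
    by (intro prod.cong refl) (simp add: card_inj_on_subset_funcset fact_prod_rev)
  also have "\<dots> = orderings q r P" by (simp add: orderings_def case_prod_beta)
  finally have "card (PiE ?I ?B) = orderings q r P" .
  then show ?thesis using card_inj_on_le[OF 1 2 3] finite_subset[OF 2 3] finite_imageD[OF _ 1] by simp
qed

text \<open>Two embeddings onto the same ball differ by a relabelling.\<close>

lemma relabelling_ball_embeddings:
  assumes P: "tree_shape q r P" and Q: "tree_shape q r Q" and g: "finite_rooted_graph g"
    and f: "ball_embedding r s0 P f g" and h: "ball_embedding r s0 Q h g"
  shows "relabelling s0 P Q (restrict (\<lambda>u. inv_into Q h (f u)) P)"
    and "\<And>u. u \<in> P \<Longrightarrow> h (inv_into Q h (f u)) = f u"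
proof -
  let ?g = "restrict (\<lambda>u. inv_into Q h (f u)) P"
  have im: "f ` P = h ` Q"
    using ball_embedding_vertices[OF P f g] ball_embedding_vertices[OF Q h g] by simp
  have inj: "inj_on f P" "inj_on h Q" using f h by (auto simp: ball_embedding_def)
  show m: "h (inv_into Q h (f u)) = f u" if "u \<in> P" for u
    using that im by (metis f_inv_into_f imageI)
  have mQ: "inv_into Q h (f u) \<in> Q" if "u \<in> P" for u
    using that im by (metis inv_into_into imageI)
  have b: "bij_betw ?g P Q"
    unfolding bij_betw_def
  proof
    show "inj_on ?g P"
      using m inj(1) by (auto simp: inj_on_def) metis
    show "?g ` P = Q"
    proof
      show "?g ` P \<subseteq> Q" using mQ by auto
      show "Q \<subseteq> ?g ` P"
      proof
        fix v assume v: "v \<in> Q"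
        then obtain u where "u \<in> P" "f u = h v" using im by (metis imageE imageI)
        then show "v \<in> ?g ` P" using v inj(2) by (auto intro!: image_eqI[of _ _ u])
      qed
    qed
  qed
  have N: "[] \<in> P" "[] \<in> Q" using tree_shapeD(2) P Q by auto
  have "f [] = h []" using f h by (simp add: ball_embedding_def)
  then have g0: "?g [] = []" using N inj by simp
  show "relabelling s0 P Q ?g"
    unfolding relabelling_def
  proof (intro conjI b g0 ballI)
    fix u assume u: "u \<in> P"
    have "particle_spin s0 (inv_into Q h (f u)) = gspin g (h (inv_into Q h (f u)))"
      using h mQ[OF u] by (simp add: ball_embedding_def)
    also have "\<dots> = particle_spin s0 u" using f u m by (simp add: ball_embedding_def)
    finally show "particle_spin s0 (?g u) = particle_spin s0 u" using u by simp
    fix v assume v: "v \<in> P"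
    have "tree_adjacent (inv_into Q h (f u)) (inv_into Q h (f v)) \<longleftrightarrow> (f u, f v) \<in> gedges g"
      using h mQ[OF u] mQ[OF v] m[OF u] m[OF v] unfolding ball_embedding_def by metis
    also have "\<dots> \<longleftrightarrow> tree_adjacent u v" using f u v by (simp add: ball_embedding_def)
    finally show "tree_adjacent (?g u) (?g v) \<longleftrightarrow> tree_adjacent u v" using u v by simp
  qed
qed

text \<open>A graph whose ball is a tree has at most \<open>orderings q r P\<close> embeddings, counted over all sets \<open>P\<close>
  of names together, and this number is the same for all \<open>P\<close> that occur.\<close>

lemma sum_ball_embeddings_le_1:
  assumes K: "finite K" "\<And>s P. (s, P) \<in> K \<Longrightarrow> tree_shape q r P" and g: "finite_rooted_graph g"
  shows "(\<Sum>(s, P)\<in>K. \<Sum>f\<in>P \<rightarrow>\<^sub>E gverts g.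
           (if ball_embedding r s P f g then 1 / real (orderings q r P) else 0)) \<le> 1"
proof -
  define H where "H = {(k, f). k \<in> K \<and> f \<in> snd k \<rightarrow>\<^sub>E gverts g \<and> ball_embedding r (fst k) (snd k) f g}"
  let ?S = "Sigma K (\<lambda>k. snd k \<rightarrow>\<^sub>E gverts g)"
  have fV: "finite (gverts g)" using g by (simp add: finite_rooted_graph_def)
  have fP: "finite (snd k)" if "k \<in> K" for k
    using K(2)[of "fst k" "snd k"] that tree_shapeD(1) by auto
  have fS: "finite ?S"
    using K(1) fP fV by (intro finite_SigmaI finite_PiE) auto
  have HS: "H \<subseteq> ?S" by (auto simp: H_def)
  have "(\<Sum>(s, P)\<in>K. \<Sum>f\<in>P \<rightarrow>\<^sub>E gverts g.
           (if ball_embedding r s P f g then 1 / real (orderings q r P) else 0)) =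
    (\<Sum>k\<in>K. \<Sum>f\<in>snd k \<rightarrow>\<^sub>E gverts g.
           (if ball_embedding r (fst k) (snd k) f g then 1 / real (orderings q r (snd k)) else 0))"
    by (simp add: case_prod_beta)
  also have "\<dots> = (\<Sum>(k, f)\<in>?S. (if ball_embedding r (fst k) (snd k) f g then 1 / real (orderings q r (snd k)) else 0))"
    using K(1) fP fV by (subst sum.Sigma) (auto intro: finite_PiE)
  also have "\<dots> = (\<Sum>(k, f)\<in>H. 1 / real (orderings q r (snd k)))"
    by (rule sum.mono_neutral_cong_right[OF fS HS]) (auto simp: H_def split: if_splits)
  also have "\<dots> \<le> 1"
  proof (cases "H = {}")
    case False
    then obtain s P f where H0: "((s, P), f) \<in> H" by auto
    have P: "tree_shape q r P" and f: "ball_embedding r s P f g"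
      using H0 K(2) by (auto simp: H_def)
    have other: "s' = s \<and> tree_shape q r Q \<and> ball_embedding r s Q h g" if "((s', Q), h) \<in> H" for s' Q h
    proof -
      have Q: "tree_shape q r Q" and h: "ball_embedding r s' Q h g" using that K(2) by (auto simp: H_def)
      have "gspin g (groot g) = s" "gspin g (groot g) = s'"
        using f h tree_shapeD(2)[OF P] tree_shapeD(2)[OF Q]
        by (auto simp: ball_embedding_def particle_spin_def dest!: bspec[where x="[]"])
      then show ?thesis using Q h by simp
    qed
    \<comment> \<open>All embeddings are compared with the fixed embedding \<open>f\<close>.\<close>
    define \<Psi> where "\<Psi> = (\<lambda>(k :: nat \<times> particle set, h). restrict (\<lambda>u. inv_into (snd k) h (f u)) P)"
    have inj: "inj_on \<Psi> H"
    proof (rule inj_onI)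
      fix x y assume xy: "x \<in> H" "y \<in> H" "\<Psi> x = \<Psi> y"
      obtain s1 Q1 h1 s2 Q2 h2 where x: "x = ((s1, Q1), h1)" and y: "y = ((s2, Q2), h2)"
        by (metis surj_pair)
      note o1 = other[OF xy(1)[unfolded x]] and o2 = other[OF xy(2)[unfolded y]]
      have 1: "relabelling s P Q1 (\<Psi> x)" "\<And>u. u \<in> P \<Longrightarrow> h1 (\<Psi> x u) = f u"
        using relabelling_ball_embeddings[OF P _ g f, of Q1 h1] o1 by (auto simp: \<Psi>_def x)
      have 2: "relabelling s P Q2 (\<Psi> y)" "\<And>u. u \<in> P \<Longrightarrow> h2 (\<Psi> y u) = f u"
        using relabelling_ball_embeddings[OF P _ g f, of Q2 h2] o2 by (auto simp: \<Psi>_def y)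
      have Q: "Q1 = \<Psi> x ` P" "Q2 = \<Psi> x ` P"
        using 1(1) 2(1) xy(3) unfolding relabelling_def bij_betw_def by simp_all
      have Q12: "Q2 = Q1" by (rule trans[OF Q(2) Q(1)[symmetric]])
      have "h1 v = h2 v" if "v \<in> Q1" for v
      proof -
        from that obtain u where "u \<in> P" "v = \<Psi> x u" unfolding Q(1) by blast
        then show ?thesis using 1(2)[of u] 2(2)[of u] xy(3) by metis
      qed
      moreover have "h1 \<in> extensional Q1" "h2 \<in> extensional Q2"
        using xy(1,2) unfolding H_def x y by (simp_all add: PiE_iff)
      ultimately have "h1 = h2" unfolding Q12 by (intro extensionalityI) auto
      then show "x = y" using Q12 o1 o2 unfolding x y by simp
    qed
    have "finite (\<Psi> ` H) \<and> card (\<Psi> ` H) \<le> orderings q r P"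
    proof (rule card_relabellings[OF P])
      fix g' assume "g' \<in> \<Psi> ` H"
      then obtain s' Q h where H1: "((s', Q), h) \<in> H" and g': "g' = \<Psi> ((s', Q), h)" by auto
      then show "g' \<in> extensional P \<and> (\<exists>Q. tree_shape q r Q \<and> relabelling s P Q g')"
        using other[OF H1] relabelling_ball_embeddings(1)[OF P _ g f, of Q h] by (auto simp: \<Psi>_def)
    qed
    then have "card H \<le> orderings q r P" using card_image[OF inj] by simp
    have "(\<Sum>(k, f)\<in>H. 1 / real (orderings q r (snd k))) = (\<Sum>(k, f)\<in>H. 1 / real (orderings q r P))"
    proof (intro sum.cong refl)
      fix x assume x: "x \<in> H"
      obtain s' Q h where [simp]: "x = ((s', Q), h)" by (metis surj_pair)
      have "relabelling s P Q (restrict (\<lambda>u. inv_into Q h (f u)) P)" "tree_shape q r Q"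
        using other x relabelling_ball_embeddings(1)[OF P _ g f, of Q h] by auto
      then show "(case x of (k, f) \<Rightarrow> 1 / real (orderings q r (snd k))) = (case x of (k, f) \<Rightarrow> 1 / real (orderings q r P))"
        using orderings_relabelling[OF P] by simp
    qed
    also have "\<dots> = real (card H) / real (orderings q r P)" by (simp add: case_prod_beta)
    also have "\<dots> \<le> 1" using \<open>card H \<le> orderings q r P\<close> orderings_pos[of q r P] by simp
    finally show ?thesis .
  qed simp
  finally show ?thesis .
qed

section \<open>Products of probability kernels\<close>

lemma measurable_PiM_kernel:
  assumes K: "\<And>i. i \<in> I \<Longrightarrow> K i \<in> M \<rightarrow>\<^sub>M prob_algebra (N i)"
  shows "(\<lambda>x. PiM I (\<lambda>i. K i x)) \<in> M \<rightarrow>\<^sub>M prob_algebra (PiM I N)"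
proof (rule measurable_prob_algebra_generated[OF sets_PiM Int_stable_prod_algebra prod_algebra_sets_into_space])
  have p: "prob_space (K i x)" and s: "sets (K i x) = sets (N i)" if "i \<in> I" "x \<in> space M" for i x
    using measurable_space[OF K that(2)] that(1) by (auto simp: space_prob_algebra)
  fix x assume x: "x \<in> space M"
  show "prob_space (PiM I (\<lambda>i. K i x))" using p x by (intro prob_space_PiM) auto
  show "sets (PiM I (\<lambda>i. K i x)) = sets (PiM I N)" using s x by (intro sets_PiM_cong) auto
next
  have p: "prob_space (K i x)" and s: "sets (K i x) = sets (N i)" if "i \<in> I" "x \<in> space M" for i x
    using measurable_space[OF K that(2)] that(1) by (auto simp: space_prob_algebra)
  fix A assume "A \<in> prod_algebra I N"
  then obtain J E where A: "A = prod_emb I N J (Pi\<^sub>E J E)" "finite J" "J \<subseteq> I" "\<And>i. i \<in> J \<Longrightarrow> E i \<in> sets (N i)"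
    by (rule prod_algebraE) auto
  have "(\<lambda>x. \<Prod>i\<in>J. emeasure (K i x) (E i)) \<in> borel_measurable M"
  proof (intro borel_measurable_prod_ennreal)
    fix i assume "i \<in> J"
    with A(3,4) show "(\<lambda>x. emeasure (K i x) (E i)) \<in> borel_measurable M"
      by (intro measurable_emeasure_kernel[OF measurable_prob_algebraD[OF K]]) auto
  qed
  moreover have "emeasure (PiM I (\<lambda>i. K i x)) A = (\<Prod>i\<in>J. emeasure (K i x) (E i))" if x: "x \<in> space M" for x
  proof -
    have "A = prod_emb I (\<lambda>i. K i x) J (Pi\<^sub>E J E)"
      unfolding A prod_emb_def using sets_eq_imp_space_eq[OF s[OF _ x]] by (auto simp: PiE_iff)
    then show ?thesis using A s[OF _ x] p[OF _ x] by (simp add: emeasure_PiM_emb subset_eq)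
  qed
  ultimately show "(\<lambda>x. emeasure (PiM I (\<lambda>i. K i x)) A) \<in> borel_measurable M"
    by (simp cong: measurable_cong)
qed

lemma measurable_discrete_kernel:
  fixes K :: "'a \<Rightarrow> 'b :: countable measure"
  assumes p: "\<And>x. x \<in> space M \<Longrightarrow> prob_space (K x)" and s: "\<And>x. sets (K x) = UNIV"
    and K: "\<And>k. (\<lambda>x. emeasure (K x) {k}) \<in> borel_measurable M"
  shows "K \<in> M \<rightarrow>\<^sub>M prob_algebra (count_space UNIV)"
proof (rule measurable_prob_algebra_generated[where \<Omega> = UNIV and G = UNIV])
  fix A :: "'b set"
  define F where "F n = {k\<in>A. to_nat k = n}" for n
  have "(\<lambda>x. emeasure (K x) (F n)) \<in> borel_measurable M" for n
  proof (cases "\<exists>k\<in>A. to_nat k = n")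
    case True
    then obtain k where "k \<in> A" "to_nat k = n" by blast
    then have "F n = {k}" by (auto simp: F_def)
    then show ?thesis using K by simp
  next
    case False
    then have "F n = {}" by (auto simp: F_def)
    then show ?thesis by simp
  qed
  then have "(\<lambda>x. \<Sum>n. emeasure (K x) (F n)) \<in> borel_measurable M" by measurable
  moreover have "(\<Sum>n. emeasure (K x) (F n)) = emeasure (K x) A" for x
  proof -
    have "(\<Sum>n. emeasure (K x) (F n)) = emeasure (K x) (\<Union>n. F n)"
      by (rule suminf_emeasure) (auto simp: s disjoint_family_on_def F_def)
    also have "(\<Union>n. F n) = A" by (auto simp: F_def)
    finally show ?thesis .
  qed
  ultimately show "(\<lambda>x. emeasure (K x) A) \<in> borel_measurable M" by simp
qed (use p s in \<open>auto simp: Int_stable_def intro: sigma_sets.Basic\<close>)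

lemma pmf_bernoulli_clamp:
  "pmf (bernoulli_pmf p) k = (if k then min 1 (max 0 p) else 1 - min 1 (max 0 p))"
proof -
  interpret pmf_as_function .
  show ?thesis by transfer simp
qed

lemma measurable_poisson_law:
  assumes [measurable]: "f \<in> borel_measurable M"
  shows "(\<lambda>x. poisson_law (f x)) \<in> M \<rightarrow>\<^sub>M prob_algebra (count_space UNIV)"
proof (rule measurable_discrete_kernel)
  fix k :: nat
  have "emeasure (poisson_law (f x)) {k} = ennreal (if 0 < f x then f x ^ k / fact k * exp (- f x) else if k = 0 then 1 else 0)" for x
    by (simp add: poisson_law_def emeasure_pmf_single)
  then show "(\<lambda>x. emeasure (poisson_law (f x)) {k}) \<in> borel_measurable M" by simp
qed (simp_all add: poisson_law_def prob_space_measure_pmf)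

lemma measurable_bernoulli_kernel:
  assumes [measurable]: "f \<in> borel_measurable M"
  shows "(\<lambda>x. measure_pmf (bernoulli_pmf (f x))) \<in> M \<rightarrow>\<^sub>M prob_algebra (count_space UNIV)"
proof (rule measurable_discrete_kernel)
  fix k :: bool
  have "emeasure (measure_pmf (bernoulli_pmf (f x))) {k} = ennreal (if k then min 1 (max 0 (f x)) else 1 - min 1 (max 0 (f x)))" for x
    by (simp add: emeasure_pmf_single pmf_bernoulli_clamp)
  then show "(\<lambda>x. emeasure (measure_pmf (bernoulli_pmf (f x))) {k}) \<in> borel_measurable M" by simp
qed (simp_all add: prob_space_measure_pmf)

section \<open>The law of the branching process\<close>

text \<open>The two models for a weight law with a positive lower bound and a finite mean.\<close>

locale dcsbm_model = prob_space \<nu> for \<nu> :: "real measure" +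
  fixes q :: nat and a b \<phi>\<^sub>0 :: real and W :: "real set"
  assumes q_pos: "q \<ge> 1" and a_pos: "a > 0" and b_pos: "b > 0" and \<phi>\<^sub>0_pos: "\<phi>\<^sub>0 > 0"
    and sets_\<nu> [measurable_cong]: "sets \<nu> = sets borel"
    and W_sets [measurable]: "W \<in> sets borel" and AE_W: "AE x in \<nu>. x \<in> W"
    and weight_ge: "AE x in \<nu>. \<phi>\<^sub>0 \<le> x" and integrable_weight: "integrable \<nu> (\<lambda>x. x)"
begin

text \<open>Independent weights with law \<open>\<nu>\<close>, indexed by \<open>A\<close>.\<close>

abbreviation weights :: "'i set \<Rightarrow> ('i \<Rightarrow> real) measure" where
  "weights A \<equiv> PiM A (\<lambda>_. \<nu>)"

text \<open>The mean weight.\<close>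

definition \<Phi> :: real where "\<Phi> = moment W \<nu> 1"

lemma \<Phi>_eq: "\<Phi> = (\<integral>x. x \<partial>\<nu>)"
  unfolding \<Phi>_def moment_def set_lebesgue_integral_def
  by (intro integral_cong_AE) (use AE_W in \<open>auto simp: indicator_def elim!: eventually_mono\<close>)

lemma \<Phi>_pos: "\<Phi> > 0"
proof -
  have "\<phi>\<^sub>0 \<le> (\<integral>x. x \<partial>\<nu>)" by (rule integral_ge_const[OF integrable_weight weight_ge])
  then show ?thesis using \<phi>\<^sub>0_pos \<Phi>_eq by simp
qed

lemma affinity_pos: "affinity a b s t > 0"
  using a_pos b_pos by (simp add: affinity_def)

lemma space_\<nu>: "space \<nu> = UNIV"
  using sets_eq_imp_space_eq[OF sets_\<nu>] by simp

lemma sets_size_biased [measurable_cong]: "sets (size_biased W \<nu>) = sets borel"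
  by (simp add: size_biased_def sets_\<nu>)

lemma prob_space_size_biased: "prob_space (size_biased W \<nu>)"
proof
  have "emeasure (size_biased W \<nu>) (space (size_biased W \<nu>)) = (\<integral>\<^sup>+x. ennreal (x / \<Phi>) \<partial>\<nu>)"
    by (simp add: size_biased_def emeasure_density \<Phi>_def cong: nn_integral_cong)
  also have "\<dots> = ennreal (\<integral>x. x / \<Phi> \<partial>\<nu>)"
    using \<Phi>_pos \<phi>\<^sub>0_pos weight_ge integrable_weight
    by (intro nn_integral_eq_integral) (auto elim!: eventually_mono)
  also have "(\<integral>x. x / \<Phi> \<partial>\<nu>) = 1" using \<Phi>_pos \<Phi>_eq by simp
  finally show "emeasure (size_biased W \<nu>) (space (size_biased W \<nu>)) = 1" by simp
qed

text \<open>The probability that a particle of spin \<open>s\<close> and weight \<open>y\<close> has \<open>d t\<close> children of every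
  spin \<open>t\<close>.\<close>

definition offspring_prob :: "nat \<Rightarrow> (nat \<Rightarrow> nat) \<Rightarrow> real \<Rightarrow> real" where
  "offspring_prob s d y =
     (\<Prod>t\<in>{1..q}. measure (poisson_law (affinity a b s t / real q * \<Phi> * y)) {d t})"

lemma measurable_offspring_kernel:
  "(\<lambda>y. PiM {1..q} (\<lambda>t. poisson_law (affinity a b s t / real q * \<Phi> * y)))
     \<in> borel \<rightarrow>\<^sub>M prob_algebra (PiM {1..q} (\<lambda>_. count_space UNIV))"
  by (intro measurable_PiM_kernel measurable_poisson_law) auto

lemma particle_law_prob_algebra:
  assumes "prob_space \<mu>" "sets \<mu> = sets borel"
  shows "particle_law q a b \<Phi> \<mu> s \<in> space (prob_algebra (particle_space q))"
proof -
  have \<mu>: "(\<lambda>_. \<mu>) \<in> count_space UNIV \<rightarrow>\<^sub>M prob_algebra borel"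
    using assms by (intro measurable_const) (auto simp: space_prob_algebra)
  note [measurable] = measurable_offspring_kernel measurable_return_prob_space
  have "(\<lambda>_. particle_law q a b \<Phi> \<mu> s) \<in> count_space (UNIV :: unit set) \<rightarrow>\<^sub>M prob_algebra (particle_space q)"
    unfolding particle_law_def particle_space_def
  proof (rule measurable_bind_prob_space2[OF \<mu>], unfold split_beta,
      rule measurable_bind_prob_space2[where N = "PiM {1..q} (\<lambda>_. count_space UNIV)"])
  qed measurable
  from measurable_space[OF this, of "()"] show ?thesis by simp
qed

lemma sets_particle_law:
  assumes "prob_space \<mu>" "sets \<mu> = sets borel"
  shows "sets (particle_law q a b \<Phi> \<mu> s) = sets (particle_space q)"
    "space (particle_law q a b \<Phi> \<mu> s) = space (particle_space q)"
    "prob_space (particle_law q a b \<Phi> \<mu> s)"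
  using particle_law_prob_algebra[OF assms, of s] sets_eq_imp_space_eq
  by (auto simp: space_prob_algebra)

text \<open>The flag \<open>parent\<close> says whether the numbers of children are prescribed; they are not for the
  last generation.\<close>

lemma emeasure_particle_law:
  assumes \<mu>: "prob_space \<mu>" "sets \<mu> = sets borel" and [measurable]: "B \<in> sets borel"
  shows "emeasure (particle_law q a b \<Phi> \<mu> s)
      {x \<in> space (particle_space q). fst x \<in> B \<and> (parent \<longrightarrow> (\<forall>t\<in>{1..q}. snd x t = d t))} =
    (\<integral>\<^sup>+y. ennreal (if parent then offspring_prob s d y else 1) * indicator B y \<partial>\<mu>)"
proof -
  let ?C = "PiM {1..q} (\<lambda>_. count_space (UNIV :: nat set))"
  let ?g = "\<lambda>y. ennreal (if parent then offspring_prob s d y else 1)"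
  let ?K = "\<lambda>y. PiM {1..q} (\<lambda>t. poisson_law (affinity a b s t / real q * \<Phi> * y))"
  let ?N = "{N \<in> space ?C. parent \<longrightarrow> (\<forall>t\<in>{1..q}. N t = d t)}"
  let ?R = "\<lambda>y :: real. ?K y \<bind> (\<lambda>N. return (borel \<Otimes>\<^sub>M ?C) (y, N))"
  let ?X = "{x \<in> space (borel \<Otimes>\<^sub>M ?C). fst x \<in> B \<and> (parent \<longrightarrow> (\<forall>t\<in>{1..q}. snd x t = d t))}"
  note [measurable] = measurable_offspring_kernel[of s] measurable_return_prob_space
  have mu: "\<mu> \<in> space (prob_algebra borel)" using \<mu> by (auto simp: space_prob_algebra)
  have X[measurable]: "?X \<in> sets (borel \<Otimes>\<^sub>M ?C)" by measurable
  have r: "(\<lambda>N. return (borel \<Otimes>\<^sub>M ?C) (y, N)) \<in> ?C \<rightarrow>\<^sub>M prob_algebra (borel \<Otimes>\<^sub>M ?C)" for y :: real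
    by measurable
  have K: "?K y \<in> space (prob_algebra ?C)" for y
    using measurable_space[OF measurable_offspring_kernel, of y s] by simp
  have m: "?R \<in> borel \<rightarrow>\<^sub>M prob_algebra (borel \<Otimes>\<^sub>M ?C)"
    by (rule measurable_bind_prob_space2[where N = ?C]) measurable
  have "emeasure (particle_law q a b \<Phi> \<mu> s) ?X = (\<integral>\<^sup>+y. emeasure (?R y) ?X \<partial>\<mu>)"
    unfolding particle_law_def particle_space_def
    by (rule emeasure_bind_prob_algebra[OF mu m X])
  also have "\<dots> = (\<integral>\<^sup>+y. ?g y * indicator B y \<partial>\<mu>)"
  proof (rule nn_integral_cong)
    fix y :: real
    interpret K: prob_space "?K y" using K[of y] by (simp add: space_prob_algebra)
    have sK: "space (?K y) = space ?C" using K[of y] by (auto simp: space_prob_algebra dest: sets_eq_imp_space_eq)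
    have sP: "sets (poisson_law r) = UNIV" "space (poisson_law r) = UNIV" "prob_space (poisson_law r)" for r
      by (simp_all add: poisson_law_def prob_space_measure_pmf)
    have "emeasure (?R y) ?X = (\<integral>\<^sup>+N. emeasure (return (borel \<Otimes>\<^sub>M ?C) (y, N)) ?X \<partial>?K y)"
      by (rule emeasure_bind_prob_algebra[OF K r X])
    also have "\<dots> = (\<integral>\<^sup>+N. indicator B y * indicator ?N N \<partial>?K y)"
      by (intro nn_integral_cong) (auto simp: indicator_def space_pair_measure sK)
    also have "\<dots> = indicator B y * emeasure (?K y) ?N"
    proof (rule nn_integral_cmult_indicator)
      have "?N \<in> sets ?C" by measurable
      then show "?N \<in> sets (?K y)"
        using K[of y] by (simp add: space_prob_algebra)
    qed
    also have "emeasure (?K y) ?N = ?g y"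
    proof (cases parent)
      case True
      have "{N \<in> space ?C. \<forall>t\<in>{1..q}. N t = d t} = Pi\<^sub>E {1..q} (\<lambda>t. {d t})"
        by (auto simp: space_PiM PiE_iff extensional_def)
      moreover interpret product_sigma_finite "\<lambda>t. poisson_law (affinity a b s t / real q * \<Phi> * y)"
        unfolding product_sigma_finite_def using sP(3) by (auto intro: prob_space_imp_sigma_finite)
      have "emeasure (?K y) (Pi\<^sub>E {1..q} (\<lambda>t. {d t})) =
        (\<Prod>t\<in>{1..q}. emeasure (poisson_law (affinity a b s t / real q * \<Phi> * y)) {d t})"
        by (intro emeasure_PiM) (auto simp: sP)
      moreover have "\<dots> = ennreal (offspring_prob s d y)"
        unfolding offspring_prob_def
        by (subst prod_ennreal[symmetric]) (auto simp: finite_measure.emeasure_eq_measure[OF prob_space.finite_measure[OF sP(3)]])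
      ultimately show ?thesis using True by simp
    next
      case False
      then show ?thesis using K.emeasure_space_1 unfolding sK by simp
    qed
    finally show "emeasure (?R y) ?X = ?g y * indicator B y" by (simp add: mult.commute)
  qed
  finally show ?thesis by (simp add: particle_space_def)
qed

lemma offspring_prob_nonneg: "offspring_prob s d y \<ge> 0"
  unfolding offspring_prob_def by (intro prod_nonneg) auto

lemma measurable_offspring_prob [measurable]: "offspring_prob s d \<in> borel_measurable borel"
proof -
  have [measurable]: "(\<lambda>y. poisson_law (affinity a b s t / real q * \<Phi> * y)) \<in> borel \<rightarrow>\<^sub>M subprob_algebra (count_space UNIV)" for t
    by (intro measurable_prob_algebraD measurable_poisson_law) auto
  have "(\<lambda>y. measure (poisson_law (affinity a b s t / real q * \<Phi> * y)) {d t}) \<in> borel_measurable borel" for t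
    by measurable
  then show ?thesis unfolding offspring_prob_def[abs_def] by measurable
qed

text \<open>The law of a particle in the branching process, given the spin of the root.\<close>

definition bp_particle :: "nat \<Rightarrow> particle \<Rightarrow> (real \<times> (nat \<Rightarrow> nat)) measure" where
  "bp_particle s0 u = particle_law q a b \<Phi> (if u = [] then \<nu> else size_biased W \<nu>) (particle_spin s0 u)"

lemma bp_weight_law: "prob_space (if u = [] then \<nu> else size_biased W \<nu>)"
    "sets (if u = [] then \<nu> else size_biased W \<nu>) = sets borel"
  using prob_space_axioms prob_space_size_biased sets_\<nu> sets_size_biased by auto

lemma bp_particle_props:
  "sets (bp_particle s0 u) = sets (particle_space q)"
  "space (bp_particle s0 u) = space (particle_space q)"
  "prob_space (bp_particle s0 u)"
  unfolding bp_particle_def by (rule sets_particle_law[OF bp_weight_law])+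

text \<open>The density, with respect to \<open>\<nu>\<close>, of the weight of the particle \<open>u\<close> on the event that its
  children are those in \<open>P\<close>. The factor \<open>y / \<Phi>\<close> comes from the size-biasing; it is cut off at \<open>0\<close>
  because weights are positive only almost surely.\<close>

definition particle_density :: "nat \<Rightarrow> nat \<Rightarrow> particle set \<Rightarrow> particle \<Rightarrow> real \<Rightarrow> real" where
  "particle_density r s0 P u y = (if u = [] then 1 else max 0 (y / \<Phi>)) *
     (if length u < r then offspring_prob (particle_spin s0 u) (offspring P u) y else 1)"

lemma particle_density_nonneg: "particle_density r s0 P u y \<ge> 0"
  by (auto simp: particle_density_def offspring_prob_nonneg intro!: mult_nonneg_nonneg)

lemma measurable_particle_density [measurable]: "particle_density r s0 P u \<in> borel_measurable borel"
  unfolding particle_density_def[abs_def] by measurable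

lemma emeasure_bp_particle:
  assumes [measurable]: "B \<in> sets borel"
  shows "emeasure (bp_particle s0 u) {x \<in> space (particle_space q). fst x \<in> B \<and>
      (length u < r \<longrightarrow> (\<forall>t\<in>{1..q}. snd x t = offspring P u t))} =
    emeasure (density \<nu> (\<lambda>y. ennreal (particle_density r s0 P u y))) B"
proof -
  let ?d = "particle_density r s0 P u"
  let ?E = "{x \<in> space (particle_space q). fst x \<in> B \<and>
      (length u < r \<longrightarrow> (\<forall>t\<in>{1..q}. snd x t = offspring P u t))}"
  let ?g = "\<lambda>y. if length u < r then offspring_prob (particle_spin s0 u) (offspring P u) y else 1"
  have g: "?g y \<ge> 0" for y by (simp add: offspring_prob_nonneg)
  have [measurable]: "?g \<in> borel_measurable borel" by measurable
  have "emeasure (bp_particle s0 u) ?E =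
    (\<integral>\<^sup>+y. ennreal (?g y) * indicator B y \<partial>(if u = [] then \<nu> else size_biased W \<nu>))"
    unfolding bp_particle_def by (rule emeasure_particle_law[OF bp_weight_law]) measurable
  also have "\<dots> = (\<integral>\<^sup>+y. ennreal (?d y) * indicator B y \<partial>\<nu>)"
  proof (cases "u = []")
    case True
    then show ?thesis unfolding particle_density_def by simp
  next
    case False
    have "(\<integral>\<^sup>+y. ennreal (?g y) * indicator B y \<partial>(size_biased W \<nu>)) =
      (\<integral>\<^sup>+y. ennreal (y / \<Phi>) * (ennreal (?g y) * indicator B y) \<partial>\<nu>)"
      unfolding size_biased_def \<Phi>_def[symmetric] by (rule nn_integral_density) measurable
    also have "\<dots> = (\<integral>\<^sup>+y. ennreal (?d y) * indicator B y \<partial>\<nu>)"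
    proof (rule nn_integral_cong)
      fix y :: real
      have "ennreal (y / \<Phi>) = ennreal (max 0 (y / \<Phi>))" by (simp add: ennreal_max_0)
      moreover have "ennreal (?d y) = ennreal (max 0 (y / \<Phi>)) * ennreal (?g y)"
        using False g[of y] by (simp only: particle_density_def if_False) (rule ennreal_mult, auto)
      ultimately show "ennreal (y / \<Phi>) * (ennreal (?g y) * indicator B y) =
        ennreal (?d y) * indicator B y" by (simp add: mult.assoc)
    qed
    finally show ?thesis using False by simp
  qed
  also have "\<dots> = emeasure (density \<nu> (\<lambda>y. ennreal (?d y))) B"
    by (subst emeasure_density) auto
  finally show ?thesis .
qed

text \<open>The joint density of the weights on the event that the family tree is \<open>P\<close>.\<close>

lemma emeasure_bp_tree:
  assumes P: "tree_shape q r P" and A: "A \<in> sets (PiM P (\<lambda>_. borel))"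
  shows "emeasure (PiM UNIV (bp_particle s0))
      {X \<in> space (PiM UNIV (\<lambda>_. particle_space q)).
         family_tree q r (\<lambda>u. snd (X u)) = P \<and> (\<lambda>u\<in>P. fst (X u)) \<in> A} =
    (\<integral>\<^sup>+x. ennreal (\<Prod>u\<in>P. particle_density r s0 P u (x u)) * indicator A x \<partial>weights P)"
proof -
  let ?d = "particle_density r s0 P"
  let ?B = "PiM P (\<lambda>_. borel :: real measure)"
  let ?S = "PiM UNIV (\<lambda>_ :: particle. particle_space q)"
  let ?\<Pi> = "PiM UNIV (bp_particle s0)"
  have fP: "finite P" using tree_shapeD[OF P] by simp
  interpret bp: product_prob_space "bp_particle s0" UNIV
    by (rule product_prob_spaceI) (rule bp_particle_props(3))
  interpret \<nu>P: product_sigma_finite "\<lambda>_ :: particle. \<nu>"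
    unfolding product_sigma_finite_def using prob_space_imp_sigma_finite[OF prob_space_axioms] by simp
  have sS: "sets ?\<Pi> = sets ?S" by (intro sets_PiM_cong) (auto simp: bp_particle_props)
  have spS: "space ?\<Pi> = space ?S" by (rule sets_eq_imp_space_eq[OF sS])
  have sB: "sets (weights P) = sets ?B" by (intro sets_PiM_cong) (auto simp: sets_\<nu>)
  have [measurable]: "(\<lambda>X. X u) \<in> ?S \<rightarrow>\<^sub>M particle_space q" for u
    by (rule measurable_component_singleton) simp
  have [measurable]: "fst \<in> particle_space q \<rightarrow>\<^sub>M borel" "snd \<in> particle_space q \<rightarrow>\<^sub>M PiM {1..q} (\<lambda>_. count_space UNIV)"
    unfolding particle_space_def by measurable
  let ?Ev = "{X \<in> space ?S. \<forall>u\<in>inner_particles r P. \<forall>t\<in>{1..q}. snd (X u) t = offspring P u t}"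
  have Ev: "?Ev \<in> sets ?S"
    using finite_inner_particles[OF fP, of r] by measurable
  let ?w = "\<lambda>X :: particle \<Rightarrow> real \<times> (nat \<Rightarrow> nat). \<lambda>u\<in>P. fst (X u)"
  have w: "?w \<in> ?S \<rightarrow>\<^sub>M ?B" by measurable
  have w': "?w \<in> density ?\<Pi> (indicator ?Ev) \<rightarrow>\<^sub>M ?B"
    using w by (simp cong: measurable_cong_sets add: sS)
  \<comment> \<open>Both sides, as functions of \<open>A\<close>, are the product of the measures \<open>?D u\<close>, by comparison on boxes.\<close>
  let ?M1 = "distr (density ?\<Pi> (indicator ?Ev)) ?B ?w"
  let ?M2 = "density (weights P) (\<lambda>x. \<Prod>u\<in>P. ennreal (?d u (x u)))"
  let ?D = "\<lambda>u. density \<nu> (\<lambda>y. ennreal (?d u y))"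
  have em1: "emeasure ?M1 C = emeasure ?\<Pi> {X \<in> ?Ev. ?w X \<in> C}" if C: "C \<in> sets ?B" for C
  proof -
    have C': "?w -` C \<inter> space ?S \<in> sets ?\<Pi>" using measurable_sets[OF w C] sS by simp
    have "emeasure ?M1 C = emeasure (density ?\<Pi> (indicator ?Ev)) (?w -` C \<inter> space ?S)"
      unfolding emeasure_distr[OF w' C] by (simp only: space_density spS)
    also have "\<dots> = (\<integral>\<^sup>+X. indicator ?Ev X * indicator (?w -` C \<inter> space ?S) X \<partial>?\<Pi>)"
      using Ev C' by (intro emeasure_density borel_measurable_indicator) (auto simp only: sS)
    also have "\<dots> = (\<integral>\<^sup>+X. indicator {X \<in> ?Ev. ?w X \<in> C} X \<partial>?\<Pi>)"
      by (intro nn_integral_cong) (auto simp: indicator_def spS)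
    also have "\<dots> = emeasure ?\<Pi> {X \<in> ?Ev. ?w X \<in> C}"
    proof (rule nn_integral_indicator)
      have "{X \<in> ?Ev. ?w X \<in> C} = ?Ev \<inter> (?w -` C \<inter> space ?S)" by auto
      then show "{X \<in> ?Ev. ?w X \<in> C} \<in> sets ?\<Pi>" using Ev C' sS by auto
    qed
    finally show ?thesis .
  qed
  interpret D: product_sigma_finite ?D
    unfolding product_sigma_finite_def
  proof
    fix u
    show "sigma_finite_measure (?D u)"
      by (subst sigma_finite_measure.sigma_finite_iff_density_finite)
         (auto intro: prob_space_imp_sigma_finite prob_space_axioms)
  qed
  have sD: "sets (PiM P ?D) = sets ?B" by (intro sets_PiM_cong) (auto simp: sets_\<nu>)
  have "?M1 = PiM P ?D"
  proof (rule D.PiM_eqI[OF fP])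
    fix C assume C: "\<And>u. u \<in> P \<Longrightarrow> C u \<in> sets (?D u)"
    then have C[measurable]: "C u \<in> sets borel" if "u \<in> P" for u using that by (auto simp: sets_\<nu>)
    let ?E = "\<lambda>u. {x \<in> space (particle_space q). fst x \<in> C u \<and>
      (length u < r \<longrightarrow> (\<forall>t\<in>{1..q}. snd x t = offspring P u t))}"
    have E: "?E u \<in> sets (bp_particle s0 u)" if "u \<in> P" for u
      unfolding bp_particle_props using C[OF that] by measurable
    have "emeasure ?M1 (Pi\<^sub>E P C) = emeasure ?\<Pi> {X \<in> ?Ev. ?w X \<in> Pi\<^sub>E P C}"
      using C fP by (intro em1) (auto intro!: sets_PiM_I_finite)
    also have "{X \<in> ?Ev. ?w X \<in> Pi\<^sub>E P C} = {X \<in> space ?\<Pi>. \<forall>u\<in>P. X u \<in> ?E u}"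
      unfolding spS by (auto simp: space_PiM inner_particles_def PiE_iff)
    also have "emeasure ?\<Pi> {X \<in> space ?\<Pi>. \<forall>u\<in>P. X u \<in> ?E u} = (\<Prod>u\<in>P. emeasure (bp_particle s0 u) (?E u))"
      using fP E by (intro bp.emeasure_PiM_Collect) auto
    also have "\<dots> = (\<Prod>u\<in>P. emeasure (?D u) (C u))"
      using C by (intro prod.cong refl emeasure_bp_particle) auto
    finally show "emeasure ?M1 (Pi\<^sub>E P C) = (\<Prod>u\<in>P. emeasure (?D u) (C u))" .
  qed (simp add: sD)
  moreover have "?M2 = PiM P ?D"
  proof (rule D.PiM_eqI[OF fP])
    fix C assume C: "\<And>u. u \<in> P \<Longrightarrow> C u \<in> sets (?D u)"
    then have C[measurable]: "C u \<in> sets borel" if "u \<in> P" for u using that by (auto simp: sets_\<nu>)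
    have "emeasure ?M2 (Pi\<^sub>E P C) =
      (\<integral>\<^sup>+x. (\<Prod>u\<in>P. ennreal (?d u (x u))) * indicator (Pi\<^sub>E P C) x \<partial>weights P)"
      using fP C by (intro emeasure_density) (auto intro!: sets_PiM_I_finite simp: sets_\<nu>)
    also have "\<dots> = (\<integral>\<^sup>+x. (\<Prod>u\<in>P. ennreal (?d u (x u)) * indicator (C u) (x u)) \<partial>weights P)"
    proof (rule nn_integral_cong)
      fix x assume x: "x \<in> space (weights P)"
      then have "indicator (Pi\<^sub>E P C) x = (\<Prod>u\<in>P. indicator (C u) (x u) :: ennreal)"
        using fP by (auto simp: space_PiM PiE_iff indicator_def intro!: prod_zero[symmetric])
      then show "(\<Prod>u\<in>P. ennreal (?d u (x u))) * indicator (Pi\<^sub>E P C) x =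
        (\<Prod>u\<in>P. ennreal (?d u (x u)) * indicator (C u) (x u))" by (simp add: prod.distrib)
    qed
    also have "\<dots> = (\<Prod>u\<in>P. \<integral>\<^sup>+y. ennreal (?d u y) * indicator (C u) y \<partial>\<nu>)"
      using fP C by (intro \<nu>P.product_nn_integral_prod) auto
    also have "\<dots> = (\<Prod>u\<in>P. emeasure (?D u) (C u))"
      using C by (intro prod.cong refl emeasure_density[symmetric]) (auto simp: sets_\<nu>)
    finally show "emeasure ?M2 (Pi\<^sub>E P C) = (\<Prod>u\<in>P. emeasure (?D u) (C u))" .
  qed (simp add: sD sB)
  ultimately have "emeasure ?M1 A = emeasure ?M2 A" by simp
  moreover have "{X \<in> space ?S. family_tree q r (\<lambda>u. snd (X u)) = P \<and> ?w X \<in> A} = {X \<in> ?Ev. ?w X \<in> A}"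
    by (auto simp: family_tree_eq_iff[OF P])
  moreover have "emeasure ?M2 A = (\<integral>\<^sup>+x. (\<Prod>u\<in>P. ennreal (?d u (x u))) * indicator A x \<partial>weights P)"
    using A fP by (intro emeasure_density) (auto simp: sB)
  ultimately show ?thesis using em1[OF A] by (simp add: prod_ennreal particle_density_nonneg)
qed


text \<open>The weights and numbers of children of all names, whether or not they occur in the tree.\<close>

abbreviation "bp_marks \<equiv> PiM (UNIV :: particle set) (\<lambda>_. particle_space q)"

abbreviation "bp_space \<equiv> count_space (UNIV :: nat set) \<Otimes>\<^sub>M bp_marks"

abbreviation "bp \<equiv> branching_process q a b W \<nu>"

text \<open>The particles of generations \<open>0, \<dots>, r\<close>.\<close>

definition bp_family_tree :: "nat \<Rightarrow> bp_outcome \<Rightarrow> particle set" where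
  "bp_family_tree r \<omega> = family_tree q r (\<lambda>u. snd (snd \<omega> u))"

lemma bp_tree_eq': "bp_tree q r \<omega> = tree_graph (fst \<omega>) (bp_family_tree r \<omega>) (\<lambda>u. fst (snd \<omega> u))"
  by (cases \<omega>) (simp only: bp_tree_eq bp_family_tree_def fst_conv snd_conv)

lemma bp_eq: "bp = spin_law q \<bind> (\<lambda>s. PiM UNIV (bp_particle s) \<bind> (\<lambda>X. return bp_space (s, X)))"
  unfolding branching_process_def bp_particle_def \<Phi>_def by (rule refl)

lemma bp_particles_prob_algebra:
  "PiM UNIV (bp_particle s) \<in> space (prob_algebra bp_marks)"
  unfolding space_prob_algebra
  by (auto intro!: prob_space_PiM sets_PiM_cong simp: bp_particle_props)

lemma bp_kernel:
  "(\<lambda>s. PiM UNIV (bp_particle s) \<bind> (\<lambda>X. return bp_space (s, X))) \<in> spin_law q \<rightarrow>\<^sub>M prob_algebra bp_space"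
proof -
  have [measurable]: "(\<lambda>s. PiM UNIV (bp_particle s)) \<in> count_space UNIV \<rightarrow>\<^sub>M prob_algebra bp_marks"
    using bp_particles_prob_algebra by simp
  note [measurable] = measurable_return_prob_space
  have "(\<lambda>s. PiM UNIV (bp_particle s) \<bind> (\<lambda>X. return bp_space (s, X))) \<in> count_space UNIV \<rightarrow>\<^sub>M prob_algebra bp_space"
    by (rule measurable_bind_prob_space2[where N = "bp_marks"]) measurable
  moreover have sl: "sets (spin_law q) = sets (count_space UNIV)" by (simp add: spin_law_def)
  ultimately show ?thesis by (subst measurable_cong_sets[OF sl refl])
qed

lemma nn_integral_spin_law:
  "(\<integral>\<^sup>+t. g t \<partial>spin_law q) = (\<Sum>t\<in>{1..q}. g t) / ennreal (real q)"
  unfolding spin_law_def using q_pos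
  by (subst nn_integral_pmf_of_set) (auto simp: ennreal_of_nat_eq_real_of_nat)

lemma spin_law_prob_algebra: "spin_law q \<in> space (prob_algebra (spin_law q))"
  by (simp add: space_prob_algebra spin_law_def prob_space_measure_pmf)

lemma bp_props: "sets bp = sets bp_space" "space bp = space bp_space" "prob_space bp"
proof -
  have "(\<lambda>_. bp) \<in> count_space (UNIV :: unit set) \<rightarrow>\<^sub>M prob_algebra bp_space"
    unfolding bp_eq
    by (rule measurable_bind_prob_space[OF measurable_const[OF spin_law_prob_algebra] bp_kernel])
  from measurable_space[OF this, of "()"] have "bp \<in> space (prob_algebra bp_space)" by simp
  then show "sets bp = sets bp_space" "prob_space bp" by (auto simp: space_prob_algebra)
  then show "space bp = space bp_space" by (metis sets_eq_imp_space_eq)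
qed

lemma emeasure_bp:
  assumes E: "E \<in> sets bp_space"
  shows "emeasure bp E =
    (\<Sum>s\<in>{1..q}. emeasure (PiM UNIV (bp_particle s)) {X \<in> space bp_marks. (s, X) \<in> E}) / real q"
proof -
  let ?\<Pi> = "\<lambda>s. PiM UNIV (bp_particle s)" and ?E = "\<lambda>s. {X \<in> space bp_marks. (s, X) \<in> E}"
  have "emeasure bp E = (\<integral>\<^sup>+s. emeasure (?\<Pi> s \<bind> (\<lambda>X. return bp_space (s, X))) E \<partial>spin_law q)"
    unfolding bp_eq by (rule emeasure_bind_prob_algebra[OF spin_law_prob_algebra bp_kernel E])
  also have "\<dots> = (\<integral>\<^sup>+s. emeasure (?\<Pi> s) (?E s) \<partial>spin_law q)"
  proof (rule nn_integral_cong)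
    fix s :: nat
    note [measurable] = measurable_return_prob_space
    have r: "(\<lambda>X. return bp_space (s, X)) \<in> bp_marks \<rightarrow>\<^sub>M prob_algebra bp_space" by measurable
    have sp: "space (?\<Pi> s) = space bp_marks" and st: "sets (?\<Pi> s) = sets bp_marks"
      using bp_particles_prob_algebra[of s] by (auto simp: space_prob_algebra dest: sets_eq_imp_space_eq)
    have m: "?E s \<in> sets bp_marks" using E by measurable
    have "emeasure (?\<Pi> s \<bind> (\<lambda>X. return bp_space (s, X))) E = (\<integral>\<^sup>+X. emeasure (return bp_space (s, X)) E \<partial>?\<Pi> s)"
      by (rule emeasure_bind_prob_algebra[OF bp_particles_prob_algebra r E])
    also have "\<dots> = (\<integral>\<^sup>+X. indicator (?E s) X \<partial>?\<Pi> s)"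
      using E by (intro nn_integral_cong) (auto simp: sp indicator_def)
    also have "\<dots> = emeasure (?\<Pi> s) (?E s)"
      by (rule nn_integral_indicator) (simp only: m st)
    finally show "emeasure (?\<Pi> s \<bind> (\<lambda>X. return bp_space (s, X))) E = emeasure (?\<Pi> s) (?E s)" .
  qed
  also have "\<dots> = (\<Sum>s\<in>{1..q}. emeasure (?\<Pi> s) (?E s)) / real q"
    by (rule nn_integral_spin_law)
  finally show ?thesis .
qed

lemma measurable_bp_coords [measurable]:
  "(\<lambda>\<omega>. snd \<omega> u) \<in> bp_space \<rightarrow>\<^sub>M particle_space q"
  "fst \<in> particle_space q \<rightarrow>\<^sub>M borel"
  "snd \<in> particle_space q \<rightarrow>\<^sub>M PiM {1..q} (\<lambda>_. count_space UNIV)"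
proof -
  show "(\<lambda>\<omega>. snd \<omega> u) \<in> bp_space \<rightarrow>\<^sub>M particle_space q"
    by (rule measurable_compose[OF measurable_snd measurable_component_singleton]) simp
qed (simp_all add: particle_space_def)

lemma bp_family_tree_shape: "tree_shape q r (bp_family_tree r \<omega>)"
  by (auto simp: tree_shape_def bp_family_tree_def)

lemma bp_family_tree_sets:
  assumes P: "tree_shape q r P"
  shows "{\<omega> \<in> space bp_space. bp_family_tree r \<omega> = P} \<in> sets bp_space"
proof -
  have fI: "finite (inner_particles r P)" using tree_shapeD(1)[OF P] by (rule finite_inner_particles)
  show ?thesis
    unfolding bp_family_tree_def family_tree_eq_iff[OF P] using fI by measurable
qed

text \<open>The discrete part of the tree: the spin of the root, and the names, which contain the other
  spins.\<close>

abbreviation bp_shape :: "nat \<Rightarrow> bp_outcome \<Rightarrow> nat \<times> particle set" where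
  "bp_shape r \<omega> \<equiv> (fst \<omega>, bp_family_tree r \<omega>)"

lemma measurable_bp_family_tree:
  "bp_shape r \<in> bp_space \<rightarrow>\<^sub>M count_space (UNIV \<times> {P. tree_shape q r P})"
proof (subst measurable_count_space_eq_countable)
  show "countable ((UNIV :: nat set) \<times> {P. tree_shape q r P})"
    using countable_tree_shapes by auto
  show "bp_shape r \<in> space bp_space \<rightarrow> UNIV \<times> {P. tree_shape q r P} \<and>
    (\<forall>k\<in>UNIV \<times> {P. tree_shape q r P}. bp_shape r -` {k} \<inter> space bp_space \<in> sets bp_space)"
  proof (intro conjI ballI)
    fix k assume "k \<in> (UNIV :: nat set) \<times> {P. tree_shape q r P}"
    then obtain s P where k: "k = (s, P)" "tree_shape q r P" by auto
    have "bp_shape r -` {k} \<inter> space bp_space =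
      {\<omega> \<in> space bp_space. bp_family_tree r \<omega> = P} \<inter> {\<omega> \<in> space bp_space. fst \<omega> = s}"
      by (auto simp: k)
    also have "\<dots> \<in> sets bp_space"
      by (rule sets.Int[OF bp_family_tree_sets[OF k(2)]]) measurable
    finally show "bp_shape r -` {k} \<inter> space bp_space \<in> sets bp_space" .
  qed (simp add: bp_family_tree_shape)
qed

lemma measurable_iso_class_bp_tree:
  "(\<lambda>\<omega>. iso_class (bp_tree q r \<omega>)) \<in> bp_space \<rightarrow>\<^sub>M iso_space"
proof -
  let ?f = "\<lambda>k \<omega>. iso_class (tree_graph (fst k) (snd k) (\<lambda>u\<in>snd k. fst (snd \<omega> u :: real \<times> (nat \<Rightarrow> nat))))"
  have "(\<lambda>\<omega>. ?f (bp_shape r \<omega>) \<omega>) \<in> bp_space \<rightarrow>\<^sub>M iso_space"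
  proof (rule measurable_compose_countable'[OF _ measurable_bp_family_tree])
    fix k assume "k \<in> (UNIV :: nat set) \<times> {P. tree_shape q r P}"
    then have P: "tree_shape q r (snd k)" by auto
    have w: "(\<lambda>\<omega>. \<lambda>u\<in>snd k. fst (snd \<omega> u)) \<in> bp_space \<rightarrow>\<^sub>M PiM (snd k) (\<lambda>_. borel)"
      by measurable
    show "?f k \<in> bp_space \<rightarrow>\<^sub>M iso_space"
      by (rule measurable_compose[OF w measurable_iso_class_tree_graph[OF P]])
  qed (use countable_tree_shapes in auto)
  moreover have "iso_class (bp_tree q r \<omega>) = ?f (bp_shape r \<omega>) \<omega>" for \<omega>
    unfolding bp_tree_eq' fst_conv snd_conv
    by (rule iso_class_tree_graph_cong) (auto simp: tree_shapeD(2)[OF bp_family_tree_shape])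
  ultimately show ?thesis by simp
qed

lemma bp_shape_event_sets:
  assumes L: "L \<subseteq> UNIV \<times> {P. tree_shape q r P}" and S: "S \<in> sets iso_space"
  shows "{\<omega> \<in> space bp. bp_shape r \<omega> \<in> L} \<in> sets bp"
    and "{\<omega> \<in> space bp. iso_class (bp_tree q r \<omega>) \<in> S} \<in> sets bp"
    and "{\<omega> \<in> space bp. bp_shape r \<omega> \<in> L \<and> iso_class (bp_tree q r \<omega>) \<in> S} \<in> sets bp"
proof -
  have "{\<omega> \<in> space bp. bp_shape r \<omega> \<in> L} = bp_shape r -` L \<inter> space bp_space"
    "{\<omega> \<in> space bp. iso_class (bp_tree q r \<omega>) \<in> S} = (\<lambda>\<omega>. iso_class (bp_tree q r \<omega>)) -` S \<inter> space bp_space"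
    by (auto simp: bp_props)
  then show 1: "{\<omega> \<in> space bp. bp_shape r \<omega> \<in> L} \<in> sets bp"
    "{\<omega> \<in> space bp. iso_class (bp_tree q r \<omega>) \<in> S} \<in> sets bp"
    using measurable_sets[OF measurable_bp_family_tree, of L r] L
      measurable_sets[OF measurable_iso_class_bp_tree S] by (simp_all only: bp_props sets_count_space Pow_iff)
  have "{\<omega> \<in> space bp. bp_shape r \<omega> \<in> L \<and> iso_class (bp_tree q r \<omega>) \<in> S} =
    {\<omega> \<in> space bp. bp_shape r \<omega> \<in> L} \<inter> {\<omega> \<in> space bp. iso_class (bp_tree q r \<omega>) \<in> S}" by auto
  then show "{\<omega> \<in> space bp. bp_shape r \<omega> \<in> L \<and> iso_class (bp_tree q r \<omega>) \<in> S} \<in> sets bp"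
    using 1 by simp
qed

text \<open>The joint density, with respect to \<open>\<nu>\<close>, of the weights of the particles on the event that
  the root has spin \<open>s\<close> and the first \<open>r\<close> generations form \<open>P\<close>.\<close>

definition tree_density :: "nat \<Rightarrow> nat \<Rightarrow> particle set \<Rightarrow> (particle \<Rightarrow> real) \<Rightarrow> real" where
  "tree_density r s P x = (\<Prod>u\<in>P. particle_density r s P u (x u)) / real q"

lemma tree_density_nonneg: "tree_density r s P x \<ge> 0"
  by (auto simp: tree_density_def particle_density_nonneg intro!: divide_nonneg_nonneg prod_nonneg)

text \<open>The mass that a density \<open>g\<close> of the weights on the tree \<open>P\<close> gives to a set \<open>S\<close> of classes.\<close>

abbreviation class_integral ::
    "nat \<Rightarrow> particle set \<Rightarrow> nat mgraph set set \<Rightarrow> ((particle \<Rightarrow> real) \<Rightarrow> real) \<Rightarrow> ennreal" where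
  "class_integral s P S g \<equiv> (\<integral>\<^sup>+x. ennreal (g x) * indicator S (iso_class (tree_graph s P x)) \<partial>weights P)"

lemma emeasure_bp_tree_shape:
  assumes P: "tree_shape q r P" and s: "s \<in> {1..q}" and S: "S \<in> sets iso_space"
  shows "emeasure bp {\<omega> \<in> space bp. bp_shape r \<omega> = (s, P) \<and> iso_class (bp_tree q r \<omega>) \<in> S} =
    class_integral s P S (tree_density r s P)"
proof -
  let ?E = "{\<omega> \<in> space bp. bp_shape r \<omega> = (s, P) \<and> iso_class (bp_tree q r \<omega>) \<in> S}"
  let ?A = "(\<lambda>x. iso_class (tree_graph s P x)) -` S \<inter> space (PiM P (\<lambda>_. borel))"
  let ?B = "{X \<in> space bp_marks. family_tree q r (\<lambda>u. snd (X u)) = P \<and> (\<lambda>u\<in>P. fst (X u)) \<in> ?A}"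
  let ?d = "\<lambda>x. \<Prod>u\<in>P. particle_density r s P u (x u)"
  have A: "?A \<in> sets (PiM P (\<lambda>_. borel))"
    by (rule measurable_sets[OF measurable_iso_class_tree_graph[OF P] S])
  have E: "?E \<in> sets bp_space"
    using bp_shape_event_sets(3)[of "{(s, P)}" r S] P S by (simp add: bp_props)
  have sec: "{X \<in> space bp_marks. (t, X) \<in> ?E} = (if t = s then ?B else {})" for t
  proof -
    have "iso_class (bp_tree q r (s, X)) = iso_class (tree_graph s P (\<lambda>u\<in>P. fst (X u)))"
      if "family_tree q r (\<lambda>u. snd (X u)) = P" for X
      unfolding bp_tree_eq that
      by (rule iso_class_tree_graph_cong) (use tree_shapeD(2)[OF P] in auto)
    then show ?thesis
      by (auto simp: bp_props space_pair_measure bp_family_tree_def space_PiM)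
  qed
  have "emeasure bp ?E = (\<Sum>t\<in>{1..q}. if t = s then emeasure (PiM UNIV (bp_particle s)) ?B else 0) / real q"
    unfolding emeasure_bp[OF E] sec by (intro arg_cong2[where f = "(/)"] sum.cong) auto
  also have "\<dots> = emeasure (PiM UNIV (bp_particle s)) ?B / real q"
    using s by (simp add: sum.delta)
  also have "\<dots> = (\<integral>\<^sup>+x. ennreal (?d x) * indicator ?A x \<partial>weights P) / real q"
    by (subst emeasure_bp_tree[OF P A]) (rule refl)
  also have "\<dots> = class_integral s P S (tree_density r s P)"
  proof (subst nn_integral_divide[symmetric])
    have [measurable]: "?A \<in> sets (weights P)"
      using A by (simp add: sets_\<nu> cong: sets_PiM_cong)
    show "(\<lambda>x. ennreal (?d x) * indicator ?A x) \<in> borel_measurable (weights P)"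
      by measurable
    show "(\<integral>\<^sup>+x. ennreal (?d x) * indicator ?A x / real q \<partial>weights P) = class_integral s P S (tree_density r s P)"
    proof (rule nn_integral_cong)
      fix x assume "x \<in> space (weights P)"
      then have "indicator ?A x = (indicator S (iso_class (tree_graph s P x)) :: ennreal)"
        by (auto simp: indicator_def space_PiM space_\<nu>)
      moreover have "ennreal (tree_density r s P x) = ennreal (?d x) / real q"
        unfolding tree_density_def using q_pos
        by (subst divide_ennreal[symmetric]) (auto intro!: prod_nonneg particle_density_nonneg)
      ultimately show "ennreal (?d x) * indicator ?A x / real q =
        ennreal (tree_density r s P x) * indicator S (iso_class (tree_graph s P x))"
        by (simp add: indicator_def)
    qed
  qed
  finally show ?thesis .
qed

lemma measurable_tree_density [measurable]:
  "tree_density r s P \<in> borel_measurable (weights P)"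
  unfolding tree_density_def[abs_def] by measurable

text \<open>There are only countably many shapes, so up to small probability the tree has one of
  finitely many.\<close>

lemma bp_tree_tight:
  assumes "\<epsilon> > 0"
  shows "\<exists>K. finite K \<and> K \<subseteq> {1..q} \<times> {P. tree_shape q r P} \<and>
    measure bp {\<omega> \<in> space bp. bp_shape r \<omega> \<in> K} > 1 - \<epsilon>"
proof -
  interpret bp: prob_space bp by (rule bp_props)
  let ?U = "{1..q} \<times> {P. tree_shape q r P}"
  have U: "countable ?U" using countable_tree_shapes by auto
  have "(1, family_tree q r (\<lambda>_ _. 0)) \<in> ?U" using q_pos by (auto simp: tree_shape_def)
  then have Une: "?U \<noteq> {}" by blast
  define K where "K n = from_nat_into ?U ` {..n}" for n
  have KU: "K n \<subseteq> ?U" for n using from_nat_into[OF Une] unfolding K_def by blast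
  then have KU': "K n \<subseteq> UNIV \<times> {P. tree_shape q r P}" for n by blast
  have "(\<lambda>n. measure bp {\<omega> \<in> space bp. bp_shape r \<omega> \<in> K n}) \<longlonglongrightarrow> measure bp (\<Union>n. {\<omega> \<in> space bp. bp_shape r \<omega> \<in> K n})"
    using bp_shape_event_sets(1)[OF KU' sets.top]
    by (intro bp.finite_Lim_measure_incseq) (auto simp: incseq_def K_def)
  moreover have "measure bp (\<Union>n. {\<omega> \<in> space bp. bp_shape r \<omega> \<in> K n}) = 1"
  proof -
    have "(\<Union>n. {..n :: nat}) = UNIV" by auto
    then have "(\<Union>n. K n) = ?U" using range_from_nat_into[OF Une U] unfolding K_def by (metis image_UN)
    then have "(\<Union>n. {\<omega> \<in> space bp. bp_shape r \<omega> \<in> K n}) = {\<omega> \<in> space bp. bp_shape r \<omega> \<in> ?U}" by blast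
    also have "\<dots> = {\<omega> \<in> space bp. fst \<omega> \<in> {1..q}}" using bp_family_tree_shape by auto
    finally have eq: "(\<Union>n. {\<omega> \<in> space bp. bp_shape r \<omega> \<in> K n}) = {\<omega> \<in> space bp. fst \<omega> \<in> {1..q}}" .
    have E: "{\<omega> \<in> space bp. fst \<omega> \<in> {1..q}} \<in> sets bp_space"
      using measurable_sets[OF measurable_fst, of "{1..q}" "count_space UNIV" "bp_marks"]
      by (simp add: bp_props vimage_def Int_def conj_commute)
    have sec: "{X \<in> space bp_marks. (s, X) \<in> {\<omega> \<in> space bp. fst \<omega> \<in> {1..q}}}
       = space (PiM UNIV (bp_particle s))" if "s \<in> {1..q}" for s
      using bp_particles_prob_algebra[of s] that
      by (auto simp: bp_props space_pair_measure space_prob_algebra dest!: sets_eq_imp_space_eq)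
    have one: "emeasure (PiM UNIV (bp_particle s)) (space (PiM UNIV (bp_particle s))) = 1" for s
      using bp_particles_prob_algebra[of s] by (auto simp: space_prob_algebra prob_space.emeasure_space_1)
    have "emeasure bp {\<omega> \<in> space bp. fst \<omega> \<in> {1..q}} = (\<Sum>s\<in>{1..q}. 1 :: ennreal) / ennreal (real q)"
      unfolding emeasure_bp[OF E] using sec one by (intro arg_cong2[where f = "(/)"] sum.cong) auto
    also have "\<dots> = 1" using q_pos by (simp add: ennreal_of_nat_eq_real_of_nat ennreal_divide_self)
    finally show ?thesis unfolding eq by (simp add: measure_def)
  qed
  ultimately have "\<forall>\<^sub>F n in sequentially. measure bp {\<omega> \<in> space bp. bp_shape r \<omega> \<in> K n} > 1 - \<epsilon>"
    using assms by (intro order_tendstoD) auto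
  then obtain n where "measure bp {\<omega> \<in> space bp. bp_shape r \<omega> \<in> K n} > 1 - \<epsilon>"
    by (auto simp: eventually_sequentially)
  then show ?thesis using KU by (intro exI[of _ "K n"]) (auto simp: K_def)
qed

end

section \<open>The law of the random graph\<close>

abbreviation edge_space :: "nat \<Rightarrow> (nat \<times> nat \<Rightarrow> bool) measure" where
  "edge_space n \<equiv> PiM (vertex_pairs n) (\<lambda>_. count_space UNIV)"

abbreviation spin_space :: "nat \<Rightarrow> (nat \<Rightarrow> nat) measure" where
  "spin_space n \<equiv> PiM {1..n} (\<lambda>_. count_space UNIV)"

abbreviation weight_space :: "nat \<Rightarrow> (nat \<Rightarrow> real) measure" where
  "weight_space n \<equiv> PiM {1..n} (\<lambda>_. borel)"

lemma finite_vertex_pairs: "finite (vertex_pairs n)"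
  by (rule finite_subset[of _ "{1..n} \<times> {1..n}"]) (auto simp: vertex_pairs_def)

lemma finite_rooted_dcsbm_graph:
  assumes "\<rho> \<in> {1..n}"
  shows "finite_rooted_graph (dcsbm_graph n (\<sigma>, \<phi>, \<eta>, \<rho>))"
  using assms by (auto simp: finite_rooted_graph_def vertex_pairs_def sym_def irrefl_def)

lemma dcsbm_space_graph:
  assumes "\<omega> \<in> space (dcsbm_space n)"
  shows "finite_rooted_graph (dcsbm_graph n \<omega>)" "gverts (dcsbm_graph n \<omega>) = {1..n}"
proof -
  obtain \<sigma> \<phi> \<eta> \<rho> where \<omega>: "\<omega> = (\<sigma>, \<phi>, \<eta>, \<rho>)" by (metis surj_pair)
  then have "\<rho> \<in> {1..n}" using assms by (auto simp: dcsbm_space_def space_pair_measure)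
  then show "finite_rooted_graph (dcsbm_graph n \<omega>)" "gverts (dcsbm_graph n \<omega>) = {1..n}"
    unfolding \<omega> using finite_rooted_dcsbm_graph by auto
qed

lemma finite_rooted_root_ball:
  assumes g: "finite_rooted_graph g"
  shows "finite_rooted_graph (root_ball r g)"
proof -
  have "gdist g (groot g) (groot g) \<le> enat r" unfolding gdist_le_iff by (intro exI[of _ 0]) auto
  then show ?thesis using g
    by (auto simp: finite_rooted_graph_def root_ball_def induced_def sym_def irrefl_def)
qed

text \<open>Spins, edges and the picked vertex take countably many values, and only the weights are
  continuous; measurability is checked for each value of the discrete part.\<close>

lemma measurable_discrete_part:
  "(\<lambda>\<omega>. (fst \<omega>, snd (snd \<omega>))) \<in> dcsbm_space n \<rightarrow>\<^sub>M
     count_space (({1..n} \<rightarrow>\<^sub>E UNIV) \<times> (vertex_pairs n \<rightarrow>\<^sub>E UNIV) \<times> {1..n})"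
  and countable_discrete_part:
  "countable (({1..n} \<rightarrow>\<^sub>E (UNIV :: nat set)) \<times> (vertex_pairs n \<rightarrow>\<^sub>E (UNIV :: bool set)) \<times> {1..n})"
proof -
  have c: "countable ({1..n} \<rightarrow>\<^sub>E (UNIV :: nat set))" "countable (vertex_pairs n \<rightarrow>\<^sub>E (UNIV :: bool set))"
    using finite_vertex_pairs by (auto intro!: countable_PiE)
  then show "countable (({1..n} \<rightarrow>\<^sub>E (UNIV :: nat set)) \<times> (vertex_pairs n \<rightarrow>\<^sub>E (UNIV :: bool set)) \<times> {1..n})"
    by (intro countable_SIGMA) auto
  have "count_space (({1..n} \<rightarrow>\<^sub>E UNIV) \<times> (vertex_pairs n \<rightarrow>\<^sub>E UNIV) \<times> {1..n}) =
    spin_space n \<Otimes>\<^sub>M edge_space n \<Otimes>\<^sub>M count_space {1..n}"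
    using c finite_vertex_pairs
    by (simp add: count_space_PiM_finite pair_measure_countable countable_SIGMA)
  then show "(\<lambda>\<omega>. (fst \<omega>, snd (snd \<omega>))) \<in> dcsbm_space n \<rightarrow>\<^sub>M
     count_space (({1..n} \<rightarrow>\<^sub>E UNIV) \<times> (vertex_pairs n \<rightarrow>\<^sub>E UNIV) \<times> {1..n})"
    by (simp add: dcsbm_space_def)
qed

lemma root_ball_weights:
  "root_ball r (dcsbm_graph n (\<sigma>, \<phi>, \<eta>, \<rho>)) =
    (let h = root_ball r (dcsbm_graph n (\<sigma>, (\<lambda>_. 0), \<eta>, \<rho>)) in
     \<lparr>gverts = gverts h, gedges = gedges h, groot = \<rho>, gspin = \<sigma>, gweight = \<phi>\<rparr>)"
  by (simp add: root_ball_def induced_def gdist_def Let_def)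

lemma measurable_root_ball_class:
  "(\<lambda>\<omega>. iso_class (root_ball r (dcsbm_graph n \<omega>))) \<in> dcsbm_space n \<rightarrow>\<^sub>M iso_space"
proof -
  let ?h = "\<lambda>k. root_ball r (dcsbm_graph n (fst k, (\<lambda>_. 0), fst (snd k), snd (snd k)))"
  let ?f = "\<lambda>k (\<omega> :: dcsbm_outcome). iso_class \<lparr>gverts = gverts (?h k), gedges = gedges (?h k), groot = snd (snd k),
    gspin = fst k, gweight = restrict (fst (snd \<omega>)) (gverts (?h k))\<rparr>"
  let ?I = "({1..n} \<rightarrow>\<^sub>E (UNIV :: nat set)) \<times> (vertex_pairs n \<rightarrow>\<^sub>E (UNIV :: bool set)) \<times> {1..n}"
  have "(\<lambda>\<omega>. ?f (fst \<omega>, snd (snd \<omega>)) \<omega>) \<in> dcsbm_space n \<rightarrow>\<^sub>M iso_space"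
  proof (rule measurable_compose_countable'[OF _ measurable_discrete_part countable_discrete_part])
    fix k assume k: "k \<in> ?I"
    have fr: "finite_rooted_graph (?h k)"
      using k by (intro finite_rooted_root_ball finite_rooted_dcsbm_graph) auto
    have "groot (?h k) = snd (snd k)" by (cases k) (simp add: root_ball_def induced_def)
    with fr have fr': "finite_rooted_graph \<lparr>gverts = gverts (?h k), gedges = gedges (?h k), groot = snd (snd k),
       gspin = fst k, gweight = x\<rparr>" for x
      by (simp add: finite_rooted_graph_def)
    have sub: "gverts (?h k) \<subseteq> {1..n}" by (cases k) (auto simp: root_ball_def induced_def)
    have "(\<lambda>\<phi>. restrict \<phi> (gverts (?h k))) \<in> weight_space n \<rightarrow>\<^sub>M PiM (gverts (?h k)) (\<lambda>_. borel)"
      by (rule measurable_restrict_subset[OF sub])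
    moreover have "(\<lambda>\<omega>. fst (snd \<omega>)) \<in> dcsbm_space n \<rightarrow>\<^sub>M weight_space n"
      unfolding dcsbm_space_def by measurable
    ultimately have w: "(\<lambda>\<omega>. restrict (fst (snd \<omega>)) (gverts (?h k))) \<in> dcsbm_space n \<rightarrow>\<^sub>M PiM (gverts (?h k)) (\<lambda>_. borel)"
      by (rule measurable_compose[rotated])
    show "?f k \<in> dcsbm_space n \<rightarrow>\<^sub>M iso_space"
      by (rule measurable_compose[OF w measurable_iso_class[OF fr']])
  qed
  moreover have "iso_class (root_ball r (dcsbm_graph n \<omega>)) = ?f (fst \<omega>, snd (snd \<omega>)) \<omega>"
    if "\<omega> \<in> space (dcsbm_space n)" for \<omega>
  proof -
    obtain \<sigma> \<phi> \<eta> \<rho> where \<omega>: "\<omega> = (\<sigma>, \<phi>, \<eta>, \<rho>)" by (metis surj_pair)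
    then have "\<rho> \<in> {1..n}" using that by (auto simp: dcsbm_space_def space_pair_measure)
    from finite_rooted_root_ball[OF finite_rooted_dcsbm_graph[OF this, of \<sigma> "\<lambda>_. 0" \<eta>], of r]
    have "\<rho> \<in> gverts (root_ball r (dcsbm_graph n (\<sigma>, (\<lambda>_. 0), \<eta>, \<rho>)))"
      by (simp add: finite_rooted_graph_def root_ball_def induced_def)
    then show ?thesis unfolding \<omega> root_ball_weights[of r n \<sigma> \<phi>] Let_def fst_conv snd_conv
      by (intro iso_class_weight_cong) auto
  qed
  ultimately show ?thesis by (simp cong: measurable_cong)
qed

lemma measurable_root_ball_card:
  "(\<lambda>\<omega>. card (gverts (root_ball r (dcsbm_graph n \<omega>)))) \<in> dcsbm_space n \<rightarrow>\<^sub>M count_space UNIV"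
proof -
  let ?f = "\<lambda>k. card (gverts (root_ball r (dcsbm_graph n (fst k, (\<lambda>_. 0), fst (snd k), snd (snd k)))))"
  have "(\<lambda>\<omega>. ?f (fst \<omega>, snd (snd \<omega>))) \<in> dcsbm_space n \<rightarrow>\<^sub>M count_space UNIV"
    by (rule measurable_compose[OF measurable_discrete_part]) simp
  moreover have "card (gverts (root_ball r (dcsbm_graph n \<omega>))) = ?f (fst \<omega>, snd (snd \<omega>))" for \<omega>
  proof -
    obtain \<sigma> \<phi> \<eta> \<rho> where \<omega>: "\<omega> = (\<sigma>, \<phi>, \<eta>, \<rho>)" by (metis surj_pair)
    show ?thesis unfolding \<omega> by (subst root_ball_weights) (simp add: Let_def)
  qed
  ultimately show ?thesis by simp
qed

context dcsbm_model
begin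

text \<open>The law of the edge indicators, given spins and weights.\<close>

definition edge_law :: "nat \<Rightarrow> (nat \<Rightarrow> nat) \<Rightarrow> (nat \<Rightarrow> real) \<Rightarrow> (nat \<times> nat \<Rightarrow> bool) measure" where
  "edge_law n \<sigma> \<phi> = PiM (vertex_pairs n) (\<lambda>e. measure_pmf (bernoulli_pmf (edge_prob a b n \<sigma> \<phi> e)))"

text \<open>The law of the outcome, given spins and weights.\<close>

definition observed :: "nat \<Rightarrow> (nat \<Rightarrow> nat) \<Rightarrow> (nat \<Rightarrow> real) \<Rightarrow> dcsbm_outcome measure" where
  "observed n \<sigma> \<phi> = edge_law n \<sigma> \<phi> \<bind> (\<lambda>\<eta>. uniform_count_measure {1..n} \<bind>
     (\<lambda>\<rho>. return (dcsbm_space n) (\<sigma>, \<phi>, \<eta>, \<rho>)))"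

lemma dcsbm_eq: "dcsbm q a b \<nu> n =
  PiM {1..n} (\<lambda>_. spin_law q) \<bind> (\<lambda>\<sigma>. weights {1..n} \<bind> (\<lambda>\<phi>. observed n \<sigma> \<phi>))"
  unfolding dcsbm_def observed_def edge_law_def by (rule refl)

lemma measurable_edge_law [measurable]:
  "(\<lambda>(\<sigma>, \<phi>). edge_law n \<sigma> \<phi>) \<in> spin_space n \<Otimes>\<^sub>M weight_space n \<rightarrow>\<^sub>M prob_algebra (edge_space n)"
  unfolding edge_law_def split_beta
proof (intro measurable_PiM_kernel measurable_bernoulli_kernel)
  fix e assume "e \<in> vertex_pairs n"
  then obtain v w where e: "e = (v, w)" "v \<in> {1..n}" "w \<in> {1..n}" by (auto simp: vertex_pairs_def)
  have \<sigma>: "(\<lambda>x. fst x u) \<in> spin_space n \<Otimes>\<^sub>M weight_space n \<rightarrow>\<^sub>M count_space UNIV"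
    and \<phi>: "(\<lambda>x. snd x u) \<in> borel_measurable (spin_space n \<Otimes>\<^sub>M weight_space n)" if "u \<in> {1..n}" for u
    using measurable_compose[OF measurable_fst measurable_component_singleton[OF that]]
      measurable_compose[OF measurable_snd measurable_component_singleton[OF that]] by auto
  have "(\<lambda>x. affinity a b (fst x v) (fst x w)) \<in> borel_measurable (spin_space n \<Otimes>\<^sub>M weight_space n)"
    by (rule measurable_compose_countable[OF measurable_compose_countable[OF _ \<sigma>[OF e(2)]] \<sigma>[OF e(3)]]) simp
  then show "(\<lambda>x. edge_prob a b n (fst x) (snd x) e) \<in> borel_measurable (spin_space n \<Otimes>\<^sub>M weight_space n)"
    unfolding e edge_prob_def prod.case
    by (intro borel_measurable_min borel_measurable_times borel_measurable_divide \<phi>[OF e(2)] \<phi>[OF e(3)]) simp_all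
qed

lemma uniform_prob_algebra:
  assumes "(n :: nat) \<ge> 1"
  shows "uniform_count_measure {1..n} \<in> space (prob_algebra (count_space {1..n}))"
  using assms prob_space_uniform_count_measure[of "{1..n}"]
  by (simp add: space_prob_algebra sets_uniform_count_measure)

lemma measurable_uniform_kernel:
  assumes n: "n \<ge> 1"
  shows "(\<lambda>\<omega>. uniform_count_measure {1..n} \<bind> (\<lambda>\<rho>. return (dcsbm_space n) (fst (fst \<omega>), snd (fst \<omega>), snd \<omega>, \<rho>)))
    \<in> (spin_space n \<Otimes>\<^sub>M weight_space n) \<Otimes>\<^sub>M edge_space n \<rightarrow>\<^sub>M prob_algebra (dcsbm_space n)"
proof (rule measurable_bind_prob_space2[OF measurable_const[OF uniform_prob_algebra[OF n]]])
  note [measurable] = measurable_return_prob_space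
  have "(\<lambda>x. (fst (fst (fst x)), snd (fst (fst x)), snd (fst x), snd x)) \<in>
    ((spin_space n \<Otimes>\<^sub>M weight_space n) \<Otimes>\<^sub>M edge_space n) \<Otimes>\<^sub>M count_space {1..n} \<rightarrow>\<^sub>M dcsbm_space n"
    unfolding dcsbm_space_def by measurable
  from measurable_compose[OF this measurable_return_prob_space]
  show "(\<lambda>(\<omega>, \<rho>). return (dcsbm_space n) (fst (fst \<omega>), snd (fst \<omega>), snd \<omega>, \<rho>)) \<in>
    ((spin_space n \<Otimes>\<^sub>M weight_space n) \<Otimes>\<^sub>M edge_space n) \<Otimes>\<^sub>M count_space {1..n} \<rightarrow>\<^sub>M prob_algebra (dcsbm_space n)"
    by (simp add: split_beta)
qed

lemma measurable_observed:
  assumes n: "n \<ge> 1"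
  shows "(\<lambda>(\<sigma>, \<phi>). observed n \<sigma> \<phi>) \<in> spin_space n \<Otimes>\<^sub>M weight_space n \<rightarrow>\<^sub>M prob_algebra (dcsbm_space n)"
  unfolding observed_def split_beta
  using measurable_edge_law[of n] measurable_uniform_kernel[OF n]
  by (intro measurable_bind_prob_space2[where N = "edge_space n"]) (simp_all add: split_beta)

lemma spins_prob_algebra: "PiM {1..n} (\<lambda>_. spin_law q) \<in> space (prob_algebra (spin_space n))"
  unfolding space_prob_algebra
  by (auto intro!: prob_space_PiM sets_PiM_cong simp: spin_law_def prob_space_measure_pmf)

lemma weights_prob_algebra: "weights {1..n} \<in> space (prob_algebra (weight_space n))"
  unfolding space_prob_algebra
  by (auto intro!: prob_space_PiM sets_PiM_cong simp: prob_space_axioms sets_\<nu>)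

lemma measurable_observed_weights:
  assumes n: "n \<ge> 1"
  shows "(\<lambda>\<sigma>. weights {1..n} \<bind> (\<lambda>\<phi>. observed n \<sigma> \<phi>)) \<in> spin_space n \<rightarrow>\<^sub>M prob_algebra (dcsbm_space n)"
  by (rule measurable_bind_prob_space2[OF measurable_const[OF weights_prob_algebra] measurable_observed[OF n]])

lemma dcsbm_props:
  assumes n: "n \<ge> 1"
  shows "sets (dcsbm q a b \<nu> n) = sets (dcsbm_space n)"
    "space (dcsbm q a b \<nu> n) = space (dcsbm_space n)" "prob_space (dcsbm q a b \<nu> n)"
proof -
  have "(\<lambda>_. dcsbm q a b \<nu> n) \<in> count_space (UNIV :: unit set) \<rightarrow>\<^sub>M prob_algebra (dcsbm_space n)"
    unfolding dcsbm_eq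
    by (rule measurable_bind_prob_space[OF measurable_const[OF spins_prob_algebra] measurable_observed_weights[OF n]])
  from measurable_space[OF this, of "()"] have "dcsbm q a b \<nu> n \<in> space (prob_algebra (dcsbm_space n))" by simp
  then show "sets (dcsbm q a b \<nu> n) = sets (dcsbm_space n)" "prob_space (dcsbm q a b \<nu> n)"
    by (auto simp: space_prob_algebra)
  then show "space (dcsbm q a b \<nu> n) = space (dcsbm_space n)" by (metis sets_eq_imp_space_eq)
qed

lemma emeasure_dcsbm:
  assumes n: "n \<ge> 1" and E: "E \<in> sets (dcsbm_space n)"
  shows "emeasure (dcsbm q a b \<nu> n) E =
    (\<integral>\<^sup>+\<sigma>. \<integral>\<^sup>+\<phi>. emeasure (observed n \<sigma> \<phi>) E \<partial>weights {1..n} \<partial>PiM {1..n} (\<lambda>_. spin_law q))"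
proof -
  have "emeasure (dcsbm q a b \<nu> n) E =
    (\<integral>\<^sup>+\<sigma>. emeasure (weights {1..n} \<bind> (\<lambda>\<phi>. observed n \<sigma> \<phi>)) E \<partial>PiM {1..n} (\<lambda>_. spin_law q))"
    unfolding dcsbm_eq
    by (rule emeasure_bind_prob_algebra[OF spins_prob_algebra measurable_observed_weights[OF n] E])
  also have "\<dots> = (\<integral>\<^sup>+\<sigma>. \<integral>\<^sup>+\<phi>. emeasure (observed n \<sigma> \<phi>) E \<partial>weights {1..n} \<partial>PiM {1..n} (\<lambda>_. spin_law q))"
  proof (rule nn_integral_cong)
    fix \<sigma> assume "\<sigma> \<in> space (PiM {1..n} (\<lambda>_. spin_law q))"
    then have "\<sigma> \<in> space (spin_space n)" by (simp add: space_PiM spin_law_def)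
    from measurable_compose[OF measurable_Pair1'[OF this] measurable_observed[OF n]]
    have "(\<lambda>\<phi>. observed n \<sigma> \<phi>) \<in> weight_space n \<rightarrow>\<^sub>M prob_algebra (dcsbm_space n)" by simp
    from emeasure_bind_prob_algebra[OF weights_prob_algebra this E]
    show "emeasure (weights {1..n} \<bind> (\<lambda>\<phi>. observed n \<sigma> \<phi>)) E =
      (\<integral>\<^sup>+\<phi>. emeasure (observed n \<sigma> \<phi>) E \<partial>weights {1..n})" .
  qed
  finally show ?thesis .
qed

text \<open>An event that contains all outcomes with a given picked vertex and with edge indicators in a
  given box.\<close>

lemma emeasure_observed_ge:
  assumes n: "n \<ge> 1" and E: "E \<in> sets (dcsbm_space n)" and \<sigma>: "\<sigma> \<in> space (spin_space n)"
    and \<phi>: "\<phi> \<in> space (weight_space n)" and \<rho>: "\<rho> \<in> {1..n}"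
    and D: "\<And>\<eta>. \<eta> \<in> space (edge_space n) \<Longrightarrow> (\<And>e. e \<in> vertex_pairs n \<Longrightarrow> \<eta> e \<in> D e) \<Longrightarrow> (\<sigma>, \<phi>, \<eta>, \<rho>) \<in> E"
  shows "emeasure (observed n \<sigma> \<phi>) E \<ge>
    ennreal ((\<Prod>e\<in>vertex_pairs n. measure (bernoulli_pmf (edge_prob a b n \<sigma> \<phi> e)) (D e)) / real n)"
proof -
  have s: "(\<sigma>, \<phi>) \<in> space (spin_space n \<Otimes>\<^sub>M weight_space n)" using \<sigma> \<phi> by (simp add: space_pair_measure)
  have el: "edge_law n \<sigma> \<phi> \<in> space (prob_algebra (edge_space n))"
    using measurable_space[OF measurable_edge_law s] by simp
  then have sel: "sets (edge_law n \<sigma> \<phi>) = sets (edge_space n)" "space (edge_law n \<sigma> \<phi>) = space (edge_space n)"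
    by (auto simp: space_prob_algebra dest: sets_eq_imp_space_eq)
  let ?U = "\<lambda>\<eta>. uniform_count_measure {1..n} \<bind> (\<lambda>\<rho>. return (dcsbm_space n) (\<sigma>, \<phi>, \<eta>, \<rho>))"
  let ?b = "\<lambda>e. bernoulli_pmf (edge_prob a b n \<sigma> \<phi> e)"
  let ?D = "Pi\<^sub>E (vertex_pairs n) D"
  have D_sets: "?D \<in> sets (edge_space n)" using finite_vertex_pairs by (intro sets_PiM_I_finite) auto
  from measurable_compose[OF measurable_Pair1'[OF s] measurable_uniform_kernel[OF n]]
  have k: "?U \<in> edge_space n \<rightarrow>\<^sub>M prob_algebra (dcsbm_space n)" by simp
  have u: "emeasure (?U \<eta>) E \<ge> ennreal (1 / real n) * indicator ?D \<eta>" if \<eta>: "\<eta> \<in> space (edge_space n)" for \<eta>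
  proof (cases "\<eta> \<in> ?D")
    case True
    have in_space: "(\<sigma>, \<phi>, \<eta>, \<rho>') \<in> space (dcsbm_space n)" if "\<rho>' \<in> {1..n}" for \<rho>'
      using \<sigma> \<phi> \<eta> that by (simp add: dcsbm_space_def space_pair_measure)
    have "(\<lambda>\<rho>. (\<sigma>, \<phi>, \<eta>, \<rho>)) \<in> count_space {1..n} \<rightarrow>\<^sub>M dcsbm_space n"
      using in_space by simp
    from measurable_compose[OF this measurable_return_prob_space]
    have m: "(\<lambda>\<rho>. return (dcsbm_space n) (\<sigma>, \<phi>, \<eta>, \<rho>)) \<in> count_space {1..n} \<rightarrow>\<^sub>M prob_algebra (dcsbm_space n)" .
    have "ennreal (1 / real n) = emeasure (uniform_count_measure {1..n}) {\<rho>}"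
      using \<rho> by (subst emeasure_uniform_count_measure) auto
    also have "\<dots> = (\<integral>\<^sup>+\<rho>'. indicator {\<rho>} \<rho>' \<partial>uniform_count_measure {1..n})"
      using \<rho> by (intro nn_integral_indicator[symmetric]) (auto simp: sets_uniform_count_measure)
    also have "\<dots> \<le> (\<integral>\<^sup>+\<rho>'. emeasure (return (dcsbm_space n) (\<sigma>, \<phi>, \<eta>, \<rho>')) E \<partial>uniform_count_measure {1..n})"
      using E D[OF \<eta>] True in_space
      by (intro nn_integral_mono) (auto simp: indicator_def space_uniform_count_measure)
    also have "\<dots> = emeasure (?U \<eta>) E"
      by (rule emeasure_bind_prob_algebra[OF uniform_prob_algebra[OF n] m E, symmetric])
    finally show ?thesis using True by simp
  qed simp
  interpret pmf: product_sigma_finite "\<lambda>e. measure_pmf (?b e)"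
    unfolding product_sigma_finite_def by (intro allI prob_space_imp_sigma_finite prob_space_measure_pmf)
  have "ennreal ((\<Prod>e\<in>vertex_pairs n. measure (?b e) (D e)) / real n) =
    ennreal (1 / real n) * (\<Prod>e\<in>vertex_pairs n. emeasure (?b e) (D e))"
    by (simp add: measure_pmf.emeasure_eq_measure prod_ennreal ennreal_mult'[symmetric])
  also have "\<dots> = ennreal (1 / real n) * emeasure (edge_law n \<sigma> \<phi>) ?D"
    unfolding edge_law_def using finite_vertex_pairs by (subst pmf.emeasure_PiM) auto
  also have "\<dots> = (\<integral>\<^sup>+\<eta>. ennreal (1 / real n) * indicator ?D \<eta> \<partial>edge_law n \<sigma> \<phi>)"
    using D_sets by (intro nn_integral_cmult_indicator[symmetric]) (simp add: sel)
  also have "\<dots> \<le> (\<integral>\<^sup>+\<eta>. emeasure (?U \<eta>) E \<partial>edge_law n \<sigma> \<phi>)"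
    using u by (intro nn_integral_mono) (simp add: sel)
  also have "\<dots> = emeasure (observed n \<sigma> \<phi>) E"
    unfolding observed_def by (rule emeasure_bind_prob_algebra[OF el k E, symmetric])
  finally show ?thesis .
qed

end

section \<open>The probability of an embedding\<close>

lemma prod_antimono_unit:
  fixes F :: "'a \<Rightarrow> real"
  assumes "finite B" "A \<subseteq> B" "\<And>x. x \<in> B \<Longrightarrow> 0 \<le> F x \<and> F x \<le> 1"
  shows "prod F B \<le> prod F A"
proof -
  have "prod F B = prod F (B - A) * prod F A" using assms by (intro prod.subset_diff) auto
  also have "\<dots> \<le> 1 * prod F A"
    using assms by (intro mult_right_mono prod_le_1 prod_nonneg) auto
  finally show ?thesis by simp
qed

lemma prod_le_prod_image:
  fixes F :: "'b \<Rightarrow> real"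
  assumes "finite I" "\<And>x. 0 \<le> F x \<and> F x \<le> 1"
  shows "(\<Prod>i\<in>I. F (g i)) \<le> prod F (g ` I)"
proof -
  obtain J where J: "J \<subseteq> I" "inj_on g J" "g ` I = g ` J"
    using subset_image_inj[of "g ` I" g I] by auto
  have "(\<Prod>i\<in>I. F (g i)) \<le> (\<Prod>i\<in>J. F (g i))" using assms J(1) by (intro prod_antimono_unit) auto
  also have "\<dots> = prod F (g ` J)" using J(2) by (simp add: prod.reindex)
  finally show ?thesis using J(3) by simp
qed

lemma prod3_unit:
  fixes x y z :: real
  assumes "0 \<le> x" "x \<le> 1" "0 \<le> y" "y \<le> 1" "0 \<le> z" "z \<le> 1"
  shows "x * y * z \<le> x" "x * y * z \<le> y" "x * y * z \<le> z" "x * y * z \<le> 1"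
proof -
  have "x * y \<le> x" "x * y \<le> y" "0 \<le> x * y"
    using assms by (auto intro: mult_left_le mult_left_le_one_le)
  moreover have "x * y * z \<le> x * y" "x * y * z \<le> z"
    using assms calculation by (auto intro: mult_left_le mult_left_le_one_le)
  ultimately show "x * y * z \<le> x" "x * y * z \<le> y" "x * y * z \<le> z" "x * y * z \<le> 1"
    using assms by linarith+
qed

lemma tree_adjacent_sym: "tree_adjacent u v \<longleftrightarrow> tree_adjacent v u"
  by (auto simp: tree_adjacent_def)

lemma tree_adjacent_irrefl: "\<not> tree_adjacent u u"
  by (auto simp: tree_adjacent_def)

text \<open>The values that the edge indicators may take when \<open>f\<close> embeds \<open>P\<close> as the ball.\<close>

definition embedding_edges :: "nat \<Rightarrow> particle set \<Rightarrow> (particle \<Rightarrow> nat) \<Rightarrow> nat \<times> nat \<Rightarrow> bool set" where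
  "embedding_edges r P f = (\<lambda>(v, w).
     if v \<in> f ` P \<and> w \<in> f ` P then {tree_adjacent (inv_into P f v) (inv_into P f w)}
     else if v \<in> f ` inner_particles r P \<or> w \<in> f ` inner_particles r P then {False}
     else UNIV)"

lemma ball_embedding_of_edges:
  assumes f: "f \<in> P \<rightarrow> {1..n}" "inj_on f P" and s: "\<And>u. u \<in> P \<Longrightarrow> \<sigma> (f u) = particle_spin s u"
    and \<eta>: "\<And>e. e \<in> vertex_pairs n \<Longrightarrow> \<eta> e \<in> embedding_edges r P f e"
  shows "ball_embedding r s P f (dcsbm_graph n (\<sigma>, \<phi>, \<eta>, f []))"
  unfolding ball_embedding_def
proof (intro conjI ballI)
  let ?g = "dcsbm_graph n (\<sigma>, \<phi>, \<eta>, f [])"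
  have e: "(v, w) \<in> gedges ?g \<longleftrightarrow> (v < w \<and> \<eta> (v, w)) \<or> (w < v \<and> \<eta> (w, v))"
    if "v \<in> {1..n}" "w \<in> {1..n}" for v w
    using that by (auto simp: vertex_pairs_def)
  have vp: "(v, w) \<in> vertex_pairs n" if "v \<in> {1..n}" "w \<in> {1..n}" "v < w" for v w
    using that by (auto simp: vertex_pairs_def)
  have fin: "f u \<in> {1..n}" if "u \<in> P" for u using f(1) that by auto
  fix u v assume u: "u \<in> P" and v: "v \<in> P"
  consider "u = v" | "f u < f v" | "f v < f u" using f(2) u v by (metis inj_onD linorder_neqE_nat)
  then show "(f u, f v) \<in> gedges ?g \<longleftrightarrow> tree_adjacent u v"
  proof cases
    case 1
    then show ?thesis by (simp add: tree_adjacent_irrefl vertex_pairs_def)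
  next
    case 2
    then have "\<eta> (f u, f v) \<longleftrightarrow> tree_adjacent u v"
      using \<eta>[OF vp[OF fin[OF u] fin[OF v]]] u v f(2) by (auto simp: embedding_edges_def)
    then show ?thesis using 2 e[OF fin[OF u] fin[OF v]] by auto
  next
    case 3
    then have "\<eta> (f v, f u) \<longleftrightarrow> tree_adjacent u v"
      using \<eta>[OF vp[OF fin[OF v] fin[OF u]]] u v f(2) by (auto simp: embedding_edges_def tree_adjacent_sym)
    then show ?thesis using 3 e[OF fin[OF u] fin[OF v]] by auto
  qed
next
  let ?g = "dcsbm_graph n (\<sigma>, \<phi>, \<eta>, f [])"
  fix u w assume u: "u \<in> inner_particles r P" and w: "w \<in> gverts ?g - f ` P"
  have uP: "u \<in> P" using u by (simp add: inner_particles_def)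
  have *: "\<eta> e \<longleftrightarrow> False" if "e \<in> vertex_pairs n" "e = (f u, w) \<or> e = (w, f u)" for e
    using \<eta>[OF that(1)] that(2) u w by (auto simp: embedding_edges_def)
  show "(f u, w) \<notin> gedges ?g"
  proof
    assume "(f u, w) \<in> gedges ?g"
    then have "((f u, w) \<in> vertex_pairs n \<and> \<eta> (f u, w)) \<or> ((w, f u) \<in> vertex_pairs n \<and> \<eta> (w, f u))" by simp
    then show False using * by blast
  qed
qed (use assms in \<open>auto\<close>)

context dcsbm_model
begin

text \<open>The edge probability, as a function of the spins and weights of the end points. It is cut off
  at \<open>0\<close> as well, so that negative weights, which have probability zero, need no special
  treatment.\<close>

definition edge_weight :: "nat \<Rightarrow> nat \<Rightarrow> nat \<Rightarrow> real \<Rightarrow> real \<Rightarrow> real" where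
  "edge_weight n s t x y = min 1 (max 0 (x * y / real n * affinity a b s t))"

lemma edge_weight_unit: "0 \<le> edge_weight n s t x y \<and> edge_weight n s t x y \<le> 1"
  by (simp add: edge_weight_def)

lemma edge_weight_sym: "edge_weight n s t x y = edge_weight n t s y x"
  by (simp add: edge_weight_def affinity_def mult.commute)

lemma measure_edge_law:
  shows "measure (bernoulli_pmf (edge_prob a b n \<sigma> \<phi> (v, w))) {True} = edge_weight n (\<sigma> v) (\<sigma> w) (\<phi> v) (\<phi> w)"
    and "measure (bernoulli_pmf (edge_prob a b n \<sigma> \<phi> (v, w))) {False} = 1 - edge_weight n (\<sigma> v) (\<sigma> w) (\<phi> v) (\<phi> w)"
    and "measure (bernoulli_pmf (edge_prob a b n \<sigma> \<phi> (v, w))) UNIV = 1"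
proof -
  have "min 1 (max 0 (edge_prob a b n \<sigma> \<phi> (v, w))) = edge_weight n (\<sigma> v) (\<sigma> w) (\<phi> v) (\<phi> w)"
    by (simp add: edge_prob_def edge_weight_def)
  then show "measure (bernoulli_pmf (edge_prob a b n \<sigma> \<phi> (v, w))) {True} = edge_weight n (\<sigma> v) (\<sigma> w) (\<phi> v) (\<phi> w)"
    "measure (bernoulli_pmf (edge_prob a b n \<sigma> \<phi> (v, w))) {False} = 1 - edge_weight n (\<sigma> v) (\<sigma> w) (\<phi> v) (\<phi> w)"
    by (simp_all add: measure_pmf_single pmf_bernoulli_clamp)
  show "measure (bernoulli_pmf (edge_prob a b n \<sigma> \<phi> (v, w))) UNIV = 1"
    using measure_pmf.prob_space by simp
qed

text \<open>A lower bound for the probability that the edges among the vertices of the ball are those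
  of the tree \<open>P\<close>. The second product runs over all ordered pairs, tree edges included, and not
  only over the non-edges; this is simpler, and harmless because the product tends to \<open>1\<close>.\<close>

definition inside_prob :: "nat \<Rightarrow> nat \<Rightarrow> particle set \<Rightarrow> (particle \<Rightarrow> real) \<Rightarrow> real" where
  "inside_prob n s P x =
     (\<Prod>v\<in>P - {[]}. edge_weight n (particle_spin s (butlast v)) (particle_spin s v) (x (butlast v)) (x v)) *
     (\<Prod>(u, v)\<in>P \<times> P. 1 - edge_weight n (particle_spin s u) (particle_spin s v) (x u) (x v))"

text \<open>The probability that a vertex of spin \<open>t\<close> and weight \<open>y\<close> is not joined to any inner particle.\<close>

definition outside_prob :: "nat \<Rightarrow> nat \<Rightarrow> nat \<Rightarrow> particle set \<Rightarrow> (particle \<Rightarrow> real) \<Rightarrow> nat \<Rightarrow> real \<Rightarrow> real" where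
  "outside_prob r n s P x t y = (\<Prod>u\<in>inner_particles r P. 1 - edge_weight n (particle_spin s u) t (x u) y)"

lemma inside_prob_nonneg: "inside_prob n s P x \<ge> 0"
  unfolding inside_prob_def using edge_weight_unit
  by (intro mult_nonneg_nonneg prod_nonneg) auto

lemma outside_prob_nonneg: "outside_prob r n s P x t y \<ge> 0"
  unfolding outside_prob_def using edge_weight_unit by (intro prod_nonneg) auto

lemma embedding_edges_prob_ge:
  assumes P: "tree_shape q r P" and f: "f \<in> P \<rightarrow> {1..n}" "inj_on f P"
    and s: "\<And>u. u \<in> P \<Longrightarrow> \<sigma> (f u) = particle_spin s u"
  shows "(\<Prod>e\<in>vertex_pairs n. measure (bernoulli_pmf (edge_prob a b n \<sigma> \<phi> e)) (embedding_edges r P f e)) \<ge>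
    inside_prob n s P (\<lambda>u. \<phi> (f u)) *
    (\<Prod>w\<in>{1..n} - f ` P. outside_prob r n s P (\<lambda>u. \<phi> (f u)) (\<sigma> w) (\<phi> w))"
proof -
  define c where "c = (\<lambda>(v, w). edge_weight n (\<sigma> v) (\<sigma> w) (\<phi> v) (\<phi> w))"
  define ord where "ord = (\<lambda>(v :: nat, w). (min v w, max v w))"
  have co: "c (ord (v, w)) = edge_weight n (\<sigma> v) (\<sigma> w) (\<phi> v) (\<phi> w)" for v w
    by (cases "v \<le> w") (auto simp: c_def ord_def min_def max_def edge_weight_sym)
  have cu: "0 \<le> c e \<and> c e \<le> 1" for e using edge_weight_unit by (cases e) (simp add: c_def)
  have fP: "finite P" using tree_shapeD[OF P] by simp
  have inP: "inner_particles r P \<subseteq> P" by (auto simp: inner_particles_def)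
  note fI = finite_inner_particles[OF fP, of r]
  \<comment> \<open>Tree edges, pairs inside the ball, and pairs of an inner particle and an outside vertex.
    As all factors are at most \<open>1\<close>, the sets may overlap and the maps need not be injective.\<close>
  define E1 where "E1 = (\<lambda>v. ord (f (butlast v), f v)) ` (P - {[]})"
  define E2 where "E2 = (\<lambda>(u, v). ord (f u, f v)) ` (P \<times> P)"
  define E3 where "E3 = (\<lambda>(w, u). ord (f u, w)) ` (({1..n} - f ` P) \<times> inner_particles r P)"
  let ?A1 = "\<Prod>v\<in>P - {[]}. edge_weight n (particle_spin s (butlast v)) (particle_spin s v) (\<phi> (f (butlast v))) (\<phi> (f v))"
  let ?A2 = "\<Prod>(u, v)\<in>P \<times> P. 1 - edge_weight n (particle_spin s u) (particle_spin s v) (\<phi> (f u)) (\<phi> (f v))"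
  let ?A3 = "\<Prod>w\<in>{1..n} - f ` P. outside_prob r n s P (\<lambda>u. \<phi> (f u)) (\<sigma> w) (\<phi> w)"
  let ?F1 = "\<lambda>e. if e \<in> E1 then c e else 1"
  let ?F2 = "\<lambda>e. if e \<in> E2 then 1 - c e else 1"
  let ?F3 = "\<lambda>e. if e \<in> E3 then 1 - c e else 1"
  let ?m = "\<lambda>e. measure (bernoulli_pmf (edge_prob a b n \<sigma> \<phi> e)) (embedding_edges r P f e)"
  have m: "?F1 e * ?F2 e * ?F3 e \<le> ?m e" if e: "e \<in> vertex_pairs n" for e
  proof -
    obtain v w where vw: "e = (v, w)" "v < w" "v \<in> {1..n}" "w \<in> {1..n}"
      using e by (auto simp: vertex_pairs_def)
    have ordvw: "ord (v, w) = (v, w)" "ord (w, v) = (v, w)" using vw(2) by (auto simp: ord_def)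
    have u: "0 \<le> ?F1 e" "?F1 e \<le> 1" "0 \<le> ?F2 e" "?F2 e \<le> 1" "0 \<le> ?F3 e" "?F3 e \<le> 1" using cu by auto
    have le: "?F1 e * ?F2 e * ?F3 e \<le> ?F1 e" "?F1 e * ?F2 e * ?F3 e \<le> ?F2 e" "?F1 e * ?F2 e * ?F3 e \<le> ?F3 e"
      "?F1 e * ?F2 e * ?F3 e \<le> 1"
      using prod3_unit[OF u] by auto
    show ?thesis
    proof (cases "v \<in> f ` P \<and> w \<in> f ` P")
      case True
      then obtain x y where xy: "x \<in> P" "y \<in> P" "v = f x" "w = f y" by auto
      have me: "embedding_edges r P f e = {tree_adjacent x y}"
        using xy f(2) by (simp add: embedding_edges_def vw(1))
      show ?thesis
      proof (cases "tree_adjacent x y")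
        case True
        have "e \<in> E1"
        proof (cases "\<exists>z. y = x @ [z]")
          case True
          then show ?thesis using xy vw ordvw by (auto simp: E1_def intro!: image_eqI[of _ _ y])
        next
          case False
          then have "\<exists>z. x = y @ [z]" using \<open>tree_adjacent x y\<close> by (simp add: tree_adjacent_def)
          then show ?thesis using xy vw ordvw by (auto simp: E1_def intro!: image_eqI[of _ _ x])
        qed
        then have "?F1 e = c e" by simp
        moreover have "?m e = c e" unfolding me using True measure_edge_law(1) by (simp add: vw(1) c_def)
        ultimately show ?thesis using le(1) by simp
      next
        case False
        have "e \<in> E2" using xy vw ordvw by (auto simp: E2_def intro!: image_eqI[of _ _ "(x, y)"])
        then have "?F2 e = 1 - c e" by simp
        moreover have "?m e = 1 - c e" unfolding me using False measure_edge_law(2) by (simp add: vw(1) c_def)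
        ultimately show ?thesis using le(2) by simp
      qed
    next
      case notP: False
      show ?thesis
      proof (cases "v \<in> f ` inner_particles r P \<or> w \<in> f ` inner_particles r P")
        case True
        have "e \<in> E3"
        proof (cases "v \<in> f ` inner_particles r P")
          case True
          then obtain x where "x \<in> inner_particles r P" "v = f x" by auto
          then show ?thesis using notP inP vw ordvw by (auto simp: E3_def intro!: image_eqI[of _ _ "(w, x)"])
        next
          case False
          with True obtain x where "x \<in> inner_particles r P" "w = f x" by auto
          then show ?thesis using notP inP vw ordvw by (auto simp: E3_def intro!: image_eqI[of _ _ "(v, x)"])
        qed
        then have "?F3 e = 1 - c e" by simp
        moreover have me: "embedding_edges r P f e = {False}"
          using notP True by (auto simp add: embedding_edges_def vw(1))
        have "?m e = 1 - c e" unfolding me using measure_edge_law(2) by (simp add: vw(1) c_def)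
        ultimately show ?thesis using le(3) by simp
      next
        case False
        then have me: "embedding_edges r P f e = UNIV" using notP by (auto simp: embedding_edges_def vw(1))
        have "?m e = 1" unfolding me using measure_edge_law(3) by (simp add: vw(1))
        then show ?thesis using le(4) by simp
      qed
    qed
  qed
  note fvp = finite_vertex_pairs[of n]
  have restr: "(\<Prod>e\<in>vertex_pairs n. if e \<in> E then F e else 1) \<ge> (\<Prod>i\<in>I. F (h i))"
    if "finite I" "E = h ` I" "\<And>e. 0 \<le> F e \<and> F e \<le> 1" for E and I :: "'i set" and F :: "nat \<times> nat \<Rightarrow> real" and h
  proof -
    have "(\<Prod>i\<in>I. F (h i)) \<le> prod F E" unfolding that(2) using that by (intro prod_le_prod_image) auto
    also have "\<dots> \<le> prod F (vertex_pairs n \<inter> E)" using that by (intro prod_antimono_unit) auto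
    also have "\<dots> = (\<Prod>e\<in>vertex_pairs n. if e \<in> E then F e else 1)"
      using fvp by (rule prod.inter_restrict)
    finally show ?thesis .
  qed
  have c1: "0 \<le> 1 - c e \<and> 1 - c e \<le> 1" for e using cu[of e] by simp
  have sb: "particle_spin s (butlast v) = \<sigma> (f (butlast v))" if "v \<in> P - {[]}" for v
    using s[of "butlast v"] tree_shape_butlast[OF P, of v] that inP by auto
  have 1: "?A1
      \<le> (\<Prod>e\<in>vertex_pairs n. ?F1 e)"
  proof -
    have "?A1
      = (\<Prod>v\<in>P - {[]}. c (ord (f (butlast v), f v)))"
      using sb s by (intro prod.cong refl) (simp add: co)
    also have "\<dots> \<le> (\<Prod>e\<in>vertex_pairs n. ?F1 e)" using fP cu by (intro restr) (auto simp: E1_def)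
    finally show ?thesis .
  qed
  have 2: "?A2
      \<le> (\<Prod>e\<in>vertex_pairs n. ?F2 e)"
  proof -
    have "?A2
      = (\<Prod>i\<in>P \<times> P. 1 - c ((\<lambda>(u, v). ord (f u, f v)) i))"
      using s by (intro prod.cong refl) (auto simp: co)
    also have "\<dots> \<le> (\<Prod>e\<in>vertex_pairs n. ?F2 e)" using fP c1 by (intro restr) (auto simp: E2_def)
    finally show ?thesis .
  qed
  have 3: "?A3
      \<le> (\<Prod>e\<in>vertex_pairs n. ?F3 e)"
  proof -
    have "?A3 =
      (\<Prod>(w, u)\<in>({1..n} - f ` P) \<times> inner_particles r P.
         1 - edge_weight n (particle_spin s u) (\<sigma> w) (\<phi> (f u)) (\<phi> w))"
      unfolding outside_prob_def by (rule prod.cartesian_product)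
    also have "\<dots> = (\<Prod>i\<in>({1..n} - f ` P) \<times> inner_particles r P. 1 - c ((\<lambda>(w, u). ord (f u, w)) i))"
      using s inP by (intro prod.cong refl) (auto simp: co)
    also have "\<dots> \<le> (\<Prod>e\<in>vertex_pairs n. ?F3 e)" using fI c1 by (intro restr) (auto simp: E3_def)
    finally show ?thesis .
  qed
  have "inside_prob n s P (\<lambda>u. \<phi> (f u)) * ?A3
    \<le> (\<Prod>e\<in>vertex_pairs n. ?F1 e) * (\<Prod>e\<in>vertex_pairs n. ?F2 e) * (\<Prod>e\<in>vertex_pairs n. ?F3 e)"
    unfolding inside_prob_def using 1 2 3 cu c1 edge_weight_unit outside_prob_nonneg
    by (intro mult_mono mult_nonneg_nonneg prod_nonneg) auto
  also have "\<dots> = (\<Prod>e\<in>vertex_pairs n. ?F1 e * ?F2 e * ?F3 e)" by (simp only: prod.distrib)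
  also have "\<dots> \<le> (\<Prod>e\<in>vertex_pairs n. ?m e)"
    using m cu c1 by (intro prod_mono conjI mult_nonneg_nonneg) auto
  finally show ?thesis .
qed

text \<open>The limit of the expected number of edges from the inner particles to the outside, given positive
  weights \<open>x\<close> in the ball.\<close>

definition escape_rate :: "nat \<Rightarrow> nat \<Rightarrow> particle set \<Rightarrow> (particle \<Rightarrow> real) \<Rightarrow> real" where
  "escape_rate r s P x = (\<Sum>u\<in>inner_particles r P.
     \<bar>x u\<bar> * ((\<Sum>t\<in>{1..q}. affinity a b (particle_spin s u) t) / real q) * \<Phi>)"

text \<open>A lower bound for the density of the weights on the event that a given injection embeds \<open>P\<close>
  as the ball of radius \<open>r\<close>: the root is picked with probability \<open>1 / n\<close>, the spins are right with
  probability \<open>q\<close> to the power \<open>- card P\<close>, and the last factor is at most the probability that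
  the other \<open>n - card P\<close> vertices are not joined to any inner particle.\<close>

definition embedding_density :: "nat \<Rightarrow> nat \<Rightarrow> nat \<Rightarrow> particle set \<Rightarrow> (particle \<Rightarrow> real) \<Rightarrow> real" where
  "embedding_density r n s P x = inside_prob n s P x / (real n * real q ^ card P) *
     max 0 (1 - escape_rate r s P x / real n) ^ (n - card P)"

lemma embedding_density_nonneg: "embedding_density r n s P x \<ge> 0"
  unfolding embedding_density_def using inside_prob_nonneg
  by (intro mult_nonneg_nonneg divide_nonneg_nonneg zero_le_power) auto

lemma AE_abs_weight: "AE y in \<nu>. \<bar>y\<bar> = y"
  using weight_ge \<phi>\<^sub>0_pos by (auto elim!: eventually_mono)

lemma integral_abs_weight: "integrable \<nu> (\<lambda>y. \<bar>y\<bar>)" "(\<integral>y. \<bar>y\<bar> \<partial>\<nu>) = \<Phi>"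
proof -
  show "integrable \<nu> (\<lambda>y. \<bar>y\<bar>)" using integrable_weight by (rule integrable_abs)
  show "(\<integral>y. \<bar>y\<bar> \<partial>\<nu>) = \<Phi>" unfolding \<Phi>_eq
    using AE_abs_weight by (intro integral_cong_AE) auto
qed

lemma measurable_outside_prob: "(\<lambda>y. outside_prob r n s P x t y) \<in> borel_measurable \<nu>"
  unfolding outside_prob_def edge_weight_def by measurable

text \<open>The probability that a vertex outside the ball has no neighbour among the inner particles.\<close>

lemma outside_prob_mean_ge:
  assumes n: "n \<ge> 1"
  shows "ennreal (max 0 (1 - escape_rate r s P x / real n)) \<le>
    (\<integral>\<^sup>+y. ennreal ((\<Sum>t\<in>{1..q}. outside_prob r n s P x t y) / real q) \<partial>\<nu>)"
proof -
  let ?z = "\<lambda>y t. \<Sum>u\<in>inner_particles r P. \<bar>x u\<bar> * \<bar>y\<bar> / real n * affinity a b (particle_spin s u) t"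
  let ?o = "\<lambda>y. (\<Sum>t\<in>{1..q}. outside_prob r n s P x t y) / real q"
  define C where "C = (\<Sum>u\<in>inner_particles r P. \<bar>x u\<bar> * ((\<Sum>t\<in>{1..q}. affinity a b (particle_spin s u) t) / real q))"
  have esc: "escape_rate r s P x = C * \<Phi>" by (simp add: escape_rate_def C_def sum_distrib_right)
  have lower: "1 - C * \<bar>y\<bar> / real n \<le> ?o y" for y
  proof -
    have le: "edge_weight n t t' x' y \<le> \<bar>x'\<bar> * \<bar>y\<bar> / real n * affinity a b t t'" for t t' x'
    proof -
      have "edge_weight n t t' x' y \<le> \<bar>x' * y / real n * affinity a b t t'\<bar>"
        unfolding edge_weight_def by linarith
      then show ?thesis using affinity_pos[of t t'] by (simp add: abs_mult)
    qed
    have t: "1 - ?z y t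
      \<le> outside_prob r n s P x t y" for t
    proof -
      have "1 - (\<Sum>u\<in>inner_particles r P. edge_weight n (particle_spin s u) t (x u) y) \<le> outside_prob r n s P x t y"
        unfolding outside_prob_def using edge_weight_unit by (intro Weierstrass_prod_ineq) auto
      moreover have "(\<Sum>u\<in>inner_particles r P. edge_weight n (particle_spin s u) t (x u) y) \<le>
        ?z y t"
        using le by (intro sum_mono) auto
      ultimately show ?thesis by linarith
    qed
    have "(\<Sum>t\<in>{1..q}. 1 - ?z y t) / real q
       \<le> ?o y"
      using t by (intro divide_right_mono sum_mono) auto
    moreover have "(\<Sum>t\<in>{1..q}. 1 - ?z y t) / real q
      = 1 - C * \<bar>y\<bar> / real n"
    proof -
      have "(\<Sum>t\<in>{1..q}. \<Sum>u\<in>inner_particles r P. \<bar>x u\<bar> * \<bar>y\<bar> / real n * affinity a b (particle_spin s u) t) =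
        (\<Sum>u\<in>inner_particles r P. \<bar>x u\<bar> * \<bar>y\<bar> / real n * (\<Sum>t\<in>{1..q}. affinity a b (particle_spin s u) t))"
        by (subst sum.swap) (simp add: sum_distrib_left)
      also have "\<dots> = real q * (C * \<bar>y\<bar> / real n)"
        using q_pos by (simp add: C_def sum_distrib_left sum_distrib_right sum_divide_distrib mult.assoc mult.commute mult.left_commute)
      finally show ?thesis using q_pos by (simp add: sum_subtractf diff_divide_distrib)
    qed
    ultimately show ?thesis by simp
  qed
  have int: "integrable \<nu> (\<lambda>y. 1 - C * \<bar>y\<bar> / real n)" using integral_abs_weight(1) by simp
  have "1 - escape_rate r s P x / real n = (\<integral>y. 1 - C * \<bar>y\<bar> / real n \<partial>\<nu>)"
    using integral_abs_weight by (simp add: esc prob_space)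
  also have "\<dots> \<le> (\<integral>y. max 0 (1 - C * \<bar>y\<bar> / real n) \<partial>\<nu>)"
    using int by (intro integral_mono) auto
  finally have "max 0 (1 - escape_rate r s P x / real n) \<le> (\<integral>y. max 0 (1 - C * \<bar>y\<bar> / real n) \<partial>\<nu>)"
    by (simp add: integral_nonneg)
  then have "ennreal (max 0 (1 - escape_rate r s P x / real n)) \<le> ennreal (\<integral>y. max 0 (1 - C * \<bar>y\<bar> / real n) \<partial>\<nu>)"
    by (rule ennreal_leI)
  also have "\<dots> = (\<integral>\<^sup>+y. ennreal (max 0 (1 - C * \<bar>y\<bar> / real n)) \<partial>\<nu>)"
    using int by (intro nn_integral_eq_integral[symmetric]) auto
  also have "\<dots> \<le> (\<integral>\<^sup>+y. ennreal (?o y) \<partial>\<nu>)"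
    using lower outside_prob_nonneg
    by (intro nn_integral_mono ennreal_leI) (auto intro!: divide_nonneg_nonneg sum_nonneg)
  finally show ?thesis .
qed

lemma inside_prob_cong:
  assumes "tree_shape q r P" "\<And>u. u \<in> P \<Longrightarrow> x u = y u"
  shows "inside_prob n s P x = inside_prob n s P y"
proof -
  have "butlast v \<in> P" if "v \<in> P - {[]}" for v
    using tree_shape_butlast(1)[OF assms(1), of v] that by (auto simp: inner_particles_def)
  then show ?thesis unfolding inside_prob_def
    by (intro arg_cong2[where f = "(*)"] prod.cong) (auto simp: assms(2))
qed

lemma outside_prob_cong:
  assumes "\<And>u. u \<in> P \<Longrightarrow> x u = y u"
  shows "outside_prob r n s P x t z = outside_prob r n s P y t z"
  unfolding outside_prob_def using assms by (intro prod.cong) (auto simp: inner_particles_def)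

lemma measurable_weight: "u \<in> A \<Longrightarrow> (\<lambda>x. x u) \<in> borel_measurable (weights A)"
  using measurable_component_singleton[of u A "\<lambda>_. \<nu>"] by (simp cong: measurable_cong_sets add: sets_\<nu>)

lemma measurable_inside_prob [measurable]:
  assumes P: "tree_shape q r P"
  shows "inside_prob n s P \<in> borel_measurable (weights P)"
proof -
  note [measurable] = measurable_weight
  have bl: "butlast v \<in> P" if "v \<in> P - {[]}" for v
    using tree_shape_butlast(1)[OF P, of v] that by (auto simp: inner_particles_def)
  have ew: "(\<lambda>x. edge_weight n t t' (x u) (x v)) \<in> borel_measurable (weights P)"
    if "u \<in> P" "v \<in> P" for t t' u v unfolding edge_weight_def using that by measurable
  show ?thesis
    unfolding inside_prob_def[abs_def] split_beta
    using bl by (intro borel_measurable_times borel_measurable_prod borel_measurable_diff ew) auto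
qed

lemma measurable_escape_rate [measurable]:
  "escape_rate r s P \<in> borel_measurable (weights P)"
proof -
  note [measurable] = measurable_weight
  show ?thesis unfolding escape_rate_def[abs_def]
    by (intro borel_measurable_sum borel_measurable_times borel_measurable_abs) (auto simp: inner_particles_def)
qed

lemma measurable_embedding_density:
  assumes "tree_shape q r P"
  shows "embedding_density r n s P \<in> borel_measurable (weights P)"
  unfolding embedding_density_def[abs_def] using measurable_inside_prob[OF assms] by measurable

lemma measurable_iso_class_indicator:
  assumes P: "tree_shape q r P" and S: "S \<in> sets iso_space"
  shows "(\<lambda>x. indicator S (iso_class (tree_graph s P x)) :: ennreal) \<in> borel_measurable (weights P)"
proof -
  have "(\<lambda>x. iso_class (tree_graph s P x)) \<in> weights P \<rightarrow>\<^sub>M iso_space"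
    using measurable_iso_class_tree_graph[OF P]
    by (simp add: sets_\<nu> cong: measurable_cong_sets sets_PiM_cong)
  then show ?thesis by (rule measurable_compose) (use S in simp)
qed

text \<open>The event that \<open>f\<close> embeds \<open>P\<close> as the ball of radius \<open>r\<close> and the class of this ball is in \<open>S\<close>.\<close>

definition embedding_event ::
    "nat \<Rightarrow> nat \<Rightarrow> nat \<Rightarrow> particle set \<Rightarrow> (particle \<Rightarrow> nat) \<Rightarrow> nat mgraph set set \<Rightarrow> dcsbm_outcome set" where
  "embedding_event r n s P f S = {\<omega> \<in> space (dcsbm_space n). ball_embedding r s P f (dcsbm_graph n \<omega>) \<and>
     iso_class (root_ball r (dcsbm_graph n \<omega>)) \<in> S}"

lemma embedding_event_sets:
  assumes S: "S \<in> sets iso_space"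
  shows "embedding_event r n s P f S \<in> sets (dcsbm_space n)"
proof -
  let ?g = "\<lambda>k. dcsbm_graph n (fst k, (\<lambda>_. 0), fst (snd k), snd (snd k))"
  have "{\<omega> \<in> space (dcsbm_space n). ball_embedding r s P f (?g (fst \<omega>, snd (snd \<omega>)))} \<in> sets (dcsbm_space n)"
    using measurable_sets[OF measurable_discrete_part, of "{k \<in> ({1..n} \<rightarrow>\<^sub>E UNIV) \<times> (vertex_pairs n \<rightarrow>\<^sub>E UNIV) \<times> {1..n}.
      ball_embedding r s P f (?g k)}" n] measurable_space[OF measurable_discrete_part, of _ n]
    by (auto simp: vimage_def Int_def conj_commute cong: conj_cong)
  moreover have "ball_embedding r s P f (?g (fst \<omega>, snd (snd \<omega>))) = ball_embedding r s P f (dcsbm_graph n \<omega>)" for \<omega>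
    by (cases \<omega>) (simp add: ball_embedding_def)
  ultimately have "{\<omega> \<in> space (dcsbm_space n). ball_embedding r s P f (dcsbm_graph n \<omega>)} \<in> sets (dcsbm_space n)"
    by simp
  from sets.Int[OF this measurable_sets[OF measurable_root_ball_class[of r n] S]]
  show ?thesis unfolding embedding_event_def by (simp add: vimage_def Int_def conj_ac)
qed

lemma emeasure_observed_embedding_ge:
  assumes n: "n \<ge> 1" and P: "tree_shape q r P" and f: "f \<in> P \<rightarrow> {1..n}" "inj_on f P"
    and S: "S \<in> sets iso_space" and \<sigma>: "\<sigma> \<in> space (spin_space n)" and \<phi>: "\<phi> \<in> space (weight_space n)"
  defines "x \<equiv> \<lambda>u\<in>P. \<phi> (f u)"
  shows "emeasure (observed n \<sigma> \<phi>) (embedding_event r n s P f S) \<ge>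
    ennreal (inside_prob n s P x / real n) * indicator S (iso_class (tree_graph s P x)) *
    (\<Prod>w\<in>{1..n}. if w \<in> f ` P then indicator {particle_spin s (inv_into P f w)} (\<sigma> w)
        else ennreal (outside_prob r n s P x (\<sigma> w) (\<phi> w)))" (is "_ \<ge> _ * _ * ?pr")
proof (cases "(\<forall>u\<in>P. \<sigma> (f u) = particle_spin s u) \<and> iso_class (tree_graph s P x) \<in> S")
  case False
  have "?pr = 0" if "u \<in> P" "\<sigma> (f u) \<noteq> particle_spin s u" for u
    using that f by (intro prod_zero bexI[of _ "f u"]) auto
  note Z = this
  show ?thesis
  proof (cases "iso_class (tree_graph s P x) \<in> S")
    case True
    with False obtain u where "u \<in> P" "\<sigma> (f u) \<noteq> particle_spin s u" by auto
    from Z[OF this] show ?thesis by (simp only: mult_zero_right zero_le)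
  qed simp
next
  case True
  let ?E = "embedding_event r n s P f S"
  have \<rho>: "f [] \<in> {1..n}" using f(1) tree_shapeD(2)[OF P] by auto
  have D: "(\<sigma>, \<phi>, \<eta>, f []) \<in> ?E" if \<eta>: "\<eta> \<in> space (edge_space n)"
    "\<And>e. e \<in> vertex_pairs n \<Longrightarrow> \<eta> e \<in> embedding_edges r P f e" for \<eta>
  proof -
    have emb: "ball_embedding r s P f (dcsbm_graph n (\<sigma>, \<phi>, \<eta>, f []))"
      using f True \<eta>(2) by (intro ball_embedding_of_edges) auto
    have "iso_class (root_ball r (dcsbm_graph n (\<sigma>, \<phi>, \<eta>, f []))) = iso_class (tree_graph s P (\<lambda>u. \<phi> (f u)))"
      using ball_embedding_iso_class[OF P emb finite_rooted_dcsbm_graph[OF \<rho>]] by simp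
    also have "\<dots> = iso_class (tree_graph s P x)"
      by (rule iso_class_tree_graph_cong) (simp_all add: x_def tree_shapeD(2)[OF P])
    finally show ?thesis
      using True emb \<sigma> \<phi> \<eta>(1) \<rho> by (simp add: embedding_event_def dcsbm_space_def space_pair_measure del: dcsbm_graph.simps)
  qed
  have J: "?pr =
     (\<Prod>w\<in>{1..n} - f ` P. ennreal (outside_prob r n s P x (\<sigma> w) (\<phi> w)))"
    using True f by (intro prod.mono_neutral_cong_right) auto
  have x: "x u = \<phi> (f u)" if "u \<in> P" for u using that by (simp add: x_def)
  have "inside_prob n s P x / real n * (\<Prod>w\<in>{1..n} - f ` P. outside_prob r n s P x (\<sigma> w) (\<phi> w))
    = inside_prob n s P (\<lambda>u. \<phi> (f u)) * (\<Prod>w\<in>{1..n} - f ` P. outside_prob r n s P (\<lambda>u. \<phi> (f u)) (\<sigma> w) (\<phi> w)) / real n"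
    using inside_prob_cong[OF P x] outside_prob_cong[OF x] by simp
  also have "\<dots> \<le> (\<Prod>e\<in>vertex_pairs n. measure (bernoulli_pmf (edge_prob a b n \<sigma> \<phi> e)) (embedding_edges r P f e)) / real n"
    using True by (intro divide_right_mono embedding_edges_prob_ge[OF P f]) auto
  finally have "ennreal (inside_prob n s P x / real n * (\<Prod>w\<in>{1..n} - f ` P. outside_prob r n s P x (\<sigma> w) (\<phi> w)))
    \<le> emeasure (observed n \<sigma> \<phi>) ?E"
    using emeasure_observed_ge[OF n embedding_event_sets[OF S] \<sigma> \<phi> \<rho> D]
    by (meson ennreal_leI order_trans)
  moreover have "ennreal (inside_prob n s P x / real n * (\<Prod>w\<in>{1..n} - f ` P. outside_prob r n s P x (\<sigma> w) (\<phi> w))) =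
    ennreal (inside_prob n s P x / real n) * (\<Prod>w\<in>{1..n} - f ` P. ennreal (outside_prob r n s P x (\<sigma> w) (\<phi> w)))"
    using inside_prob_nonneg outside_prob_nonneg
    by (subst ennreal_mult) (auto intro!: prod_nonneg simp: prod_ennreal)
  ultimately show ?thesis using True unfolding J by simp
qed

text \<open>Given the weights, the integrand is a product over the vertices as a function of the spins; after the
  spins have been integrated out, it is a product over the weights outside the ball.\<close>

lemma emeasure_embedding_ge:
  assumes n: "n \<ge> 1" and P: "tree_shape q r P" and s: "s \<in> {1..q}" and f: "f \<in> P \<rightarrow> {1..n}" "inj_on f P"
    and S: "S \<in> sets iso_space"
  shows "emeasure (dcsbm q a b \<nu> n) (embedding_event r n s P f S) \<ge>
    class_integral s P S (embedding_density r n s P)"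
proof -
  let ?V = "{1..n}" and ?I = "f ` P" and ?J = "{1..n} - f ` P"
  let ?W = "\<lambda>A. PiM A (\<lambda>_ :: nat. \<nu>)" and ?\<Sigma> = "PiM {1..n} (\<lambda>_. spin_law q)"
  let ?x = "\<lambda>\<phi>. \<lambda>u\<in>P. \<phi> (f u) :: real"
  let ?F = "\<lambda>x. ennreal (inside_prob n s P x / real n) * indicator S (iso_class (tree_graph s P x))"
  let ?K = "\<lambda>w t \<phi>. if w \<in> f ` P then indicator {particle_spin s (inv_into P f w)} t
        else ennreal (outside_prob r n s P (?x \<phi>) t (\<phi> w))"
  let ?h = "\<lambda>x y. ennreal ((\<Sum>t\<in>{1..q}. outside_prob r n s P x t y) / real q)"
  let ?Q = "\<lambda>\<phi>. \<Prod>w\<in>?V. if w \<in> ?I then ennreal (1 / real q) else ?h (?x \<phi>) (\<phi> w)"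
  let ?T = "\<lambda>\<phi>. ?F (?x \<phi>) * ?Q \<phi>"
  let ?L = "\<lambda>\<sigma> \<phi>. \<Prod>w\<in>?V. ?K w (\<sigma> w) \<phi>"
  have fP: "finite P" using tree_shapeD[OF P] by simp
  have fV: "f u \<in> ?V" if "u \<in> P" for u using f(1) that by auto
  have IV: "?I \<union> ?J = ?V" using fV by auto
  have cI: "card ?I = card P" by (rule card_image[OF f(2)])
  have cJ: "card ?J = n - card P" using fP fV by (subst card_Diff_subset) (auto simp: cI)
  interpret W: product_sigma_finite "\<lambda>_ :: nat. \<nu>"
    unfolding product_sigma_finite_def using prob_space_imp_sigma_finite[OF prob_space_axioms] by simp
  interpret SL: product_sigma_finite "\<lambda>_ :: nat. spin_law q"
    unfolding product_sigma_finite_def spin_law_def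
    by (intro allI prob_space_imp_sigma_finite prob_space_measure_pmf)
  have ps: "prob_space ?\<Sigma>" "prob_space (?W ?V)"
    by (auto intro!: prob_space_PiM simp: spin_law_def prob_space_measure_pmf prob_space_axioms)
  interpret pair: pair_sigma_finite ?\<Sigma> "?W ?V"
    using ps by (intro pair_sigma_finite.intro prob_space_imp_sigma_finite)
  have F[measurable]: "?F \<in> borel_measurable (weights P)"
    using measurable_inside_prob[OF P] measurable_iso_class_indicator[OF P S] by measurable
  have xm: "?x \<in> ?W A \<rightarrow>\<^sub>M weights P" if "?I \<subseteq> A" for A
    using that by (intro measurable_restrict measurable_component_singleton) auto
  have o: "(\<lambda>\<phi>. outside_prob r n s P (?x \<phi>) t (\<phi> w)) \<in> borel_measurable (?W ?V)" if "w \<in> ?V" for w t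
  proof -
    have "(\<lambda>\<phi>. \<Prod>u\<in>inner_particles r P. 1 - min 1 (max 0 (\<phi> (f u) * \<phi> w / real n * affinity a b (particle_spin s u) t)))
        \<in> borel_measurable (?W ?V)"
      using fV that by (intro borel_measurable_prod borel_measurable_diff borel_measurable_min
          borel_measurable_max borel_measurable_times borel_measurable_divide measurable_weight)
        (auto simp: inner_particles_def)
    moreover have "outside_prob r n s P (?x \<phi>) t z = outside_prob r n s P (\<lambda>u. \<phi> (f u)) t z" for \<phi> z
      by (rule outside_prob_cong) simp
    ultimately show ?thesis by (simp add: outside_prob_def edge_weight_def)
  qed
  have om: "(\<lambda>y. outside_prob r n s P x t y) \<in> borel_measurable \<nu>" for x t by (rule measurable_outside_prob)
  have hm: "?h x \<in> borel_measurable \<nu>" for x using om by measurable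
  have Km: "?K w t \<in> borel_measurable (?W ?V)" if "w \<in> ?V" for w t
    using measurable_compose[OF o[OF that, of t] measurable_ennreal] by (cases "w \<in> f ` P") simp_all
  have sl: "sets (spin_law q) = sets (count_space UNIV)" by (simp add: spin_law_def)
  have joint: "(\<lambda>(\<sigma>, \<phi>). ?F (?x \<phi>) * ?L \<sigma> \<phi>) \<in> borel_measurable (?\<Sigma> \<Otimes>\<^sub>M ?W ?V)"
    unfolding split_beta
  proof (rule borel_measurable_times_ennreal, rule_tac [2] borel_measurable_prod_ennreal)
    show "(\<lambda>p. ?F (?x (snd p))) \<in> borel_measurable (?\<Sigma> \<Otimes>\<^sub>M ?W ?V)"
      using fV by (intro measurable_compose[OF measurable_compose[OF measurable_snd xm] F]) auto
    fix w assume w: "w \<in> ?V"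
    have sw: "(\<lambda>p. fst p w) \<in> ?\<Sigma> \<Otimes>\<^sub>M ?W ?V \<rightarrow>\<^sub>M count_space UNIV"
    proof -
      have "(\<lambda>\<sigma>. \<sigma> w) \<in> ?\<Sigma> \<rightarrow>\<^sub>M spin_law q" by (rule measurable_component_singleton[OF w])
      from measurable_compose[OF measurable_fst this]
      show ?thesis by (simp only: measurable_cong_sets[OF refl sl])
    qed
    show "(\<lambda>p. ?K w (fst p w) (snd p)) \<in> borel_measurable (?\<Sigma> \<Otimes>\<^sub>M ?W ?V)"
      by (rule measurable_compose_countable[OF measurable_compose[OF measurable_snd Km[OF w]] sw])
  qed
  have Kint: "(\<integral>\<^sup>+t. ?K w t \<phi> \<partial>spin_law q) = (if w \<in> ?I then ennreal (1 / real q) else ?h (?x \<phi>) (\<phi> w))"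
    if "w \<in> ?V" for w \<phi>
  proof (cases "w \<in> ?I")
    case True
    have "particle_spin s (inv_into P f w) \<in> {1..q}"
      using tree_shape_spin[OF P s inv_into_into[OF True]] .
    then have "(\<Sum>t\<in>{1..q}. indicator {particle_spin s (inv_into P f w)} t :: ennreal) = 1"
      by (simp add: indicator_def sum.delta)
    then show ?thesis using True q_pos by (simp add: nn_integral_spin_law divide_ennreal[symmetric])
  next
    case False
    then show ?thesis using outside_prob_nonneg q_pos
      by (simp add: nn_integral_spin_law sum_ennreal sum_nonneg divide_ennreal)
  qed
  have fold_eq: "(\<integral>\<^sup>+y. ?T (merge ?I ?J (z, y)) \<partial>?W ?J) =
     ?F (?x z) * ennreal (1 / real q) ^ card P * (\<integral>\<^sup>+y. ?h (?x z) y \<partial>\<nu>) ^ (n - card P)" for z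
  proof -
    have mx: "?x (merge ?I ?J (z, y)) = ?x z" for y by (auto simp: merge_def)
    have pr: "(\<Prod>w\<in>?V. if w \<in> ?I then ennreal (1 / real q) else ?h (?x z) (merge ?I ?J (z, y) w)) =
      ennreal (1 / real q) ^ card P * (\<Prod>w\<in>?J. ?h (?x z) (y w))" for y
    proof -
      have "(\<Prod>w\<in>?I \<union> ?J. if w \<in> ?I then ennreal (1 / real q) else ?h (?x z) (merge ?I ?J (z, y) w)) =
        (\<Prod>w\<in>?I. ennreal (1 / real q)) * (\<Prod>w\<in>?J. ?h (?x z) (y w))"
        using fP by (subst prod.union_disjoint) (auto intro!: arg_cong2[where f = "(*)"] prod.cong simp: merge_def)
      then show ?thesis unfolding IV by (simp add: cI)
    qed
    have "(\<integral>\<^sup>+y. ?F (?x z) * (ennreal (1 / real q) ^ card P * (\<Prod>w\<in>?J. ?h (?x z) (y w))) \<partial>?W ?J) =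
      ?F (?x z) * (ennreal (1 / real q) ^ card P * (\<integral>\<^sup>+y. (\<Prod>w\<in>?J. ?h (?x z) (y w)) \<partial>?W ?J))"
    proof -
      have hp: "(\<lambda>y. \<Prod>w\<in>?J. ?h (?x z) (y w)) \<in> borel_measurable (?W ?J)"
      proof (rule borel_measurable_prod_ennreal)
        fix w assume "w \<in> ?J"
        then have "(\<lambda>y. y w) \<in> ?W ?J \<rightarrow>\<^sub>M \<nu>" by (rule measurable_component_singleton)
        then show "(\<lambda>y. ?h (?x z) (y w)) \<in> borel_measurable (?W ?J)" by (rule measurable_compose[OF _ hm])
      qed
      then show ?thesis by (subst nn_integral_cmult; (subst nn_integral_cmult)?) auto
    qed
    also have "(\<integral>\<^sup>+y. (\<Prod>w\<in>?J. ?h (?x z) (y w)) \<partial>?W ?J) = (\<integral>\<^sup>+y. ?h (?x z) y \<partial>\<nu>) ^ (n - card P)"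
      using hm cJ by (subst W.product_nn_integral_prod) auto
    finally show ?thesis by (simp only: mx pr mult.assoc)
  qed
  let ?G = "\<lambda>x. ennreal (embedding_density r n s P x) * indicator S (iso_class (tree_graph s P x))"
  have G: "?G \<in> borel_measurable (weights P)"
    using measurable_embedding_density[OF P] measurable_iso_class_indicator[OF P S] by measurable
  have GF: "?G x \<le> ?F x * ennreal (1 / real q) ^ card P * (\<integral>\<^sup>+y. ?h x y \<partial>\<nu>) ^ (n - card P)" for x
  proof -
    define M where "M = max 0 (1 - escape_rate r s P x / real n)"
    have M: "M \<ge> 0" by (simp add: M_def)
    have "ennreal (embedding_density r n s P x) = ennreal (inside_prob n s P x / real n) *
      ennreal (1 / real q) ^ card P * ennreal M ^ (n - card P)"
      unfolding embedding_density_def M_def[symmetric] using inside_prob_nonneg[of n s P x] M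
      by (simp add: ennreal_power ennreal_mult'[symmetric] ennreal_mult''[symmetric] power_one_over)
    also have "\<dots> \<le> ennreal (inside_prob n s P x / real n) *
      ennreal (1 / real q) ^ card P * (\<integral>\<^sup>+y. ?h x y \<partial>\<nu>) ^ (n - card P)"
      unfolding M_def by (intro mult_left_mono power_mono outside_prob_mean_ge[OF n]) auto
    finally show ?thesis by (auto simp: indicator_def)
  qed
  have "(\<integral>\<^sup>+x. ?G x \<partial>weights P) = (\<integral>\<^sup>+x. ?G x \<partial>distr (?W ?I) (weights P) ?x)"
    using distr_PiM_reindex[of ?I "\<lambda>_. \<nu>" f P] f(2) prob_space_axioms by simp
  also have "\<dots> = (\<integral>\<^sup>+z. ?G (?x z) \<partial>?W ?I)"
    by (rule nn_integral_distr[OF xm]) (use G in \<open>simp_all only: measurable_distr_eq1 subset_refl\<close>)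
  also have "\<dots> \<le> (\<integral>\<^sup>+z. ?F (?x z) * ennreal (1 / real q) ^ card P * (\<integral>\<^sup>+y. ?h (?x z) y \<partial>\<nu>) ^ (n - card P) \<partial>?W ?I)"
    by (intro nn_integral_mono GF)
  also have "\<dots> = (\<integral>\<^sup>+z. \<integral>\<^sup>+y. ?T (merge ?I ?J (z, y)) \<partial>?W ?J \<partial>?W ?I)"
    by (simp only: fold_eq)
  also have "\<dots> = (\<integral>\<^sup>+\<phi>. ?T \<phi> \<partial>?W (?I \<union> ?J))"
  proof (rule W.product_nn_integral_fold[symmetric])
    show "?T \<in> borel_measurable (?W (?I \<union> ?J))"
      unfolding IV
    proof (rule borel_measurable_times_ennreal, rule_tac [2] borel_measurable_prod_ennreal)
      show "(\<lambda>\<phi>. ?F (?x \<phi>)) \<in> borel_measurable (?W ?V)"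
        using fV by (intro measurable_compose[OF xm F]) auto
      fix w assume w: "w \<in> ?V"
      show "(\<lambda>\<phi>. if w \<in> ?I then ennreal (1 / real q) else ?h (?x \<phi>) (\<phi> w)) \<in> borel_measurable (?W ?V)"
        using o[OF w] by (cases "w \<in> ?I") (auto intro!: measurable_compose[OF _ measurable_ennreal] borel_measurable_divide borel_measurable_sum)
    qed
  qed (use fP in auto)
  also have "\<dots> = (\<integral>\<^sup>+\<phi>. ?T \<phi> \<partial>?W ?V)"
    by (simp only: IV)
  also have "\<dots> = (\<integral>\<^sup>+\<phi>. \<integral>\<^sup>+\<sigma>. ?F (?x \<phi>) * ?L \<sigma> \<phi> \<partial>?\<Sigma> \<partial>?W ?V)"
  proof (rule nn_integral_cong)
    fix \<phi> assume "\<phi> \<in> space (?W ?V)"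
    have Ks: "(\<lambda>t. ?K w t \<phi>) \<in> borel_measurable (spin_law q)" for w by (simp add: spin_law_def)
    have "(\<lambda>\<sigma>. \<Prod>w\<in>?V. ?K w (\<sigma> w) \<phi>) \<in> borel_measurable ?\<Sigma>"
    proof (rule borel_measurable_prod_ennreal)
      fix w assume "w \<in> ?V"
      then have "(\<lambda>\<sigma>. \<sigma> w) \<in> ?\<Sigma> \<rightarrow>\<^sub>M spin_law q" by (rule measurable_component_singleton)
      then show "(\<lambda>\<sigma>. ?K w (\<sigma> w) \<phi>) \<in> borel_measurable ?\<Sigma>" by (rule measurable_compose[OF _ Ks])
    qed
    then have "(\<integral>\<^sup>+\<sigma>. ?F (?x \<phi>) * ?L \<sigma> \<phi> \<partial>?\<Sigma>) = ?F (?x \<phi>) * (\<integral>\<^sup>+\<sigma>. ?L \<sigma> \<phi> \<partial>?\<Sigma>)"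
      by (rule nn_integral_cmult)
    also have "(\<integral>\<^sup>+\<sigma>. ?L \<sigma> \<phi> \<partial>?\<Sigma>) = (\<Prod>w\<in>?V. \<integral>\<^sup>+t. ?K w t \<phi> \<partial>spin_law q)"
      by (rule SL.product_nn_integral_prod[OF _ Ks]) simp
    also have "\<dots> = ?Q \<phi>"
      by (intro prod.cong refl Kint)
    finally show "?T \<phi> = (\<integral>\<^sup>+\<sigma>. ?F (?x \<phi>) * ?L \<sigma> \<phi> \<partial>?\<Sigma>)" by (rule sym)
  qed
  also have "\<dots> = (\<integral>\<^sup>+\<sigma>. \<integral>\<^sup>+\<phi>. ?F (?x \<phi>) * ?L \<sigma> \<phi> \<partial>?W ?V \<partial>?\<Sigma>)"
    by (rule pair.Fubini'[OF joint])
  also have "\<dots> \<le> (\<integral>\<^sup>+\<sigma>. \<integral>\<^sup>+\<phi>. emeasure (observed n \<sigma> \<phi>) (embedding_event r n s P f S) \<partial>?W ?V \<partial>?\<Sigma>)"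
    by (intro nn_integral_mono emeasure_observed_embedding_ge[OF n P f S])
       (auto simp: space_PiM spin_law_def space_\<nu>)
  also have "\<dots> = emeasure (dcsbm q a b \<nu> n) (embedding_event r n s P f S)"
    by (rule emeasure_dcsbm[OF n embedding_event_sets[OF S], symmetric])
  finally show ?thesis .
qed

end

section \<open>Convergence of the densities\<close>

text \<open>The injections that may embed the tree \<open>P\<close> into a graph on \<open>n\<close> vertices.\<close>

definition embeddings :: "particle set \<Rightarrow> nat \<Rightarrow> (particle \<Rightarrow> nat) set" where
  "embeddings P n = {f \<in> P \<rightarrow>\<^sub>E {1..n}. inj_on f P}"

lemma finite_embeddings: "finite P \<Longrightarrow> finite (embeddings P n)"
  unfolding embeddings_def
  by (rule finite_subset[of _ "P \<rightarrow>\<^sub>E {1..n}"]) (auto intro: finite_PiE)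

lemma card_embeddings_asymp:
  assumes "finite P"
  shows "(\<lambda>n. real (card (embeddings P n)) / real n ^ card P) \<longlonglongrightarrow> 1"
proof -
  have c: "real (card (embeddings P n)) / real n ^ card P = (\<Prod>i\<in>{0..<card P}. real (n - i) / real n)" for n
  proof -
    have "card (embeddings P n) = (\<Prod>i\<in>{0..<card P}. n - i)"
      unfolding embeddings_def using assms by (subst card_inj_on_subset_funcset) auto
    then show ?thesis by (simp add: prod_dividef)
  qed
  have "(\<lambda>n. real (n - i) / real n) \<longlonglongrightarrow> 1" for i
  proof -
    have "(\<lambda>n. 1 - real i / real n) \<longlonglongrightarrow> 1 - 0"
      by (intro tendsto_diff tendsto_const lim_const_over_n)
    moreover have "\<forall>\<^sub>F n in sequentially. 1 - real i / real n = real (n - i) / real n"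
      using eventually_ge_at_top[of "Suc i"] by eventually_elim (simp add: of_nat_diff field_simps)
    ultimately have "(\<lambda>n. real (n - i) / real n) \<longlonglongrightarrow> 1 - 0" by (rule Lim_transform_eventually)
    then show ?thesis by simp
  qed
  then have "(\<lambda>n. \<Prod>i\<in>{0..<card P}. real (n - i) / real n) \<longlonglongrightarrow> (\<Prod>i\<in>{0..<card P}. 1)"
    by (intro tendsto_prod)
  then show ?thesis by (simp add: c)
qed

lemma power_exp_limit:
  "(\<lambda>n. max 0 (1 - c / real n) ^ (n - k)) \<longlonglongrightarrow> exp (- c)"
proof -
  have 1: "(\<lambda>n. 1 - c / real n) \<longlonglongrightarrow> 1 - 0"
    by (intro tendsto_diff tendsto_const lim_const_over_n)
  have "(\<lambda>n. (1 + (- c) / real n) ^ n) \<longlonglongrightarrow> exp (- c)" by (rule tendsto_exp_limit_sequentially)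
  then have "(\<lambda>n. (1 - c / real n) ^ n / (1 - c / real n) ^ k) \<longlonglongrightarrow> exp (- c) / (1 - 0) ^ k"
    by (intro tendsto_divide tendsto_power 1) auto
  moreover have "\<forall>\<^sub>F n in sequentially. (1 - c / real n) ^ n / (1 - c / real n) ^ k = max 0 (1 - c / real n) ^ (n - k)"
  proof -
    have "\<forall>\<^sub>F n in sequentially. 0 < 1 - c / real n" by (rule order_tendstoD(1)[OF 1]) simp
    then show ?thesis using eventually_ge_at_top[of k]
      by eventually_elim (subst power_diff, auto)
  qed
  ultimately show ?thesis by (auto dest: Lim_transform_eventually)
qed

context dcsbm_model
begin

lemma edge_weight_scaled:
  assumes "x > 0" "y > 0"
  shows "(\<lambda>n. real n * edge_weight n s t x y) \<longlonglongrightarrow> x * y * affinity a b s t"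
proof (rule tendsto_eventually)
  let ?z = "x * y * affinity a b s t"
  have z: "?z > 0" using assms affinity_pos by simp
  obtain N where N: "?z < real N" using reals_Archimedean2 by blast
  show "\<forall>\<^sub>F n in sequentially. real n * edge_weight n s t x y = ?z"
    using eventually_ge_at_top[of N]
  proof eventually_elim
    case (elim n)
    have n: "?z < real n" using N elim by linarith
    then have "0 \<le> x * y / real n * affinity a b s t" "x * y / real n * affinity a b s t \<le> 1"
      using z by (auto simp: field_simps)
    then have "edge_weight n s t x y = x * y / real n * affinity a b s t" unfolding edge_weight_def by simp
    then show ?case using n z by simp
  qed
qed

lemma edge_weight_to_0:
  assumes "x > 0" "y > 0"
  shows "(\<lambda>n. edge_weight n s t x y) \<longlonglongrightarrow> 0"
proof -
  have "(\<lambda>n. real n * edge_weight n s t x y * inverse (real n)) \<longlonglongrightarrow> x * y * affinity a b s t * 0"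
    by (intro tendsto_mult edge_weight_scaled[OF assms] lim_inverse_n)
  moreover have "\<forall>\<^sub>F n in sequentially. real n * edge_weight n s t x y * inverse (real n) = edge_weight n s t x y"
    using eventually_gt_at_top[of 0] by eventually_elim (simp add: field_simps)
  ultimately have "(\<lambda>n. edge_weight n s t x y) \<longlonglongrightarrow> x * y * affinity a b s t * 0"
    by (rule Lim_transform_eventually)
  then show ?thesis by simp
qed

text \<open>The density of the tree in explicit form; the two agree for positive weights.\<close>

definition limit_density :: "nat \<Rightarrow> nat \<Rightarrow> particle set \<Rightarrow> (particle \<Rightarrow> real) \<Rightarrow> real" where
  "limit_density r s P x =
     (\<Prod>v\<in>P - {[]}. x (butlast v) * x v * affinity a b (particle_spin s (butlast v)) (particle_spin s v)) *
     exp (- escape_rate r s P x) / (real (orderings q r P) * real q ^ card P)"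

text \<open>A product over the non-root particles, grouped by parent and spin.\<close>

lemma child_prod:
  fixes h :: "particle \<Rightarrow> nat \<Rightarrow> real"
  assumes P: "tree_shape q r P"
  shows "(\<Prod>u\<in>inner_particles r P. \<Prod>t\<in>{1..q}. h u t ^ offspring P u t) =
    (\<Prod>v\<in>P - {[]}. h (butlast v) (particle_spin s v))"
proof -
  let ?I = "inner_particles r P \<times> {1..q}"
  let ?S = "Sigma ?I (\<lambda>(u, t). {..<offspring P u t})"
  let ?g = "\<lambda>((u, t), i). u @ [(t, i)] :: particle"
  have fI: "finite ?I" using tree_shapeD(1)[OF P] finite_inner_particles by auto
  have bij: "bij_betw ?g ?S (P - {[]})"
    unfolding bij_betw_def
  proof
    show "inj_on ?g ?S" by (auto simp: inj_on_def)
    show "?g ` ?S = P - {[]}"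
    proof
      show "?g ` ?S \<subseteq> P - {[]}" using tree_shapeD(4)[OF P] by auto
      show "P - {[]} \<subseteq> ?g ` ?S"
      proof
        fix v assume v: "v \<in> P - {[]}"
        obtain t i where l: "last v = (t, i)" by (cases "last v")
        then have v': "v = butlast v @ [(t, i)]" using v by (metis DiffD2 append_butlast_last_id insertI1)
        then have "butlast v \<in> inner_particles r P \<and> t \<in> {1..q} \<and> i < offspring P (butlast v) t"
          using v tree_shapeD(4)[OF P, of "butlast v" t i] by auto
        then show "v \<in> ?g ` ?S" using v' by (intro image_eqI[of _ _ "((butlast v, t), i)"]) auto
      qed
    qed
  qed
  have "(\<Prod>u\<in>inner_particles r P. \<Prod>t\<in>{1..q}. h u t ^ offspring P u t) =
    (\<Prod>(u, t)\<in>?I. h u t ^ offspring P u t)" by (rule prod.cartesian_product)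
  also have "\<dots> = (\<Prod>k\<in>?I. \<Prod>i\<in>(\<lambda>(u, t). {..<offspring P u t}) k. h (fst k) (snd k))"
    by (intro prod.cong refl) (auto simp: split_beta)
  also have "\<dots> = (\<Prod>(k, i)\<in>?S. h (fst k) (snd k))"
    using fI by (subst prod.Sigma) auto
  also have "\<dots> = (\<Prod>k\<in>?S. (\<lambda>v. h (butlast v) (particle_spin s v)) (?g k))"
    by (intro prod.cong refl) (auto simp: particle_spin_def)
  also have "\<dots> = (\<Prod>v\<in>P - {[]}. h (butlast v) (particle_spin s v))"
    by (rule prod.reindex_bij_betw[OF bij])
  finally show ?thesis .
qed

lemma tree_density_eq:
  assumes P: "tree_shape q r P" and x: "\<And>u. u \<in> P \<Longrightarrow> x u > 0"
  shows "tree_density r s P x = limit_density r s P x"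
proof -
  have fP: "finite P" and NP: "[] \<in> P" using tree_shapeD[OF P] by auto
  have inP: "inner_particles r P \<subseteq> P" by (auto simp: inner_particles_def)
  let ?inn = "inner_particles r P"
  let ?op = "\<lambda>u. offspring_prob (particle_spin s u) (offspring P u) (x u)"
  let ?kap = "\<lambda>u t. affinity a b (particle_spin s u) t"
  let ?rate = "\<lambda>u t. ?kap u t / real q * \<Phi> * x u"
  let ?R = "\<Prod>v\<in>P - {[]}. ?rate (butlast v) (particle_spin s v)" and ?W = "\<Prod>v\<in>P - {[]}. x v / \<Phi>"
  have q: "real q > 0" using q_pos by simp
  have rate: "?rate u t > 0" if "u \<in> P" for u t
    using x[OF that] affinity_pos q \<Phi>_pos by simp
  have op: "?op u =
     (\<Prod>t\<in>{1..q}. ?rate u t ^ offspring P u t) / (\<Prod>t\<in>{1..q}. fact (offspring P u t)) *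
     exp (- (\<bar>x u\<bar> * ((\<Sum>t\<in>{1..q}. ?kap u t) / real q) * \<Phi>))" if u: "u \<in> ?inn" for u
  proof -
    have uP: "u \<in> P" using u inP by auto
    have "measure (poisson_law (?rate u t)) {k} = ?rate u t ^ k / fact k * exp (- ?rate u t)" for t k
      using rate[OF uP, of t] by (simp add: poisson_law_def measure_pmf_single)
    then have "?op u =
      (\<Prod>t\<in>{1..q}. ?rate u t ^ offspring P u t / fact (offspring P u t) * exp (- ?rate u t))"
      unfolding offspring_prob_def by (intro prod.cong) auto
    also have "\<dots> = (\<Prod>t\<in>{1..q}. ?rate u t ^ offspring P u t) / (\<Prod>t\<in>{1..q}. fact (offspring P u t)) *
      exp (\<Sum>t\<in>{1..q}. - ?rate u t)"
      by (simp add: prod.distrib prod_dividef exp_sum)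
    also have "(\<Sum>t\<in>{1..q}. - ?rate u t) = - (\<bar>x u\<bar> * ((\<Sum>t\<in>{1..q}. ?kap u t) / real q) * \<Phi>)"
      using x[OF uP] by (simp add: sum_negf sum_distrib_right sum_distrib_left sum_divide_distrib
          mult.commute mult.left_commute mult.assoc)
    finally show ?thesis .
  qed
  have A: "(\<Prod>u\<in>P. if u = [] then 1 else max 0 (x u / \<Phi>)) = ?W"
  proof -
    have "max 0 (x v / \<Phi>) = x v / \<Phi>" if "v \<in> P" for v using x[OF that] \<Phi>_pos by simp
    then show ?thesis using fP by (intro prod.mono_neutral_cong_right) auto
  qed
  have B: "(\<Prod>u\<in>P. if length u < r then ?op u else 1) =
    (\<Prod>u\<in>?inn. ?op u)"
    using fP by (intro prod.mono_neutral_cong_right) (auto simp: inner_particles_def)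
  have C: "(\<Prod>u\<in>?inn. ?op u) =
    ?R / real (orderings q r P) * exp (- escape_rate r s P x)"
  proof -
    have "(\<Prod>u\<in>?inn. ?op u) =
      (\<Prod>u\<in>?inn. \<Prod>t\<in>{1..q}. ?rate u t ^ offspring P u t) / (\<Prod>u\<in>?inn. \<Prod>t\<in>{1..q}. fact (offspring P u t)) *
      exp (- escape_rate r s P x)"
      using finite_inner_particles[OF fP, of r]
      by (simp add: op prod.distrib prod_dividef escape_rate_def exp_sum sum_negf[symmetric] cong: prod.cong)
    moreover have "(\<Prod>u\<in>?inn. \<Prod>t\<in>{1..q}. fact (offspring P u t)) = real (orderings q r P)"
      unfolding orderings_def prod.cartesian_product by (simp add: split_beta)
    moreover have "(\<Prod>u\<in>?inn. \<Prod>t\<in>{1..q}. ?rate u t ^ offspring P u t) = ?R"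
      by (rule child_prod[OF P])
    ultimately show ?thesis by simp
  qed
  have D: "?W * ?R =
    (\<Prod>v\<in>P - {[]}. x (butlast v) * x v * ?kap (butlast v) (particle_spin s v)) / real q ^ (card P - 1)"
  proof -
    have "?W * ?R =
      (\<Prod>v\<in>P - {[]}. x (butlast v) * x v * ?kap (butlast v) (particle_spin s v) / real q)"
      unfolding prod.distrib[symmetric] using \<Phi>_pos by (intro prod.cong refl) (simp add: field_simps)
    also have "\<dots> = (\<Prod>v\<in>P - {[]}. x (butlast v) * x v * ?kap (butlast v) (particle_spin s v)) / real q ^ (card P - 1)"
      using fP NP by (simp add: prod_dividef card_Diff_singleton)
    finally show ?thesis .
  qed
  have "card P > 0" using fP NP by (auto simp: card_gt_0_iff)
  then have qk: "real q ^ card P = real q * real q ^ (card P - 1)" by (simp add: power_eq_if)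
  have "tree_density r s P x = ?W *
      (?R / real (orderings q r P) * exp (- escape_rate r s P x)) / real q"
    unfolding tree_density_def particle_density_def prod.distrib A B C by (rule refl)
  also have "\<dots> = (?W * ?R) *
      exp (- escape_rate r s P x) / (real (orderings q r P) * real q)" by simp
  also have "\<dots> = limit_density r s P x" unfolding D limit_density_def qk by simp
  finally show ?thesis .
qed

text \<open>The contribution of all embeddings of \<open>P\<close>; dividing by the number of orderings
  compensates for counting each ball several times.\<close>

definition graph_density :: "nat \<Rightarrow> nat \<Rightarrow> nat \<Rightarrow> particle set \<Rightarrow> (particle \<Rightarrow> real) \<Rightarrow> real" where
  "graph_density r n s P x = real (card (embeddings P n)) / real (orderings q r P) * embedding_density r n s P x"

lemma graph_density_nonneg: "graph_density r n s P x \<ge> 0"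
  unfolding graph_density_def using embedding_density_nonneg by (intro mult_nonneg_nonneg) auto

lemma graph_density_tendsto:
  assumes P: "tree_shape q r P" and x: "\<And>u. u \<in> P \<Longrightarrow> x u > 0"
  shows "(\<lambda>n. graph_density r n s P x) \<longlonglongrightarrow> tree_density r s P x"
proof -
  have fP: "finite P" and NP: "[] \<in> P" using tree_shapeD[OF P] by auto
  have xb: "x (butlast v) > 0" if "v \<in> P - {[]}" for v
    using tree_shape_butlast(1)[OF P, of v] that by (intro x) (auto simp: inner_particles_def)
  let ?A = "\<Prod>v\<in>P - {[]}. x (butlast v) * x v * affinity a b (particle_spin s (butlast v)) (particle_spin s v)"
  let ?e = "\<lambda>n u v. edge_weight n (particle_spin s u) (particle_spin s v) (x u) (x v)"
  let ?c = "real (orderings q r P) * real q ^ card P"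
  let ?p = "\<lambda>n. real (card (embeddings P n)) / real n ^ card P"
  let ?E = "\<lambda>n. \<Prod>v\<in>P - {[]}. real n * ?e n (butlast v) v"
  let ?N = "\<lambda>n. \<Prod>(u, v)\<in>P \<times> P. 1 - ?e n u v"
  let ?X = "\<lambda>n. max 0 (1 - escape_rate r s P x / real n) ^ (n - card P)"
  let ?f = "\<lambda>n. ?p n * ?E n * ?N n * ?X n / ?c"
  have cP: "card P > 0" using fP NP by (auto simp: card_gt_0_iff)
  have "?E \<longlonglongrightarrow> ?A"
    using x xb by (intro tendsto_prod edge_weight_scaled) auto
  moreover have "?N \<longlonglongrightarrow> (\<Prod>(u, v)\<in>P \<times> P. 1 - 0)"
    unfolding split_beta using x by (intro tendsto_prod tendsto_diff tendsto_const edge_weight_to_0) auto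
  moreover have "?X \<longlonglongrightarrow> exp (- escape_rate r s P x)" by (rule power_exp_limit)
  ultimately have "?f \<longlonglongrightarrow>
    1 * ?A *
    (\<Prod>(u, v)\<in>P \<times> P. 1 - 0) * exp (- escape_rate r s P x) / ?c"
    using orderings_pos[of q r P] q_pos
    by (intro tendsto_divide tendsto_mult card_embeddings_asymp[OF fP] tendsto_const) auto
  also have "1 * ?A *
    (\<Prod>(u, v)\<in>P \<times> P. 1 - 0) * exp (- escape_rate r s P x) / ?c = tree_density r s P x"
    by (simp add: tree_density_eq[OF P x] limit_density_def split_beta)
  finally have lim: "?f \<longlonglongrightarrow> tree_density r s P x" .
  have "\<forall>\<^sub>F n in sequentially. ?f n = graph_density r n s P x"
    using eventually_gt_at_top[of 0]
  proof eventually_elim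
    case (elim n)
    have "?E n = real n ^ (card P - 1) * (\<Prod>v\<in>P - {[]}. ?e n (butlast v) v)"
      using fP NP by (simp add: prod.distrib card_Diff_singleton)
    moreover have "real n ^ card P = real n * real n ^ (card P - 1)" using cP by (simp add: power_eq_if)
    ultimately show ?case using elim
      by (simp add: graph_density_def embedding_density_def inside_prob_def field_simps)
  qed
  with lim show ?thesis by (rule Lim_transform_eventually)
qed

end

section \<open>Total variation for a fixed radius\<close>

lemma tv_dist_le:
  assumes "\<And>A. A \<in> sets M \<Longrightarrow> \<bar>measure M A - measure N A\<bar> \<le> c"
  shows "tv_dist M N \<le> c"
  unfolding tv_dist_def using assms by (intro cSUP_least) auto

lemma tv_dist_nonneg:
  assumes "prob_space M" "prob_space N"
  shows "tv_dist M N \<ge> 0"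
proof -
  have "\<bar>measure M A - measure N A\<bar> \<le> 1" for A
    using prob_space.prob_le_1[OF assms(1), of A] prob_space.prob_le_1[OF assms(2), of A]
      measure_nonneg[of M A] measure_nonneg[of N A] by linarith
  then have "\<bar>measure M {} - measure N {}\<bar> \<le> tv_dist M N"
    unfolding tv_dist_def by (intro cSUP_upper bdd_aboveI2[where M = 1]) auto
  then show ?thesis by simp
qed

text \<open>For probability measures a one-sided bound on all events is two-sided, by passing to
  complements.\<close>

lemma tv_dist_le_one_sided:
  assumes M: "prob_space M" and N: "prob_space N" and s: "sets N = sets M"
    and le: "\<And>A. A \<in> sets M \<Longrightarrow> measure N A \<le> measure M A + c"
  shows "tv_dist M N \<le> c"
proof (rule tv_dist_le)
  fix A assume A: "A \<in> sets M"
  have sp: "space N = space M" using s by (rule sets_eq_imp_space_eq)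
  have "measure N (space M - A) \<le> measure M (space M - A) + c" using A by (intro le) auto
  then have "1 - measure N A \<le> 1 - measure M A + c"
    using A s prob_space.prob_compl[OF M A] prob_space.prob_compl[OF N, of A] by (simp add: sp)
  then show "\<bar>measure M A - measure N A\<bar> \<le> c" using le[OF A] by linarith
qed

context dcsbm_model
begin

lemma iso_class_tree_graph_in_space:
  assumes "tree_shape q r P"
  shows "iso_class (tree_graph s P x) \<in> space iso_space"
proof -
  have "iso_class (tree_graph s P x) = iso_class (tree_graph s P (restrict x P))"
    using tree_shapeD(2)[OF assms] by (intro iso_class_tree_graph_cong) auto
  also have "\<dots> \<in> space iso_space"
    using measurable_space[OF measurable_iso_class_tree_graph[OF assms], of "restrict x P" s] by (simp add: space_PiM)
  finally show ?thesis .
qed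

lemma tree_density_integral_le_1:
  assumes P: "tree_shape q r P" and s: "s \<in> {1..q}"
  shows "(\<integral>\<^sup>+x. ennreal (tree_density r s P x) \<partial>weights P) \<le> 1"
proof -
  have "(\<integral>\<^sup>+x. ennreal (tree_density r s P x) \<partial>weights P) =
    (\<integral>\<^sup>+x. ennreal (tree_density r s P x) * indicator (space iso_space) (iso_class (tree_graph s P x)) \<partial>weights P)"
    by (simp add: iso_class_tree_graph_in_space[OF P])
  also have "\<dots> \<le> 1"
    unfolding emeasure_bp_tree_shape[OF P s sets.top, symmetric]
    using bp_props(3) by (rule prob_space.emeasure_le_1)
  finally show ?thesis .
qed

text \<open>The mass of the tree density that the graph density does not reach.\<close>

definition deficit :: "nat \<Rightarrow> nat \<Rightarrow> nat \<Rightarrow> particle set \<Rightarrow> ennreal" where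
  "deficit r n s P = (\<integral>\<^sup>+x. ennreal (max 0 (tree_density r s P x - graph_density r n s P x)) \<partial>weights P)"

lemma measurable_graph_density:
  assumes "tree_shape q r P"
  shows "graph_density r n s P \<in> borel_measurable (weights P)"
  unfolding graph_density_def[abs_def] using measurable_embedding_density[OF assms] by measurable

text \<open>As the deficit is at most the integrable tree density, pointwise convergence suffices.\<close>

lemma deficit_tendsto_0:
  assumes P: "tree_shape q r P" and s: "s \<in> {1..q}"
  shows "(\<lambda>n. deficit r n s P) \<longlonglongrightarrow> 0"
proof -
  note [measurable] = measurable_graph_density[OF P]
  have pos: "AE x in weights P. \<forall>u\<in>P. x u > 0"
  proof (rule AE_finite_allI)
    show "finite P" using tree_shapeD[OF P] by simp
    fix u assume "u \<in> P"
    then have "AE x in weights P. \<phi>\<^sub>0 \<le> x u"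
      using weight_ge prob_space_axioms by (intro AE_PiM_component) auto
    then show "AE x in weights P. x u > 0" by eventually_elim (use \<phi>\<^sub>0_pos in auto)
  qed
  have "(\<lambda>n. deficit r n s P) \<longlonglongrightarrow> (\<integral>\<^sup>+x. 0 \<partial>weights P)"
    unfolding deficit_def
  proof (rule nn_integral_dominated_convergence)
    show "AE x in weights P. ennreal (max 0 (tree_density r s P x - graph_density r n s P x))
       \<le> ennreal (tree_density r s P x)" for n
      using tree_density_nonneg graph_density_nonneg by (intro AE_I2 ennreal_leI) auto
    show "(\<integral>\<^sup>+x. ennreal (tree_density r s P x) \<partial>weights P) < \<infinity>"
      using tree_density_integral_le_1[OF P s] by (rule le_less_trans) simp
    show "AE x in weights P. (\<lambda>n. ennreal (max 0 (tree_density r s P x - graph_density r n s P x))) \<longlonglongrightarrow> 0"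
      using pos
    proof eventually_elim
      case (elim x)
      have "(\<lambda>n. max 0 (tree_density r s P x - graph_density r n s P x)) \<longlonglongrightarrow> max 0 (tree_density r s P x - tree_density r s P x)"
        using elim by (intro tendsto_max tendsto_const tendsto_diff graph_density_tendsto[OF P]) auto
      then have "(\<lambda>n. ennreal (max 0 (tree_density r s P x - graph_density r n s P x))) \<longlonglongrightarrow> ennreal 0"
        by (intro tendsto_ennrealI) simp
      then show ?case by simp
    qed
  qed measurable
  then show ?thesis by simp
qed

text \<open>The event that the ball is a tree with a shape in \<open>K\<close> and that its class is in \<open>S\<close>.\<close>

definition cover :: "nat \<Rightarrow> nat \<Rightarrow> (nat \<times> particle set) set \<Rightarrow> nat mgraph set set \<Rightarrow> dcsbm_outcome set" where
  "cover r n K S = (\<Union>(s, P)\<in>K. \<Union>f\<in>embeddings P n. embedding_event r n s P f S)"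

lemma cover_sets:
  assumes K: "finite K" "K \<subseteq> {1..q} \<times> {P. tree_shape q r P}" and S: "S \<in> sets iso_space"
  shows "cover r n K S \<in> sets (dcsbm_space n)"
proof -
  have "finite (embeddings P n)" if "(s, P) \<in> K" for s P
    using K(2) that by (intro finite_embeddings tree_shapeD(1)[of q r]) auto
  then show ?thesis unfolding cover_def
    using K(1) embedding_event_sets[OF S] by (intro sets.finite_UN) auto
qed

lemma emeasure_cover_ge:
  assumes K: "finite K" "K \<subseteq> {1..q} \<times> {P. tree_shape q r P}" and S: "S \<in> sets iso_space" and n: "n \<ge> 1"
  shows "emeasure (dcsbm q a b \<nu> n) (cover r n K S) \<ge>
    (\<Sum>(s, P)\<in>K. class_integral s P S (graph_density r n s P))"
proof -
  let ?M = "dcsbm q a b \<nu> n"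
  let ?o = "\<lambda>P. 1 / real (orderings q r P)"
  let ?em = "\<lambda>s P. \<Sum>f\<in>embeddings P n. ennreal (?o P) * emeasure ?M (embedding_event r n s P f S)"
  let ?emb = "\<lambda>s P \<omega>. \<Sum>f\<in>embeddings P n. ennreal (?o P) * indicator (embedding_event r n s P f S) \<omega>"
  let ?sum = "\<lambda>\<omega>. \<Sum>(s, P)\<in>K. ?emb s P \<omega>"
  have sh: "tree_shape q r P" "s \<in> {1..q}" "finite (embeddings P n)" if "(s, P) \<in> K" for s P
    using K(2) that tree_shapeD(1)[of q r P] by (auto intro: finite_embeddings)
  have ev: "embedding_event r n s P f S \<in> sets ?M" for s P f
    using embedding_event_sets[OF S] dcsbm_props[OF n] by simp
  have "(\<Sum>(s, P)\<in>K. class_integral s P S (graph_density r n s P))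
    \<le> (\<Sum>(s, P)\<in>K. ?em s P)"
  proof (rule sum_mono, clarify)
    fix s P assume sP: "(s, P) \<in> K"
    note P = sh(1)[OF sP] and s = sh(2)[OF sP]
    let ?I = "class_integral s P S (embedding_density r n s P)"
    have "class_integral s P S (graph_density r n s P) =
      (\<integral>\<^sup>+x. ennreal (real (card (embeddings P n)) * ?o P) * (ennreal (embedding_density r n s P x) * indicator S (iso_class (tree_graph s P x))) \<partial>weights P)"
      unfolding graph_density_def using embedding_density_nonneg
      by (intro nn_integral_cong) (simp add: ennreal_mult'[symmetric] mult.assoc[symmetric])
    also have "\<dots> = ennreal (real (card (embeddings P n)) * ?o P) * ?I"
      by (intro nn_integral_cmult borel_measurable_times_ennreal measurable_iso_class_indicator[OF P S]
          measurable_compose[OF measurable_embedding_density[OF P] measurable_ennreal])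
    also have "\<dots> = (\<Sum>f\<in>embeddings P n. ennreal (?o P) * ?I)"
      by (subst ennreal_mult) (simp_all add: ennreal_of_nat_eq_real_of_nat mult.assoc)
    also have "\<dots> \<le> ?em s P"
      using P s n S by (intro sum_mono mult_left_mono emeasure_embedding_ge) (auto simp: embeddings_def)
    finally show "class_integral s P S (graph_density r n s P)
      \<le> ?em s P" .
  qed
  also have "\<dots> = (\<integral>\<^sup>+\<omega>. ?sum \<omega> \<partial>?M)"
    using ev by (simp add: split_beta nn_integral_sum nn_integral_cmult)
  also have "\<dots> \<le> (\<integral>\<^sup>+\<omega>. indicator (cover r n K S) \<omega> \<partial>?M)"
  proof (rule nn_integral_mono)
    fix \<omega> assume "\<omega> \<in> space ?M"
    then have \<omega>: "\<omega> \<in> space (dcsbm_space n)" using dcsbm_props[OF n] by simp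
    show "?sum \<omega> \<le> indicator (cover r n K S) \<omega>"
    proof (cases "\<omega> \<in> cover r n K S")
      case False
      then have "?sum \<omega> = 0"
        by (intro sum.neutral) (auto simp: cover_def intro!: sum.neutral)
      then show ?thesis by simp
    next
      case True
      let ?g = "dcsbm_graph n \<omega>"
      let ?w = "\<lambda>s P f. if ball_embedding r s P f ?g then ?o P else 0"
      note g = dcsbm_space_graph[OF \<omega>]
      have "?sum \<omega> \<le>
        (\<Sum>(s, P)\<in>K. \<Sum>f\<in>P \<rightarrow>\<^sub>E gverts ?g. ennreal (?w s P f))"
      proof (rule sum_mono, clarify)
        fix s P assume sP: "(s, P) \<in> K"
        have "?emb s P \<omega> \<le>
          (\<Sum>f\<in>embeddings P n. ennreal (?w s P f))"
          by (intro sum_mono) (auto simp: indicator_def embedding_event_def)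
        also have "\<dots> \<le> (\<Sum>f\<in>P \<rightarrow>\<^sub>E gverts ?g. ennreal (?w s P f))"
          using tree_shapeD(1)[OF sh(1)[OF sP]]
          by (intro sum_mono2) (auto simp: embeddings_def g intro: finite_PiE)
        finally show "?emb s P \<omega> \<le>
          (\<Sum>f\<in>P \<rightarrow>\<^sub>E gverts ?g. ennreal (?w s P f))" .
      qed
      also have "\<dots> = ennreal (\<Sum>(s, P)\<in>K. \<Sum>f\<in>P \<rightarrow>\<^sub>E gverts ?g. ?w s P f)"
        by (simp add: split_beta sum_ennreal sum_nonneg)
      also have "\<dots> \<le> ennreal 1"
        by (intro ennreal_leI sum_ball_embeddings_le_1[OF K(1) sh(1) g(1)])
      finally show ?thesis using True by simp
    qed
  qed
  also have "\<dots> = emeasure ?M (cover r n K S)"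
    using cover_sets[OF K S] dcsbm_props[OF n] by (intro nn_integral_indicator) simp
  finally show ?thesis .
qed

text \<open>The comparison of the two laws on the event that the tree has a shape in \<open>K\<close>.\<close>

lemma emeasure_bp_le_cover:
  assumes K: "finite K" "K \<subseteq> {1..q} \<times> {P. tree_shape q r P}" and S: "S \<in> sets iso_space" and n: "n \<ge> 1"
  shows "emeasure bp {\<omega> \<in> space bp. bp_shape r \<omega> \<in> K \<and> iso_class (bp_tree q r \<omega>) \<in> S} \<le>
    emeasure (dcsbm q a b \<nu> n) (cover r n K S) + (\<Sum>(s, P)\<in>K. deficit r n s P)"
proof -
  let ?E = "\<lambda>k. {\<omega> \<in> space bp. bp_shape r \<omega> = k \<and> iso_class (bp_tree q r \<omega>) \<in> S}"
  have E: "?E k \<in> sets bp" if "k \<in> K" for k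
    using bp_shape_event_sets(3)[of "{k}" r S] K(2) S that by auto
  have "{\<omega> \<in> space bp. bp_shape r \<omega> \<in> K \<and> iso_class (bp_tree q r \<omega>) \<in> S} = (\<Union>k\<in>K. ?E k)" by auto
  then have "emeasure bp {\<omega> \<in> space bp. bp_shape r \<omega> \<in> K \<and> iso_class (bp_tree q r \<omega>) \<in> S} \<le>
    (\<Sum>k\<in>K. emeasure bp (?E k))"
    using E by (simp only:) (intro emeasure_subadditive_finite[OF K(1)] image_subsetI)
  also have "\<dots> \<le> (\<Sum>(s, P)\<in>K. class_integral s P S (graph_density r n s P)
      + deficit r n s P)"
  proof (rule sum_mono)
    fix k assume k: "k \<in> K"
    obtain s P where sP: "k = (s, P)" by (cases k)
    have P: "tree_shape q r P" and s: "s \<in> {1..q}" using k K(2) by (auto simp: sP)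
    note [measurable] = measurable_graph_density[OF P] measurable_iso_class_indicator[OF P S]
    let ?m = "\<lambda>x. max 0 (tree_density r s P x - graph_density r n s P x)"
    let ?i = "\<lambda>x. indicator S (iso_class (tree_graph s P x)) :: ennreal"
    have "emeasure bp (?E k) =
      class_integral s P S (tree_density r s P)"
      unfolding sP by (rule emeasure_bp_tree_shape[OF P s S])
    also have "\<dots> \<le> (\<integral>\<^sup>+x. ennreal (graph_density r n s P x) * ?i x +
      ennreal (?m x) \<partial>weights P)"
    proof (rule nn_integral_mono)
      fix x
      have "ennreal (tree_density r s P x) \<le>
        ennreal (graph_density r n s P x + ?m x)"
        by (intro ennreal_leI) simp
      also have "\<dots> = ennreal (graph_density r n s P x) + ennreal (?m x)"
        using graph_density_nonneg by (rule ennreal_plus) simp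
      finally show "ennreal (tree_density r s P x) * ?i x \<le>
        ennreal (graph_density r n s P x) * ?i x +
        ennreal (?m x)"
        by (auto simp: indicator_def)
    qed
    also have "\<dots> = class_integral s P S (graph_density r n s P)
      + deficit r n s P"
      unfolding deficit_def by (rule nn_integral_add) measurable
    finally show "emeasure bp (?E k) \<le> (case k of (s, P) \<Rightarrow>
      class_integral s P S (graph_density r n s P) + deficit r n s P)"
      by (simp add: sP)
  qed
  also have "\<dots> = (\<Sum>(s, P)\<in>K. class_integral s P S (graph_density r n s P))
      + (\<Sum>(s, P)\<in>K. deficit r n s P)"
    by (simp add: split_beta sum.distrib)
  also have "\<dots> \<le> emeasure (dcsbm q a b \<nu> n) (cover r n K S) + (\<Sum>(s, P)\<in>K. deficit r n s P)"
    by (intro add_right_mono emeasure_cover_ge[OF K S n])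
  finally show ?thesis .
qed

abbreviation ball_law :: "nat \<Rightarrow> nat \<Rightarrow> nat mgraph set measure" where
  "ball_law r n \<equiv> distr (dcsbm q a b \<nu> n) iso_space (\<lambda>\<omega>. iso_class (root_ball r (dcsbm_graph n \<omega>)))"

abbreviation tree_law :: "nat \<Rightarrow> nat mgraph set measure" where
  "tree_law r \<equiv> distr bp iso_space (\<lambda>\<omega>. iso_class (bp_tree q r \<omega>))"

lemma measurable_ball_class:
  "n \<ge> 1 \<Longrightarrow> (\<lambda>\<omega>. iso_class (root_ball r (dcsbm_graph n \<omega>))) \<in> dcsbm q a b \<nu> n \<rightarrow>\<^sub>M iso_space"
  using measurable_root_ball_class[of r n] measurable_cong_sets[OF dcsbm_props(1) refl] by blast

lemma measurable_tree_class: "(\<lambda>\<omega>. iso_class (bp_tree q r \<omega>)) \<in> bp \<rightarrow>\<^sub>M iso_space"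
  using measurable_iso_class_bp_tree[of r] measurable_cong_sets[OF bp_props(1) refl] by blast

lemma prob_space_laws:
  shows "n \<ge> 1 \<Longrightarrow> prob_space (ball_law r n)" and "prob_space (tree_law r)"
  using dcsbm_props(3) measurable_ball_class bp_props(3) measurable_tree_class
  by (auto intro: prob_space.prob_space_distr)

abbreviation small_ball_prob :: "nat \<Rightarrow> nat \<Rightarrow> real" where
  "small_ball_prob r n \<equiv> \<P>(\<omega> in dcsbm q a b \<nu> n.
     real (card (gverts (root_ball r (dcsbm_graph n \<omega>)))) \<le> real n powr (1 / 9))"

text \<open>As balls with a shape in a finite set have bounded size, the second claim follows as well.\<close>

lemma fixed_radius:
  assumes \<epsilon>: "\<epsilon> > 0"
  shows "\<forall>\<^sub>F n in sequentially. tv_dist (ball_law r n) (tree_law r) \<le> 2 * \<epsilon> \<and> small_ball_prob r n \<ge> 1 - 2 * \<epsilon>"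
proof -
  interpret bp: prob_space bp by (rule bp_props)
  obtain K where K: "finite K" "K \<subseteq> {1..q} \<times> {P. tree_shape q r P}"
    and tight: "measure bp {\<omega> \<in> space bp. bp_shape r \<omega> \<in> K} > 1 - \<epsilon>"
    using bp_tree_tight[OF \<epsilon>] by blast
  let ?K = "{\<omega> \<in> space bp. bp_shape r \<omega> \<in> K}"
  have "(\<lambda>n. \<Sum>k\<in>K. deficit r n (fst k) (snd k)) \<longlonglongrightarrow> (\<Sum>k\<in>K. 0)"
    using K(2) by (intro tendsto_sum deficit_tendsto_0) auto
  then have "(\<lambda>n. \<Sum>k\<in>K. deficit r n (fst k) (snd k)) \<longlonglongrightarrow> 0" by simp
  then have d: "\<forall>\<^sub>F n in sequentially. (\<Sum>k\<in>K. deficit r n (fst k) (snd k)) < ennreal \<epsilon>"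
    by (rule order_tendstoD) (use \<epsilon> in simp)
  have c: "\<forall>\<^sub>F n in sequentially. real (\<Sum>k\<in>K. card (snd k)) \<le> real n powr (1 / 9)"
  proof -
    define m where "m = Suc (\<Sum>k\<in>K. card (snd k))"
    have m: "real m > 0" unfolding m_def of_nat_0_less_iff by (rule zero_less_Suc)
    show ?thesis using eventually_ge_at_top[of "m ^ 9"]
    proof eventually_elim
      case (elim n)
      have "real m = (real m powr 9) powr (1 / 9)" using m by (simp only: powr_powr) simp
      also have "real m powr 9 = real (m ^ 9)" using m by (simp add: powr_numeral)
      also have "\<dots> powr (1 / 9) \<le> real n powr (1 / 9)" using elim by (intro powr_mono2) auto
      finally show ?case by (simp add: m_def)
    qed
  qed
  show ?thesis
    using d c eventually_ge_at_top[of 1]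
  proof eventually_elim
    case (elim n)
    interpret G: prob_space "dcsbm q a b \<nu> n" by (rule dcsbm_props(3)[OF elim(3)])
    note Gs = dcsbm_props(1,2)[OF elim(3)]
    have KU: "K \<subseteq> UNIV \<times> {P. tree_shape q r P}" using K(2) by auto
    note Kev = bp_shape_event_sets(1)[OF KU sets.top]
    let ?T = "\<lambda>S. {\<omega> \<in> space bp. iso_class (bp_tree q r \<omega>) \<in> S}"
    have main: "measure bp (?T S) \<le> G.prob (cover r n K S) + 2 * \<epsilon>"
      if S: "S \<in> sets iso_space" for S
    proof -
      let ?A = "{\<omega> \<in> space bp. bp_shape r \<omega> \<in> K \<and> iso_class (bp_tree q r \<omega>) \<in> S}"
      note Sev = bp_shape_event_sets(2)[OF KU S]
      have A: "?A = ?K \<inter> (?T S)" by auto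
      have "ennreal (measure bp ?A) \<le> ennreal (G.prob (cover r n K S)) + ennreal \<epsilon>"
        using emeasure_bp_le_cover[OF K S elim(3)] elim(1)
        unfolding bp.emeasure_eq_measure G.emeasure_eq_measure split_beta
        by (meson add_left_mono less_imp_le order_trans)
      also have "\<dots> = ennreal (G.prob (cover r n K S) + \<epsilon>)" using \<epsilon> by (subst ennreal_plus) auto
      finally have 1: "measure bp ?A \<le> G.prob (cover r n K S) + \<epsilon>"
        using \<epsilon> by (subst (asm) ennreal_le_iff) (auto intro: add_nonneg_nonneg)
      have "measure bp (?T S) \<le> measure bp (?A \<union> (space bp - ?K))"
        using Sev Kev unfolding A by (intro bp.finite_measure_mono) auto
      also have "\<dots> \<le> measure bp ?A + measure bp (space bp - ?K)"
        using Sev Kev unfolding A by (intro measure_Un_le) auto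
      also have "measure bp (space bp - ?K) < \<epsilon>"
        using bp.prob_compl[OF Kev] tight by simp
      finally show ?thesis using 1 by simp
    qed
    have tv: "tv_dist (ball_law r n) (tree_law r) \<le> 2 * \<epsilon>"
    proof (rule tv_dist_le_one_sided[OF prob_space_laws(1)[OF elim(3)] prob_space_laws(2)])
      fix S assume "S \<in> sets (ball_law r n)"
      then have S: "S \<in> sets iso_space" by simp
      let ?B = "{\<omega> \<in> space (dcsbm q a b \<nu> n). iso_class (root_ball r (dcsbm_graph n \<omega>)) \<in> S}"
      have B: "?B \<in> sets (dcsbm q a b \<nu> n)"
        using measurable_sets[OF measurable_ball_class[OF elim(3)] S, of r] by (simp add: vimage_def Int_def conj_commute)
      have "G.prob (cover r n K S) \<le> G.prob ?B"
        using B by (intro G.finite_measure_mono) (auto simp: cover_def embedding_event_def Gs)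
      moreover have "measure (ball_law r n) S = G.prob ?B"
        using S by (subst measure_distr[OF measurable_ball_class[OF elim(3)]]) (auto intro!: arg_cong[where f = "G.prob"])
      moreover have "measure (tree_law r) S = measure bp (?T S)"
        using S by (subst measure_distr[OF measurable_tree_class]) (auto intro!: arg_cong[where f = "measure bp"])
      ultimately show "measure (tree_law r) S \<le> measure (ball_law r n) S + 2 * \<epsilon>" using main[OF S] by simp
    qed simp
    let ?C = "{\<omega> \<in> space (dcsbm q a b \<nu> n). real (card (gverts (root_ball r (dcsbm_graph n \<omega>)))) \<le> real n powr (1 / 9)}"
    have C: "?C \<in> sets (dcsbm q a b \<nu> n)"
    proof -
      have "?C = (\<lambda>\<omega>. card (gverts (root_ball r (dcsbm_graph n \<omega>)))) -` {k. real k \<le> real n powr (1 / 9)}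
          \<inter> space (dcsbm_space n)" unfolding Gs by blast
      also have "\<dots> \<in> sets (dcsbm_space n)" by (rule measurable_sets[OF measurable_root_ball_card]) simp
      finally show ?thesis unfolding Gs .
    qed
    have "cover r n K (space iso_space) \<subseteq> ?C"
    proof
      fix \<omega> assume "\<omega> \<in> cover r n K (space iso_space)"
      then obtain s P f where sP: "(s, P) \<in> K" and w: "\<omega> \<in> space (dcsbm_space n)"
        and f: "ball_embedding r s P f (dcsbm_graph n \<omega>)"
        by (auto simp: cover_def embedding_event_def)
      have P: "tree_shape q r P" using sP K(2) by auto
      have "gverts (root_ball r (dcsbm_graph n \<omega>)) = f ` P"
        using ball_embedding_vertices[OF P f dcsbm_space_graph(1)[OF w]] .
      then have "card (gverts (root_ball r (dcsbm_graph n \<omega>))) = card P"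
        using f by (simp add: ball_embedding_def card_image)
      also have "\<dots> \<le> (\<Sum>k\<in>K. card (snd k))"
        using member_le_sum[OF sP, of "\<lambda>k. card (snd k)"] K(1) by simp
      finally have "real (card (gverts (root_ball r (dcsbm_graph n \<omega>)))) \<le> real (\<Sum>k\<in>K. card (snd k))"
        by (rule of_nat_mono)
      then show "\<omega> \<in> ?C" using w elim(2) by (simp add: Gs)
    qed
    then have "G.prob (cover r n K (space iso_space)) \<le> small_ball_prob r n"
      using C by (rule G.finite_measure_mono)
    moreover have "measure bp {\<omega> \<in> space bp. iso_class (bp_tree q r \<omega>) \<in> space iso_space} = 1"
    proof -
      have "{\<omega> \<in> space bp. iso_class (bp_tree q r \<omega>) \<in> space iso_space} = space bp"
        using measurable_space[OF measurable_tree_class] by auto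
      then show ?thesis using bp.prob_space by simp
    qed
    ultimately show ?case using tv main[OF sets.top] by simp
  qed
qed

end

section \<open>Letting the radius grow\<close>

lemma diagonal_radius:
  fixes c :: "nat \<Rightarrow> nat \<Rightarrow> real"
  assumes c: "\<And>r. c r \<longlonglongrightarrow> 0" and nonneg: "\<And>r n. c r n \<ge> 0"
  shows "\<exists>R :: nat \<Rightarrow> nat. mono R \<and> \<not> bdd_above (range R) \<and> (\<lambda>n. c (R n) n) \<longlonglongrightarrow> 0"
proof -
  \<comment> \<open>The radii that are safe from \<open>n\<close> on; this set increases with \<open>n\<close>, and so does its maximum.\<close>
  define A where "A n = insert 0 {r. r \<le> n \<and> (\<forall>m\<ge>n. c r m < 1 / real (Suc r))}" for n
  define R where "R n = Max (A n)" for n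
  have fA: "finite (A n)" and nA: "A n \<noteq> {}" for n
    by (auto simp: A_def intro: finite_subset[of _ "insert 0 {..n}"])
  have large: "\<exists>n0. \<forall>n\<ge>n0. r \<in> A n" for r
  proof -
    have "\<forall>\<^sub>F n in sequentially. c r n < 1 / real (Suc r)" by (rule order_tendstoD[OF c]) simp
    then obtain n1 where "\<forall>n\<ge>n1. c r n < 1 / real (Suc r)" by (auto simp: eventually_sequentially)
    then have "\<forall>n\<ge>max r n1. r \<in> A n" by (auto simp: A_def)
    then show ?thesis by blast
  qed
  have ge: "r \<le> R n" if "r \<in> A n" for r n unfolding R_def using fA that by (rule Max_ge)
  have RA: "R n \<in> A n" for n unfolding R_def using fA nA by (rule Max_in)
  have "mono R"
  proof (rule monoI)
    fix m n :: nat assume "m \<le> n"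
    then have "A m \<subseteq> A n" by (auto simp: A_def)
    then show "R m \<le> R n" using RA ge by blast
  qed
  moreover have "\<not> bdd_above (range R)"
  proof
    assume "bdd_above (range R)"
    then obtain B where B: "\<And>n. R n \<le> B" by (auto simp: bdd_above_def)
    obtain n where "Suc B \<in> A n" using large[of "Suc B"] by auto
    then show False using ge[of "Suc B" n] B[of n] by simp
  qed
  moreover have "(\<lambda>n. c (R n) n) \<longlonglongrightarrow> 0"
  proof (rule LIMSEQ_I)
    fix \<epsilon> :: real assume "\<epsilon> > 0"
    then obtain r where r: "1 / real (Suc r) < \<epsilon>" using nat_approx_posE by blast
    obtain n0 where n0: "\<forall>n\<ge>n0. Suc r \<in> A n" using large by blast
    show "\<exists>no. \<forall>n\<ge>no. norm (c (R n) n - 0) < \<epsilon>"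
    proof (intro exI allI impI)
      fix n assume "n \<ge> n0"
      then have R: "Suc r \<le> R n" using ge n0 by blast
      then have "c (R n) n < 1 / real (Suc (R n))" using RA[of n] by (auto simp: A_def)
      also have "\<dots> \<le> 1 / real (Suc r)" using R by (intro divide_left_mono) auto
      finally show "norm (c (R n) n - 0) < \<epsilon>" using r nonneg[of "R n" n] by simp
    qed
  qed
  ultimately show ?thesis by (intro exI[of _ R] conjI)
qed

lemma (in dcsbm_model) local_limit:
  "\<exists>R :: nat \<Rightarrow> nat. mono R \<and> \<not> bdd_above (range R) \<and>
    (\<lambda>n. tv_dist (ball_law (R n) n) (tree_law (R n))) \<longlonglongrightarrow> 0 \<and>
    (\<lambda>n. small_ball_prob (R n) n) \<longlonglongrightarrow> 1"
proof -
  let ?c = "\<lambda>r n. \<bar>tv_dist (ball_law r n) (tree_law r)\<bar> + \<bar>small_ball_prob r n - 1\<bar>"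
  have "?c r \<longlonglongrightarrow> 0" for r
  proof (rule LIMSEQ_I)
    fix \<epsilon> :: real assume \<epsilon>: "\<epsilon> > 0"
    have "\<forall>\<^sub>F n in sequentially. tv_dist (ball_law r n) (tree_law r) \<le> 2 * (\<epsilon> / 5) \<and> small_ball_prob r n \<ge> 1 - 2 * (\<epsilon> / 5)"
      by (rule fixed_radius) (use \<epsilon> in simp)
    then have "\<forall>\<^sub>F n in sequentially. norm (?c r n - 0) < \<epsilon>"
      using eventually_ge_at_top[of 1]
    proof eventually_elim
      case (elim n)
      have "tv_dist (ball_law r n) (tree_law r) \<ge> 0"
        using prob_space_laws elim(2) by (intro tv_dist_nonneg)
      moreover have "small_ball_prob r n \<le> 1" using prob_space.prob_le_1[OF dcsbm_props(3)[OF elim(2)]] .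
      ultimately show ?case using elim \<epsilon> by simp
    qed
    then show "\<exists>no. \<forall>n\<ge>no. norm (?c r n - 0) < \<epsilon>" by (simp add: eventually_sequentially)
  qed
  then obtain R :: "nat \<Rightarrow> nat" where R: "mono R" "\<not> bdd_above (range R)" and lim: "(\<lambda>n. ?c (R n) n) \<longlonglongrightarrow> 0"
    using diagonal_radius[of ?c] by auto
  have "(\<lambda>n. tv_dist (ball_law (R n) n) (tree_law (R n))) \<longlonglongrightarrow> 0"
    by (rule Lim_null_comparison[OF _ lim]) simp
  moreover have "(\<lambda>n. small_ball_prob (R n) n - 1) \<longlonglongrightarrow> 0"
    by (rule Lim_null_comparison[OF _ lim]) simp
  then have "(\<lambda>n. small_ball_prob (R n) n) \<longlonglongrightarrow> 1" by (simp add: LIM_zero_iff)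
  ultimately show ?thesis using R by (intro exI[of _ R] conjI)
qed

text \<open>The mean is at most the sum of the tails.\<close>

lemma integrable_of_tail:
  fixes M :: "real measure"
  assumes "prob_space M" and s[measurable_cong]: "sets M = sets borel" and nonneg: "AE x in M. 0 \<le> x" and \<beta>: "\<beta> > 1"
    and tail: "\<forall>\<^sub>F k::nat in at_top. measure M {real k..} \<le> real k powr (- \<beta>)"
  shows "integrable M (\<lambda>x. x)"
proof -
  interpret prob_space M by fact
  have sm: "summable (\<lambda>k. measure M {real k..})"
  proof (rule summable_comparison_test_ev)
    show "\<forall>\<^sub>F k::nat in sequentially. norm (measure M {real k..}) \<le> real k powr (- \<beta>)" using tail by simp
    show "summable (\<lambda>k. real k powr (- \<beta>))" using \<beta> by (simp add: summable_real_powr_iff)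
  qed
  have le: "ennreal x \<le> (\<Sum>k. indicator {real k..} x)" if "0 \<le> x" for x :: real
  proof -
    have "ennreal x \<le> ennreal (real (nat \<lceil>x\<rceil>))" using that by (intro ennreal_leI) linarith
    also have "\<dots> = (\<Sum>k<nat \<lceil>x\<rceil>. 1)" by (simp add: ennreal_of_nat_eq_real_of_nat)
    also have "\<dots> = (\<Sum>k<nat \<lceil>x\<rceil>. indicator {real k..} x)"
    proof (intro sum.cong refl)
      fix k assume "k \<in> {..<nat \<lceil>x\<rceil>}"
      then have "real k \<le> x" by (simp add: less_ceiling_iff zless_nat_eq_int_zless)
      then show "1 = (indicator {real k..} x :: ennreal)" by simp
    qed
    also have "\<dots> \<le> (\<Sum>k. indicator {real k..} x)" by (rule sum_le_suminf) auto
    finally show ?thesis .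
  qed
  have "(\<integral>\<^sup>+x. ennreal (norm x) \<partial>M) \<le> (\<integral>\<^sup>+x. (\<Sum>k. indicator {real k..} x) \<partial>M)"
    using nonneg by (intro nn_integral_mono_AE) (auto elim!: eventually_mono intro: le)
  also have "\<dots> = (\<Sum>k. \<integral>\<^sup>+x. indicator {real k..} x \<partial>M)"
    by (rule nn_integral_suminf) measurable
  also have "\<dots> = (\<Sum>k. ennreal (measure M {real k..}))"
    by (simp add: emeasure_eq_measure s)
  also have "\<dots> < \<infinity>"
    unfolding infinity_ennreal_def less_top[symmetric] by (rule ennreal_suminf_neq_top[OF sm]) simp
  finally show ?thesis by (intro integrableI_bounded) auto
qed

theorem theorem3p1:
  fixes q :: nat and a b \<phi>\<^sub>m\<^sub>i\<^sub>n \<beta> :: real and W :: "real set" and \<nu> :: "real measure"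
  assumes "q \<ge> 2" and "a > 0" and "b > 0"
    and "\<phi>\<^sub>m\<^sub>i\<^sub>n > 0" and "W \<in> sets borel" and "W \<subseteq> {\<phi>\<^sub>m\<^sub>i\<^sub>n..}"
    and "prob_space \<nu>" and "sets \<nu> = sets borel" and "AE x in \<nu>. x \<in> W"
    and "\<beta> > 8"
    and "\<forall>\<^sub>F k::nat in at_top. measure \<nu> {real k..} \<le> real k powr (- \<beta>)"
  shows "\<exists>R :: nat \<Rightarrow> nat. mono R \<and> \<not> bdd_above (range R) \<and>
    (\<lambda>n. tv_dist
        (distr (dcsbm q a b \<nu> n) iso_space (\<lambda>\<omega>. iso_class (root_ball (R n) (dcsbm_graph n \<omega>))))
        (distr (branching_process q a b W \<nu>) iso_space (\<lambda>\<omega>. iso_class (bp_tree q (R n) \<omega>))))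
      \<longlonglongrightarrow> 0 \<and>
    (\<lambda>n. \<P>(\<omega> in dcsbm q a b \<nu> n.
        real (card (gverts (root_ball (R n) (dcsbm_graph n \<omega>)))) \<le> real n powr (1 / 9)))
      \<longlonglongrightarrow> 1"
proof -
  have ge: "AE x in \<nu>. \<phi>\<^sub>m\<^sub>i\<^sub>n \<le> x" using assms(9,6) by (auto elim!: eventually_mono)
  then have "AE x in \<nu>. 0 \<le> x" using assms(4) by (auto elim!: eventually_mono)
  then have "integrable \<nu> (\<lambda>x. x)"
    using assms(10) by (intro integrable_of_tail[OF assms(7,8) _ _ assms(11)]) auto
  then interpret dcsbm_model \<nu> q a b \<phi>\<^sub>m\<^sub>i\<^sub>n W
    using assms ge by (intro dcsbm_model.intro dcsbm_model_axioms.intro) auto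
  show ?thesis by (rule local_limit)
qed

end
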